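(* If $f_n:\{0,1\}^{V_n}\to\{-1,1\}$, $n\in\mathbb{N}$, are monotone and the sequence $\{f_n\}_{n\in\mathbb{N}}$ is NS, then the sequence is CGXS.
   Context: $\{V_n\}$ is an increasing sequence of finite sets. $f_n$ is monotone if $f_n(\omega)\le f_n(\omega')$ whenever $\omega_i\le\omega'_i$ for every $i$. Let $\omega$ be uniform on $\{0,1\}^{V_n}$; for $\epsilon\in(0,1)$, $\omega^\epsilon$ is obtained from $\omega$ by resampling each coordinate (as a fair bit) independently with probability $\epsilon$. NS (noise sensitive): for every $\epsilon\in(0,1)$, $\lim_{n\to\infty}\mathbb{E}[f_n(\omega)f_n(\omega^\epsilon)]-\mathbb{E}[f_n(\omega)]^2=0$. Complete graph exclusion process on $V_n$: to every unordered pair of distinct elements of $V_n$ associate an independent Poisson clock of rate $1/|V_n|$; when it rings, the two elements are interchanged. $\pi^n_t$ is the random permutation of $V_n$ obtained by composing, in order, all transpositions up to time $t$. With $\eta^n_0$ uniform on $\{0,1\}^{V_n}$ and independent of the clocks, $\eta^n_t(x)=\eta^n_0((\pi^n_t)^{-1}(x))$. CGXS (complete graph exclusion sensitive): for some $t>0$ (equivalently, for all $t>0$), $\lim_{n\to\infty}\mathbb{E}[f_n(\eta^n_0)f_n(\eta^n_t)]-\mathbb{E}[f_n(\eta^n_0)]^2=0$. *)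

theory Defs
  imports "HOL-Probability.Probability"
begin

text \<open>
  Configurations in \<open>{0,1}\<^sup>V\<close> are extensional functions \<open>V \<rightarrow>\<^sub>E UNIV\<close> into \<open>bool\<close>
  (\<open>False\<close> is 0, \<open>True\<close> is 1). As they all agree outside \<open>V\<close>, the pointwise order on functions,
  restricted to them, is the coordinatewise order over \<open>V\<close>.
\<close>

definition configs :: "'v set \<Rightarrow> ('v \<Rightarrow> bool) set" where
  "configs V = V \<rightarrow>\<^sub>E UNIV"

definition uniform_config :: "'v set \<Rightarrow> ('v \<Rightarrow> bool) pmf" where
  "uniform_config V = pmf_of_set (configs V)"

text \<open>
  Joint law of \<open>(\<omega>, \<omega>\<^sup>\<epsilon>)\<close>: \<open>r\<close> marks the coordinates to be resampled and \<open>\<xi>\<close> supplies the fresh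
  fair bits.
\<close>

definition noise_pair :: "'v set \<Rightarrow> real \<Rightarrow> (('v \<Rightarrow> bool) \<times> ('v \<Rightarrow> bool)) pmf" where
  "noise_pair V \<epsilon> =
     do {
       \<omega> \<leftarrow> uniform_config V;
       r \<leftarrow> Pi_pmf V undefined (\<lambda>_. bernoulli_pmf \<epsilon>);
       \<xi> \<leftarrow> uniform_config V;
       return_pmf (\<omega>, \<lambda>x\<in>V. if r x then \<xi> x else \<omega> x)
     }"

definition noise_sensitive :: "(nat \<Rightarrow> 'v set) \<Rightarrow> (nat \<Rightarrow> ('v \<Rightarrow> bool) \<Rightarrow> real) \<Rightarrow> bool" where
  "noise_sensitive V f \<longleftrightarrow>
     (\<forall>\<epsilon>. 0 < \<epsilon> \<and> \<epsilon> < 1 \<longrightarrow>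
       (\<lambda>n. measure_pmf.expectation (noise_pair (V n) \<epsilon>) (\<lambda>(\<omega>, \<omega>'). f n \<omega> * f n \<omega>')
             - (measure_pmf.expectation (uniform_config (V n)) (f n))\<^sup>2) \<longlonglongrightarrow> 0)"

definition edges :: "'v set \<Rightarrow> 'v set set" where
  "edges V = {e. e \<subseteq> V \<and> card e = 2}"

definition edge_swap :: "'v set \<Rightarrow> 'v \<Rightarrow> 'v" where
  "edge_swap e x = (if x \<in> e then the_elem (e - {x}) else x)"

text \<open>
  The probability space carries \<open>\<eta>\<^sub>0\<close> together with the waiting times \<open>c (e, k)\<close> of the clocks:
  a Poisson clock of rate \<open>\<lambda>\<close> is one whose successive waiting times are independent and
  exponentially distributed with parameter \<open>\<lambda>\<close>. If \<open>V\<close> has fewer than two elements there are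
  no clocks, so the value of \<open>1 / card V\<close> for empty \<open>V\<close> plays no role.
\<close>

definition exclusion_space ::
    "'v set \<Rightarrow> (('v \<Rightarrow> bool) \<times> ('v set \<times> nat \<Rightarrow> real)) measure" where
  "exclusion_space V =
     measure_pmf (uniform_config V) \<Otimes>\<^sub>M
     (\<Pi>\<^sub>M _\<in>edges V \<times> UNIV. density lborel (exponential_density (1 / real (card V))))"

definition ring_time :: "('v set \<times> nat \<Rightarrow> real) \<Rightarrow> 'v set \<Rightarrow> nat \<Rightarrow> real" where
  "ring_time c e k = (\<Sum>j\<le>k. c (e, j))"

definition ring_times :: "'v set \<Rightarrow> real \<Rightarrow> ('v set \<times> nat \<Rightarrow> real) \<Rightarrow> real set" where
  "ring_times V t c = {ring_time c e k |e k. e \<in> edges V \<and> ring_time c e k \<le> t}"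

text \<open>
  Almost surely, no two clocks ring at the same time, and only finitely many rings occur up to
  time \<open>t\<close>. The choice operator below and \<^const>\<open>sorted_list_of_set\<close> (which is empty on infinite
  sets) therefore only make an arbitrary decision on a null event.
\<close>

definition ringing_edge :: "'v set \<Rightarrow> ('v set \<times> nat \<Rightarrow> real) \<Rightarrow> real \<Rightarrow> 'v set" where
  "ringing_edge V c s = (SOME e. e \<in> edges V \<and> (\<exists>k. ring_time c e k = s))"

text \<open>The transposition of a later ring is applied after those of the earlier rings.\<close>

definition interchange_perm :: "'v set \<Rightarrow> real \<Rightarrow> ('v set \<times> nat \<Rightarrow> real) \<Rightarrow> 'v \<Rightarrow> 'v" where
  "interchange_perm V t c =
     fold (\<lambda>s \<pi>. edge_swap (ringing_edge V c s) \<circ> \<pi>) (sorted_list_of_set (ring_times V t c)) id"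

definition exclusion_config ::
    "'v set \<Rightarrow> real \<Rightarrow> ('v \<Rightarrow> bool) \<times> ('v set \<times> nat \<Rightarrow> real) \<Rightarrow> 'v \<Rightarrow> bool" where
  "exclusion_config V t = (\<lambda>(\<eta>\<^sub>0, c). \<lambda>x\<in>V. \<eta>\<^sub>0 (inv (interchange_perm V t c) x))"

definition complete_graph_exclusion_sensitive ::
    "(nat \<Rightarrow> 'v set) \<Rightarrow> (nat \<Rightarrow> ('v \<Rightarrow> bool) \<Rightarrow> real) \<Rightarrow> bool" where
  "complete_graph_exclusion_sensitive V f \<longleftrightarrow>
     (\<exists>t>0.
       (\<lambda>n. (\<integral>w. f n (fst w) * f n (exclusion_config (V n) t w) \<partial>exclusion_space (V n))
             - (\<integral>w. f n (fst w) \<partial>exclusion_space (V n))\<^sup>2) \<longlonglongrightarrow> 0)"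

end

(*
  Write n = |V| and, for sets X and Y of ones, let Psi(X,Y) be the average of f(sigma X) f(sigma Y)
  over all permutations sigma of V. Both E[f(omega) f(omega^eps)] and E[f(eta_0) f(eta_t)] are
  averages of Psi, over a pair of sets that is either the noise pair or (S, pi S) with pi the
  interchange permutation; the latter uses that the law of pi is invariant under conjugation.

  Psi depends only on the sizes of the intersection and of the two differences of X and Y.
  Monotonicity bounds the effect on Psi of enlarging X and Y by the increments of the level
  averages g(k) = E[f | k ones]. By noise sensitivity f is asymptotically uncorrelated with the
  magnetization, and as g is monotone this forces g(n/2 + K sqrt n) - g(n/2 - K sqrt n) -> 0 for
  every fixed K. Hence Psi is nearly constant on all pairs whose three sizes agree up to
  M sqrt n with the typical sizes of the noise pair with parameter eps.

  With high probability j = |S - pi S| lies between n/512 and n/8 for t = 1/16: edges that ring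
  exactly once and whose neighbours do not ring bound j from below, vertices without any ring bound
  it from above, and both are counted by a second moment argument. So (S, pi S) is typical for
  eps = 4j/n, which is at least 1/128, and since the noise correlation is antitone in eps,
  sensitivity at the single value 1/128 gives Psi(S, pi S) - E[f]^2 -> 0 uniformly.
*)
theory Submission
  imports Defs
begin

section \<open>Noise on random subsets\<close>

text \<open>Exclusion preserves the number of ones and noise does not, so the two pairs can only be
  matched up to fluctuations of order sqrt n in the three sizes; flatness of g on that scale absorbs
  them. Flatness comes from testing f against the normalized magnetization, which noise damps only
  by the factor 1 - eps.

  NS is a separate limit for each eps, whereas 4j/n is random and moves with n; hence the comparison
  with one fixed parameter below all values that matter.

  Exclusion sensitivity asks for one positive time, and t is chosen so small that most points never
  move. The bound n/8 on j leaves room inside V for a common enlargement of two typical pairs, whose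
  union may have n/2 + j + 4w points for the width w = M sqrt n. The limit in n is taken with M
  fixed; the remaining error of order 1/M^2 is removed only afterwards.

  All this presupposes that the sizes of the sets tend to infinity. As the sets increase, the
  alternative is that the sizes stay bounded. Then a non-constant function with values 1 and -1 has
  noise correlation exceeding its squared mean by a fixed amount, so NS forces the functions to be
  eventually constant.\<close>

text \<open>\<open>bav V p h\<close> is the mean of \<open>h\<close> over the random subset of \<open>V\<close> that contains each point
  independently with probability \<open>p\<close>; configurations are identified with their sets of ones.\<close>

definition bav :: "'v set \<Rightarrow> real \<Rightarrow> ('v set \<Rightarrow> real) \<Rightarrow> real" where
  "bav V p h = (\<Sum>R\<in>Pow V. p ^ card R * (1 - p) ^ card (V - R) * h R)"

abbreviation av :: "'v set \<Rightarrow> ('v set \<Rightarrow> real) \<Rightarrow> real" where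
  "av V \<equiv> bav V (1 / 2)"

lemma bav_empty [simp]: "bav {} p h = h {}"
  by (simp add: bav_def)

lemma bav_insert:
  assumes "finite V" "x \<notin> V"
  shows "bav (insert x V) p h = p * bav V p (\<lambda>R. h (insert x R)) + (1 - p) * bav V p h"
proof -
  have inj: "inj_on (insert x) (Pow V)"
    using assms(2) by (auto simp: inj_on_def insert_ident)
  have disj: "Pow V \<inter> insert x ` Pow V = {}"
    using assms(2) by auto
  have [simp]: "card (insert x R) = Suc (card R)" "insert x V - insert x R = V - R"
      "card (insert x V - R) = Suc (card (V - R))" if "R \<subseteq> V" for R
  proof -
    show "card (insert x R) = Suc (card R)"
      using assms that finite_subset by (subst card_insert_disjoint) auto
    show "insert x V - insert x R = V - R"
      using assms(2) by auto
    have "insert x V - R = insert x (V - R)"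
      using assms(2) that by auto
    thus "card (insert x V - R) = Suc (card (V - R))"
      using assms by auto
  qed
  show ?thesis
    unfolding bav_def Pow_insert using assms inj disj
    by (simp add: sum.union_disjoint sum.reindex sum_distrib_left mult_ac add.commute)
qed

lemma bav_cong: "(\<And>R. R \<subseteq> V \<Longrightarrow> h R = h' R) \<Longrightarrow> bav V p h = bav V p h'"
  by (simp add: bav_def)

lemma bav_add: "bav V p (\<lambda>R. h R + h' R) = bav V p h + bav V p h'"
  by (simp add: bav_def distrib_left sum.distrib)

lemma bav_diff: "bav V p (\<lambda>R. h R - h' R) = bav V p h - bav V p h'"
  by (simp add: bav_def right_diff_distrib sum_subtractf)

lemma bav_cmult: "bav V p (\<lambda>R. a * h R) = a * bav V p h"
  by (simp add: bav_def sum_distrib_left mult_ac)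

lemma bav_multc: "bav V p (\<lambda>R. h R * a) = bav V p h * a"
  by (simp add: bav_def sum_distrib_right mult.assoc)

lemma bav_divide: "bav V p (\<lambda>R. h R / a) = bav V p h / a"
  by (simp add: bav_def sum_divide_distrib)

lemma bav_sum: "bav V p (\<lambda>R. \<Sum>i\<in>I. h i R) = (\<Sum>i\<in>I. bav V p (h i))"
  by (simp add: bav_def sum_distrib_left sum.swap[of _ I])

lemma bav_swap: "bav V p (\<lambda>R. bav W p' (h R)) = bav W p' (\<lambda>T. bav V p (\<lambda>R. h R T))"
  unfolding bav_def sum_distrib_left by (subst sum.swap) (simp add: mult_ac)

lemma bav_const: "finite V \<Longrightarrow> bav V p (\<lambda>R. a) = a"
  by (induction V rule: finite_induct) (auto simp: bav_insert algebra_simps)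

lemma bav_mono:
  assumes "0 \<le> p" "p \<le> 1" "\<And>R. R \<subseteq> V \<Longrightarrow> h R \<le> h' R"
  shows "bav V p h \<le> bav V p h'"
  unfolding bav_def using assms by (intro sum_mono mult_left_mono) auto

lemma bav_nonneg:
  assumes "0 \<le> p" "p \<le> 1" "\<And>R. R \<subseteq> V \<Longrightarrow> 0 \<le> h R"
  shows "0 \<le> bav V p h"
  unfolding bav_def using assms by (intro sum_nonneg mult_nonneg_nonneg) auto

lemma bav_ge_term:
  assumes "finite V" "0 \<le> p" "p \<le> 1" "\<And>R. R \<subseteq> V \<Longrightarrow> 0 \<le> h R" "R \<subseteq> V"
  shows "p ^ card R * (1 - p) ^ card (V - R) * h R \<le> bav V p h"
  unfolding bav_def using assms
  by (intro member_le_sum[where f = "\<lambda>R. p ^ card R * (1 - p) ^ card (V - R) * h R"]) auto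

text \<open>Induction on the points: raising the inclusion probability of one point moves mass
  \<open>p' - p\<close> from sets without it to sets with it, where \<open>h\<close> is smaller.
  This later trades a varying noise parameter for a fixed smaller one.\<close>

lemma bav_antimono_prob:
  assumes "finite V" "0 \<le> p" "p \<le> p'" "p' \<le> 1"
    and "\<And>R R'. R \<subseteq> R' \<Longrightarrow> R' \<subseteq> V \<Longrightarrow> h R' \<le> h R"
  shows "bav V p' h \<le> bav V p h"
  using assms(1,5)
proof (induction V arbitrary: h rule: finite_induct)
  case (insert x V)
  let ?h' = "\<lambda>R. h (insert x R)"
  have 1: "bav V p' ?h' \<le> bav V p ?h'"
    by (rule insert.IH) (auto intro!: insert.prems)
  have 2: "bav V p' h \<le> bav V p h"
    by (rule insert.IH) (auto intro!: insert.prems)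
  have 3: "bav V p ?h' \<le> bav V p h"
    using assms by (intro bav_mono insert.prems) auto
  have "p' * bav V p' ?h' + (1 - p') * bav V p' h \<le> p' * bav V p ?h' + (1 - p') * bav V p h"
    using assms 1 2 by (intro add_mono mult_left_mono) auto
  also have "\<dots> = p * bav V p ?h' + (1 - p) * bav V p h - (p' - p) * (bav V p h - bav V p ?h')"
    by (simp add: algebra_simps)
  also have "\<dots> \<le> p * bav V p ?h' + (1 - p) * bav V p h"
    using assms(3) 3 by simp
  finally show ?case
    using insert.hyps by (simp add: bav_insert)
qed simp

lemma bav_mem:
  assumes "finite V" "x \<in> V"
  shows "bav V p (\<lambda>R. if x \<in> R then a else b) = p * a + (1 - p) * b"
proof -
  have V: "V = insert x (V - {x})"
    using assms by auto
  have 1: "bav (V - {x}) p (\<lambda>R. if x \<in> R then a else b) = bav (V - {x}) p (\<lambda>R. b)"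
    by (rule bav_cong) auto
  show ?thesis
    using assms by (subst V, subst bav_insert) (simp_all add: bav_const 1)
qed

lemma bav_mem2:
  assumes "finite V" "x \<in> V" "y \<in> V" "x \<noteq> y"
  shows "bav V p (\<lambda>R. (if x \<in> R then a else b) * (if y \<in> R then c else d)) =
    (p * a + (1 - p) * b) * (p * c + (1 - p) * d)"
proof -
  have V: "V = insert x (V - {x})"
    using assms by auto
  have 1: "bav (V - {x}) p (\<lambda>R. (if x \<in> R then a else b) * (if y \<in> R then c else d)) =
      bav (V - {x}) p (\<lambda>R. b * (if y \<in> R then c else d))"
    by (rule bav_cong) auto
  show ?thesis
    using assms
    by (subst V, subst bav_insert) (simp_all add: 1 bav_cmult bav_mem algebra_simps)
qed

lemma bav_bij:
  assumes "finite V" "bij_betw g V V"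
  shows "bav V p (\<lambda>S. h (g ` S)) = bav V p h"
proof -
  have inj: "inj_on g V" and im: "g ` V = V"
    using assms(2) by (auto simp: bij_betw_def)
  have bij: "bij_betw ((`) g) (Pow V) (Pow V)"
    using bij_betw_Pow[OF assms(2)] .
  have "bav V p h = (\<Sum>R\<in>Pow V. p ^ card (g ` R) * (1 - p) ^ card (V - g ` R) * h (g ` R))"
    unfolding bav_def using sum.reindex_bij_betw[OF bij] by (rule sym)
  also have "\<dots> = bav V p (\<lambda>S. h (g ` S))"
    unfolding bav_def
  proof (rule sum.cong[OF refl])
    fix R assume R: "R \<in> Pow V"
    have "V - g ` R = g ` (V - R)"
      using R im inj by (subst inj_on_image_set_diff[OF inj]) auto
    thus "p ^ card (g ` R) * (1 - p) ^ card (V - g ` R) * h (g ` R) =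
        p ^ card R * (1 - p) ^ card (V - R) * h (g ` R)"
      using R inj by (auto simp: card_image inj_on_subset)
  qed
  finally show ?thesis ..
qed

lemma av_eq: "finite V \<Longrightarrow> av V h = (\<Sum>S\<in>Pow V. h S) / 2 ^ card V"
proof -
  assume V: "finite V"
  have "(1 / 2) ^ card R * (1 - 1 / 2) ^ card (V - R) = (1 / 2 :: real) ^ card V" if "R \<subseteq> V" for R
  proof -
    have "card V = card R + card (V - R)"
      using V that by (metis card_Diff_subset card_mono finite_subset le_add_diff_inverse)
    thus ?thesis by (simp add: power_add)
  qed
  hence "av V h = (\<Sum>S\<in>Pow V. (1 / 2) ^ card V * h S)"
    unfolding bav_def by (intro sum.cong) auto
  thus ?thesis
    by (simp add: sum_divide_distrib power_one_over)
qed

text \<open>\<open>resample V R h\<close> is the conditional expectation of \<open>h\<close> given the coordinates outside \<open>R\<close>.\<close>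

definition mix :: "'v set \<Rightarrow> 'v set \<Rightarrow> 'v set \<Rightarrow> 'v set" where
  "mix R S T = (S - R) \<union> (T \<inter> R)"

definition resample :: "'v set \<Rightarrow> 'v set \<Rightarrow> ('v set \<Rightarrow> real) \<Rightarrow> 'v set \<Rightarrow> real" where
  "resample V R h S = av V (\<lambda>T. h (mix R S T))"

lemma mix_subset: "S \<subseteq> V \<Longrightarrow> T \<subseteq> V \<Longrightarrow> mix R S T \<subseteq> V"
  by (auto simp: mix_def)

text \<open>Exchanging \<open>S\<close> and \<open>T\<close> on \<open>R\<close> is an involution on
  pairs of subsets, so it preserves the law of two independent uniform sets.\<close>

lemma av_swap_mix:
  assumes "finite V"
  shows "av V (\<lambda>S. av V (\<lambda>T. h (mix R S T) (mix R T S))) = av V (\<lambda>S. av V (h S))"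
proof -
  let ?s = "\<lambda>(S, T). (mix R S T, mix R T S)"
  have "(\<Sum>z\<in>Pow V \<times> Pow V. case ?s z of (S, T) \<Rightarrow> h S T) =
      (\<Sum>z\<in>Pow V \<times> Pow V. case z of (S, T) \<Rightarrow> h S T)"
  proof (rule sum.reindex_bij_witness[where i = ?s and j = ?s])
    fix z assume "z \<in> Pow V \<times> Pow V"
    thus "?s z \<in> Pow V \<times> Pow V" "?s (?s z) = z"
      by (auto simp: mix_def)
    thus "?s z \<in> Pow V \<times> Pow V" "?s (?s z) = z" by auto
  qed auto
  thus ?thesis
    using assms by (simp add: av_eq sum_divide_distrib[symmetric] sum.cartesian_product case_prod_unfold)
qed

text \<open>\<open>resample V R\<close> is an orthogonal projection in L2:
  \<open>resample V R k\<close> ignores the points of \<open>R\<close>, so \<open>h\<close> may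
  first be averaged over them.\<close>

lemma av_mult_resample:
  assumes "finite V"
  shows "av V (\<lambda>S. h S * resample V R k S) = av V (\<lambda>S. resample V R h S * resample V R k S)"
proof -
  have rk: "resample V R k (mix R S T) = resample V R k S" for S T
    unfolding resample_def by (rule bav_cong) (auto simp: mix_def intro!: arg_cong[of _ _ k])
  have "av V (\<lambda>S. h S * resample V R k S) = av V (\<lambda>S. av V (\<lambda>T. h S * resample V R k S))"
    using assms by (simp add: bav_const)
  also have "\<dots> = av V (\<lambda>S. av V (\<lambda>T. h (mix R S T) * resample V R k (mix R S T)))"
    using av_swap_mix[OF assms, of "\<lambda>S T. h S * resample V R k S" R] by simp
  also have "\<dots> = av V (\<lambda>S. resample V R h S * resample V R k S)"
    by (simp add: rk bav_multc) (simp add: resample_def)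
  finally show ?thesis .
qed

lemma av_resample: "finite V \<Longrightarrow> av V (resample V R h) = av V h"
  using av_swap_mix[of V "\<lambda>S T. h S" R] by (simp add: resample_def[abs_def] bav_const)

text \<open>Pythagoras for the projection: the squared norm of \<open>h - resample V R h\<close> is
  the difference of the two sides.\<close>

lemma resample_contraction:
  assumes "finite V"
  shows "av V (\<lambda>S. (resample V R h S)\<^sup>2) \<le> av V (\<lambda>S. (h S)\<^sup>2)"
proof -
  have "0 \<le> av V (\<lambda>S. (h S - resample V R h S)\<^sup>2)"
    by (rule bav_nonneg) auto
  also have "\<dots> = av V (\<lambda>S. (h S)\<^sup>2 - 2 * (h S * resample V R h S) + (resample V R h S)\<^sup>2)"
    by (intro bav_cong) (simp add: power2_eq_square algebra_simps)
  also have "\<dots> = av V (\<lambda>S. (h S)\<^sup>2) - 2 * av V (\<lambda>S. h S * resample V R h S) +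
      av V (\<lambda>S. (resample V R h S)\<^sup>2)"
    by (simp only: bav_add bav_diff bav_cmult)
  also have "\<dots> = av V (\<lambda>S. (h S)\<^sup>2) - av V (\<lambda>S. (resample V R h S)\<^sup>2)"
    by (simp add: av_mult_resample[OF assms, symmetric] power2_eq_square)
  finally show ?thesis by simp
qed

text \<open>The inner average replaces the fresh set \<open>T\<close> by \<open>mix R T U\<close>,
  which is again uniform by \<open>av_swap_mix\<close>.\<close>

lemma resample_tower:
  assumes "finite V" "R \<subseteq> R'"
  shows "resample V R' (resample V R h) S = resample V R' h S"
proof -
  have "resample V R' (resample V R h) S = av V (\<lambda>T. av V (\<lambda>U. h (mix R' S (mix R T U))))"
    unfolding resample_def using assms(2)
    by (intro bav_cong arg_cong[of _ _ h]) (auto simp: mix_def)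
  also have "\<dots> = resample V R' h S"
    using av_swap_mix[OF assms(1), of "\<lambda>T U. h (mix R' S T)" R] assms
    by (simp add: resample_def bav_const)
  finally show ?thesis .
qed

text \<open>The correlation of \<open>h\<close> between a uniform set and the same set with the
  points of \<open>R\<close> refreshed. As the squared norm of a projection it is visibly antitone
  in \<open>R\<close>; its mean over random \<open>R\<close> is the noise correlation.\<close>

definition noise_energy :: "'v set \<Rightarrow> ('v set \<Rightarrow> real) \<Rightarrow> 'v set \<Rightarrow> real" where
  "noise_energy V h R = av V (\<lambda>S. (resample V R h S)\<^sup>2)"

lemma noise_energy_eq:
  assumes "finite V"
  shows "noise_energy V h R = av V (\<lambda>S. av V (\<lambda>T. h S * h (mix R S T)))"
  unfolding noise_energy_def power2_eq_square av_mult_resample[OF assms, symmetric]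
  by (simp add: resample_def bav_cmult)

lemma noise_energy_antimono:
  assumes "finite V" "R \<subseteq> R'"
  shows "noise_energy V h R' \<le> noise_energy V h R"
  using resample_contraction[OF assms(1), of R' "resample V R h"]
  by (simp add: noise_energy_def resample_tower[OF assms])

text \<open>Expand the nonnegative mean square of
  \<open>resample V R h - av V h - s * resample V R k\<close>. This is Cauchy-Schwarz before
  optimizing in \<open>s\<close>: the bound is linear in the covariance, so it can still be averaged
  over \<open>R\<close>.\<close>

lemma noise_energy_ge:
  assumes "finite V" "av V k = 0" "av V (\<lambda>S. (k S)\<^sup>2) \<le> 1"
  shows "2 * s * av V (\<lambda>S. h S * resample V R k S) - s\<^sup>2 \<le> noise_energy V h R - (av V h)\<^sup>2"
proof -
  let ?c = "av V h" and ?rh = "resample V R h" and ?rk = "resample V R k"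
  have "0 \<le> av V (\<lambda>S. (?rh S - ?c - s * ?rk S)\<^sup>2)"
    by (rule bav_nonneg) auto
  also have "\<dots> = av V (\<lambda>S. (?rh S)\<^sup>2 + ?c\<^sup>2 + s\<^sup>2 * (?rk S)\<^sup>2 - (2 * ?c) * ?rh S -
      (2 * s) * (?rh S * ?rk S) + (2 * s * ?c) * ?rk S)"
    by (intro bav_cong) (simp add: power2_eq_square algebra_simps)
  also have "\<dots> = noise_energy V h R + ?c\<^sup>2 + s\<^sup>2 * noise_energy V k R - (2 * ?c) * ?c -
      2 * s * av V (\<lambda>S. h S * ?rk S)"
    using assms
    by (simp only: bav_add bav_diff bav_cmult av_resample bav_const noise_energy_def
        av_mult_resample[OF assms(1), symmetric])
  finally have "0 \<le> noise_energy V h R - ?c\<^sup>2 + s\<^sup>2 * noise_energy V k R - 2 * s * av V (\<lambda>S. h S * ?rk S)"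
    by (simp add: power2_eq_square)
  moreover have "noise_energy V k R \<le> 1"
    using resample_contraction[OF assms(1), of R k] assms(3) by (simp add: noise_energy_def)
  hence "s\<^sup>2 * noise_energy V k R \<le> s\<^sup>2 * 1"
    by (intro mult_left_mono) auto
  ultimately show ?thesis by simp
qed

lemma noise_energy_ge_square_mean: "finite V \<Longrightarrow> (av V h)\<^sup>2 \<le> noise_energy V h R"
  using noise_energy_ge[of V "\<lambda>_. 0" 0 h R] by (simp add: bav_const)

section \<open>The magnetization as a test function for noise\<close>

definition spin :: "'v set \<Rightarrow> 'v \<Rightarrow> real" where
  "spin S x = (if x \<in> S then 1 else -1)"

lemma sum_spin: "finite V \<Longrightarrow> S \<subseteq> V \<Longrightarrow> (\<Sum>x\<in>V. spin S x) = 2 * real (card S) - real (card V)"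
proof -
  assume V: "finite V" "S \<subseteq> V"
  have "(\<Sum>x\<in>V. spin S x) = (\<Sum>x\<in>S. spin S x) + (\<Sum>x\<in>V-S. spin S x)"
    using V by (metis add.commute sum.subset_diff)
  also have "\<dots> = real (card S) - real (card (V - S))"
    by (simp add: spin_def)
  finally show ?thesis
    using V by (simp add: card_Diff_subset finite_subset card_mono of_nat_diff)
qed

definition magnetization :: "'v set \<Rightarrow> 'v set \<Rightarrow> real" where
  "magnetization V S = (\<Sum>x\<in>V. spin S x) / sqrt (card V)"

lemma av_magnetization: "finite V \<Longrightarrow> av V (magnetization V) = 0"
  by (simp add: magnetization_def[abs_def] bav_divide bav_sum spin_def bav_mem)

text \<open>Distinct spins are uncorrelated, so only the diagonal of the double sum survives.
  Equality fails only for empty \<open>V\<close>, where the magnetization is 0.\<close>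

lemma av_magnetization_sq:
  assumes "finite V"
  shows "av V (\<lambda>S. (magnetization V S)\<^sup>2) \<le> 1"
proof -
  have e: "av V (\<lambda>S. spin S x * spin S y) = (if x = y then 1 else 0)" if "x \<in> V" "y \<in> V" for x y
  proof (cases "x = y")
    case True
    have "av V (\<lambda>S. spin S x * spin S y) = av V (\<lambda>S. 1)"
      by (rule bav_cong) (auto simp: spin_def True)
    thus ?thesis using True assms by (simp add: bav_const)
  next
    case False
    thus ?thesis using assms that unfolding spin_def by (subst bav_mem2) auto
  qed
  have "av V (\<lambda>S. (magnetization V S)\<^sup>2) = (\<Sum>x\<in>V. \<Sum>y\<in>V. av V (\<lambda>S. spin S x * spin S y)) / card V"
    by (simp add: magnetization_def power_divide bav_divide power2_eq_square sum_product bav_sum)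
  also have "\<dots> = (\<Sum>x\<in>V. \<Sum>y\<in>V. if x = y then 1 else 0) / card V"
    by (simp add: e)
  also have "\<dots> \<le> 1"
    using assms by (cases "V = {}") auto
  finally show ?thesis .
qed

lemma resample_magnetization:
  assumes "finite V"
  shows "resample V R (magnetization V) S = (\<Sum>x\<in>V. if x \<in> R then 0 else spin S x) / sqrt (card V)"
proof -
  have "av V (\<lambda>T. spin (mix R S T) x) = (if x \<in> R then 0 else spin S x)" if "x \<in> V" for x
    using assms that by (auto simp: spin_def mix_def bav_const bav_mem)
  thus ?thesis
    by (simp add: resample_def magnetization_def bav_divide bav_sum)
qed

text \<open>A spin survives the resampling with probability \<open>1 - \<epsilon>\<close>, so the
  mean over \<open>R\<close> of the resampled magnetization is \<open>1 - \<epsilon>\<close> times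
  the magnetization.\<close>

lemma noise_correlation_ge_magnetization:
  assumes "finite V" "0 \<le> \<epsilon>" "\<epsilon> \<le> 1"
  shows "((1 - \<epsilon>) * av V (\<lambda>S. h S * magnetization V S))\<^sup>2 \<le> bav V \<epsilon> (noise_energy V h) - (av V h)\<^sup>2"
proof -
  define a where "a = av V (\<lambda>S. h S * magnetization V S)"
  \<comment> \<open>This value maximizes
    \<open>2 * s * ((1 - \<epsilon>) * a) - s\<^sup>2\<close>.\<close>
  define s where "s = (1 - \<epsilon>) * a"
  have m: "bav V \<epsilon> (\<lambda>R. resample V R (magnetization V) S) = (1 - \<epsilon>) * magnetization V S" for S
    using assms
    by (simp add: resample_magnetization bav_divide bav_sum bav_mem sum_distrib_left magnetization_def)
  have "bav V \<epsilon> (\<lambda>R. 2 * s * av V (\<lambda>S. h S * resample V R (magnetization V) S) - s\<^sup>2) \<le>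
      bav V \<epsilon> (\<lambda>R. noise_energy V h R - (av V h)\<^sup>2)"
    using assms by (intro bav_mono noise_energy_ge av_magnetization av_magnetization_sq)
  also have "bav V \<epsilon> (\<lambda>R. 2 * s * av V (\<lambda>S. h S * resample V R (magnetization V) S) - s\<^sup>2) =
      2 * s * ((1 - \<epsilon>) * a) - s\<^sup>2"
    unfolding a_def
    by (simp only: bav_diff bav_cmult bav_const assms bav_swap[of V \<epsilon>] m)
      (simp add: bav_cmult mult.left_commute[of _ "1 - \<epsilon>"])
  finally show ?thesis
    using assms(1) by (simp add: s_def a_def bav_diff bav_const power2_eq_square mult_ac)
qed

section \<open>Averages over permutations\<close>

definition perm_mean :: "'v set \<Rightarrow> (('v \<Rightarrow> 'v) \<Rightarrow> real) \<Rightarrow> real" where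
  "perm_mean V h = (\<Sum>\<sigma> | \<sigma> permutes V. h \<sigma>) / fact (card V)"

lemma perm_mean_const: "finite V \<Longrightarrow> perm_mean V (\<lambda>_. a) = a"
  by (simp add: perm_mean_def card_permutations)

lemma perm_mean_mono:
  assumes "\<And>\<sigma>. \<sigma> permutes V \<Longrightarrow> h \<sigma> \<le> h' \<sigma>"
  shows "perm_mean V h \<le> perm_mean V h'"
  unfolding perm_mean_def using assms by (intro divide_right_mono sum_mono) auto

lemma perm_mean_cong:
  "(\<And>\<sigma>. \<sigma> permutes V \<Longrightarrow> h \<sigma> = h' \<sigma>) \<Longrightarrow> perm_mean V h = perm_mean V h'"
  by (simp add: perm_mean_def)

lemma perm_mean_diff: "perm_mean V (\<lambda>\<sigma>. h \<sigma> - h' \<sigma>) = perm_mean V h - perm_mean V h'"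
  by (simp add: perm_mean_def sum_subtractf diff_divide_distrib)

lemma perm_mean_add: "perm_mean V (\<lambda>\<sigma>. h \<sigma> + h' \<sigma>) = perm_mean V h + perm_mean V h'"
  by (simp add: perm_mean_def sum.distrib add_divide_distrib)

lemma perm_mean_abs: "\<bar>perm_mean V h\<bar> \<le> perm_mean V (\<lambda>\<sigma>. \<bar>h \<sigma>\<bar>)"
  unfolding perm_mean_def by (auto simp: abs_divide intro!: divide_right_mono sum_abs)

lemma perm_mean_compose:
  assumes "\<tau> permutes V"
  shows "perm_mean V (\<lambda>\<sigma>. h (\<sigma> \<circ> \<tau>)) = perm_mean V h"
  unfolding perm_mean_def
  by (subst (2) sum_permutations_compose_right[OF assms]) simp

text \<open>The level average g at \<open>card X\<close>; \<open>sym_corr\<close> below is Psi. Both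
  stay functions of sets, so that monotonicity of \<open>h\<close> applies to them directly.\<close>

definition sym_mean :: "'v set \<Rightarrow> ('v set \<Rightarrow> real) \<Rightarrow> 'v set \<Rightarrow> real" where
  "sym_mean V h X = perm_mean V (\<lambda>\<sigma>. h (\<sigma> ` X))"

definition sym_corr :: "'v set \<Rightarrow> ('v set \<Rightarrow> real) \<Rightarrow> 'v set \<Rightarrow> 'v set \<Rightarrow> real" where
  "sym_corr V h X Y = perm_mean V (\<lambda>\<sigma>. h (\<sigma> ` X) * h (\<sigma> ` Y))"

lemma sym_mean_image: "\<tau> permutes V \<Longrightarrow> sym_mean V h (\<tau> ` X) = sym_mean V h X"
  using perm_mean_compose[of \<tau> V "\<lambda>\<sigma>. h (\<sigma> ` X)"] by (simp add: sym_mean_def image_comp)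

lemma sym_corr_image: "\<tau> permutes V \<Longrightarrow> sym_corr V h (\<tau> ` X) (\<tau> ` Y) = sym_corr V h X Y"
  using perm_mean_compose[of \<tau> V "\<lambda>\<sigma>. h (\<sigma> ` X) * h (\<sigma> ` Y)"]
  by (simp add: sym_corr_def image_comp)

lemma permutes_image_subset: "\<sigma> permutes V \<Longrightarrow> X \<subseteq> V \<Longrightarrow> \<sigma> ` X \<subseteq> V"
  by (metis image_mono permutes_image)

text \<open>Change one factor at a time and bound the other by 1. Monotonicity makes the increments
  nonnegative, so the absolute values disappear and the means are increments of level
  averages.\<close>

lemma sym_corr_mono_bound:
  assumes "\<And>X Y. X \<subseteq> Y \<Longrightarrow> Y \<subseteq> V \<Longrightarrow> h X \<le> h Y" "\<And>X. X \<subseteq> V \<Longrightarrow> \<bar>h X\<bar> \<le> 1"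
    and "X \<subseteq> X'" "X' \<subseteq> V" "Y \<subseteq> Y'" "Y' \<subseteq> V"
  shows "\<bar>sym_corr V h X' Y' - sym_corr V h X Y\<bar> \<le>
    (sym_mean V h X' - sym_mean V h X) + (sym_mean V h Y' - sym_mean V h Y)"
proof -
  have "\<bar>h (\<sigma> ` X') * h (\<sigma> ` Y') - h (\<sigma> ` X) * h (\<sigma> ` Y)\<bar> \<le>
      (h (\<sigma> ` X') - h (\<sigma> ` X)) + (h (\<sigma> ` Y') - h (\<sigma> ` Y))" if \<sigma>: "\<sigma> permutes V" for \<sigma>
  proof -
    have sub: "\<sigma> ` X' \<subseteq> V" "\<sigma> ` Y' \<subseteq> V" "\<sigma> ` X \<subseteq> V" "\<sigma> ` Y \<subseteq> V"
      using assms(3-6) by (auto simp del: image_subset_iff intro!: permutes_image_subset[OF \<sigma>])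
    have le: "h (\<sigma> ` X) \<le> h (\<sigma> ` X')" "h (\<sigma> ` Y) \<le> h (\<sigma> ` Y')"
      using sub assms(3,5) by (auto intro!: assms(1) image_mono)
    have "h (\<sigma> ` X') * h (\<sigma> ` Y') - h (\<sigma> ` X) * h (\<sigma> ` Y) =
        (h (\<sigma> ` X') - h (\<sigma> ` X)) * h (\<sigma> ` Y') + h (\<sigma> ` X) * (h (\<sigma> ` Y') - h (\<sigma> ` Y))"
      by (simp add: algebra_simps)
    also have "\<bar>\<dots>\<bar> \<le> \<bar>h (\<sigma> ` X') - h (\<sigma> ` X)\<bar> * \<bar>h (\<sigma> ` Y')\<bar> +
        \<bar>h (\<sigma> ` X)\<bar> * \<bar>h (\<sigma> ` Y') - h (\<sigma> ` Y)\<bar>"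
      by (metis abs_mult abs_triangle_ineq)
    also have "\<dots> \<le> \<bar>h (\<sigma> ` X') - h (\<sigma> ` X)\<bar> * 1 + 1 * \<bar>h (\<sigma> ` Y') - h (\<sigma> ` Y)\<bar>"
      using sub by (intro add_mono mult_left_mono mult_right_mono assms(2)) auto
    finally show ?thesis
      using le by simp
  qed
  hence "perm_mean V (\<lambda>\<sigma>. \<bar>h (\<sigma> ` X') * h (\<sigma> ` Y') - h (\<sigma> ` X) * h (\<sigma> ` Y)\<bar>) \<le>
      perm_mean V (\<lambda>\<sigma>. (h (\<sigma> ` X') - h (\<sigma> ` X)) + (h (\<sigma> ` Y') - h (\<sigma> ` Y)))"
    by (rule perm_mean_mono)
  thus ?thesis
    using perm_mean_abs[of V "\<lambda>\<sigma>. h (\<sigma> ` X') * h (\<sigma> ` Y') - h (\<sigma> ` X) * h (\<sigma> ` Y)"]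
    by (simp add: sym_corr_def sym_mean_def perm_mean_diff perm_mean_add)
qed

text \<open>The three cardinalities also fix that of the fourth cell, the complement of the union.
  Labelling each point by its two memberships then gives the same multiset of labels for both pairs,
  and such labellings differ by a permutation.\<close>

lemma ex_permutes_pair:
  assumes V: "finite V" "X \<subseteq> V" "Y \<subseteq> V" "X' \<subseteq> V" "Y' \<subseteq> V"
    and c: "card (X \<inter> Y) = card (X' \<inter> Y')" "card (X - Y) = card (X' - Y')" "card (Y - X) = card (Y' - X')"
  obtains \<tau> where "\<tau> permutes V" "\<tau> ` X = X'" "\<tau> ` Y = Y'"
proof -
  let ?l = "\<lambda>X Y x. (x \<in> X, x \<in> Y)"
  have cells: "{x \<in> V. ?l X Y x = (True, True)} = X \<inter> Y" "{x \<in> V. ?l X Y x = (True, False)} = X - Y"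
    "{x \<in> V. ?l X Y x = (False, True)} = Y - X"
    "{x \<in> V. ?l X Y x = (False, False)} = V - (X \<inter> Y \<union> (X - Y) \<union> (Y - X))"
    if "X \<subseteq> V" "Y \<subseteq> V" for X Y using that by auto
  have last: "card (V - (X \<inter> Y \<union> (X - Y) \<union> (Y - X))) =
      card V - (card (X \<inter> Y) + card (X - Y) + card (Y - X))" if "X \<subseteq> V" "Y \<subseteq> V" for X Y
  proof -
    have fin: "finite X" "finite Y" using that V(1) finite_subset by auto
    have "card (X \<inter> Y \<union> (X - Y) \<union> (Y - X)) = card (X \<inter> Y) + card (X - Y) + card (Y - X)"
      using fin by (subst card_Un_disjoint; (subst card_Un_disjoint)?) auto
    moreover have "X \<inter> Y \<union> (X - Y) \<union> (Y - X) \<subseteq> V"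
      using that by auto
    ultimately show ?thesis
      using fin by (subst card_Diff_subset) auto
  qed
  have eq: "image_mset (?l X Y) (mset_set V) = image_mset (?l X' Y') (mset_set V)"
  proof (rule multiset_eqI)
    fix z :: "bool \<times> bool"
    have cnt: "count (image_mset k (mset_set V)) z = card {x \<in> V. k x = z}" for k :: "'a \<Rightarrow> bool \<times> bool"
    proof -
      have "{x \<in> V. k x = z} = k -` {z} \<inter> V" by auto
      thus ?thesis using V(1) by (simp add: count_image_mset)
    qed
    obtain a b where z: "z = (a, b)" by fastforce
    show "count (image_mset (?l X Y) (mset_set V)) z = count (image_mset (?l X' Y') (mset_set V)) z"
      unfolding cnt unfolding z
      using cells[OF V(2,3)] cells[OF V(4,5)] last[OF V(2,3)] last[OF V(4,5)] c
      by (cases a; cases b) simp_all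
  qed
  obtain \<tau> where \<tau>: "\<tau> permutes V" "\<forall>x\<in>V. ?l X Y x = ?l X' Y' (\<tau> x)"
    by (rule image_mset_eq_implies_permutes[OF V(1) eq])
  have "\<tau> ` X = X' \<and> \<tau> ` Y = Y'"
  proof -
    have *: "\<tau> ` A = B" if AB: "\<And>x. x \<in> V \<Longrightarrow> x \<in> A \<longleftrightarrow> \<tau> x \<in> B" "A \<subseteq> V" "B \<subseteq> V" for A B
    proof (intro equalityI subsetI)
      fix y assume y: "y \<in> B"
      hence "y \<in> \<tau> ` V" using AB(3) permutes_image[OF \<tau>(1)] by auto
      then obtain x where "x \<in> V" "y = \<tau> x" by auto
      thus "y \<in> \<tau> ` A" using AB(1) y by auto
    qed (use AB in auto)
    show ?thesis using \<tau>(2) V by (intro conjI *) auto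
  qed
  thus ?thesis using that \<tau>(1) by blast
qed

text \<open>A permutation moves \<open>X\<close> onto a subset of \<open>Y\<close>; then
  monotonicity applies.\<close>

lemma sym_mean_mono_card:
  assumes "finite V" "\<And>X Y. X \<subseteq> Y \<Longrightarrow> Y \<subseteq> V \<Longrightarrow> h X \<le> h Y"
    and "X \<subseteq> V" "Y \<subseteq> V" "card X \<le> card Y"
  shows "sym_mean V h X \<le> sym_mean V h Y"
proof -
  obtain Z where Z: "Z \<subseteq> Y" "card Z = card X"
    using obtain_subset_with_card_n[OF assms(5)] by metis
  have "Z \<subseteq> V" using Z assms by auto
  then obtain \<tau> where "\<tau> permutes V" "\<tau> ` X = Z"
    using ex_permutes_pair[of V X X Z Z] assms Z by auto
  hence "sym_mean V h X = sym_mean V h Z"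
    using sym_mean_image by metis
  also have "\<dots> \<le> sym_mean V h Y"
    unfolding sym_mean_def using Z assms(4)
    by (intro perm_mean_mono assms(2) image_mono permutes_image_subset) auto
  finally show ?thesis .
qed

text \<open>Fresh points come from outside the union: \<open>A\<close> joins both sets,
  \<open>B\<close> only the first, \<open>C\<close> only the second. Each enlarges exactly one cell,
  and the bound on \<open>a + b + c\<close> leaves room for all three.\<close>

lemma grow_pair:
  assumes V: "finite V" "X \<subseteq> V" "Y \<subseteq> V"
    and c: "card (X \<inter> Y) \<le> a" "card (X - Y) \<le> b" "card (Y - X) \<le> c" "a + b + c \<le> card V"
  obtains X' Y' where "X \<subseteq> X'" "Y \<subseteq> Y'" "X' \<subseteq> V" "Y' \<subseteq> V"
    "card (X' \<inter> Y') = a" "card (X' - Y') = b" "card (Y' - X') = c"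
proof -
  have fin: "finite X" "finite Y" using V finite_subset by auto
  have cu: "card (X \<union> Y) = card (X \<inter> Y) + card (X - Y) + card (Y - X)"
  proof -
    have "X \<union> Y = X \<inter> Y \<union> (X - Y) \<union> (Y - X)" by auto
    thus ?thesis using fin by (simp only:) (subst card_Un_disjoint; (subst card_Un_disjoint)?; auto)
  qed
  have c0: "card (V - (X \<union> Y)) = card V - card (X \<union> Y)"
    using V fin by (subst card_Diff_subset) auto
  have leA: "a - card (X \<inter> Y) \<le> card (V - (X \<union> Y))"
    using c cu c0 by simp
  obtain A where A: "A \<subseteq> V - (X \<union> Y)" "card A = a - card (X \<inter> Y)"
    using obtain_subset_with_card_n[OF leA] by metis
  have fA: "finite A" using A V finite_subset by blast
  have c1: "card (V - (X \<union> Y) - A) = card V - card (X \<union> Y) - (a - card (X \<inter> Y))"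
    using A fA c0 by (subst card_Diff_subset) auto
  have leB: "b - card (X - Y) \<le> card (V - (X \<union> Y) - A)"
    using c cu c1 by simp
  obtain B where B: "B \<subseteq> V - (X \<union> Y) - A" "card B = b - card (X - Y)"
    using obtain_subset_with_card_n[OF leB] by metis
  have fB: "finite B" using B V finite_subset by blast
  have c2: "card (V - (X \<union> Y) - A - B) =
      card V - card (X \<union> Y) - (a - card (X \<inter> Y)) - (b - card (X - Y))"
    using B fB c1 by (subst card_Diff_subset) auto
  have leC: "c - card (Y - X) \<le> card (V - (X \<union> Y) - A - B)"
    using c cu c2 by simp
  obtain C where C: "C \<subseteq> V - (X \<union> Y) - A - B" "card C = c - card (Y - X)"
    using obtain_subset_with_card_n[OF leC] by metis
  have fC: "finite C" using C V finite_subset by blast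
  have cells: "(X \<union> A \<union> B) \<inter> (Y \<union> A \<union> C) = (X \<inter> Y) \<union> A" "(X \<union> A \<union> B) - (Y \<union> A \<union> C) = (X - Y) \<union> B"
    "(Y \<union> A \<union> C) - (X \<union> A \<union> B) = (Y - X) \<union> C"
    using A B C by auto
  show ?thesis
  proof (rule that[of "X \<union> A \<union> B" "Y \<union> A \<union> C"])
    show "card ((X \<union> A \<union> B) \<inter> (Y \<union> A \<union> C)) = a"
      unfolding cells using A c fin fA by (subst card_Un_disjoint) auto
    show "card ((X \<union> A \<union> B) - (Y \<union> A \<union> C)) = b"
      unfolding cells using B c fin fB by (subst card_Un_disjoint) auto
    show "card ((Y \<union> A \<union> C) - (X \<union> A \<union> B)) = c"
      unfolding cells using C c fin fC by (subst card_Un_disjoint) auto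
  qed (use A B C V in auto)
qed

text \<open>The size of \<open>Y\<close> is controlled implicitly: it lies within
  \<open>3 * w\<close> of \<open>card V / 2\<close>. Hence the distance \<open>3 * w\<close> at
  which the levels of \<open>L\<close> and \<open>H\<close> are placed below. For the noise pair,
  \<open>j\<close> is \<open>card V * \<epsilon> / 4\<close>.\<close>

definition typical :: "'v set \<Rightarrow> real \<Rightarrow> real \<Rightarrow> 'v set \<Rightarrow> 'v set \<Rightarrow> bool" where
  "typical V j w X Y \<longleftrightarrow> X \<subseteq> V \<and> Y \<subseteq> V \<and> \<bar>real (card X) - card V / 2\<bar> \<le> w \<and>
     \<bar>real (card (X - Y)) - j\<bar> \<le> w \<and> \<bar>real (card (Y - X)) - j\<bar> \<le> w"

text \<open>Both pairs are compared with a common pair that is larger than either of them up to a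
  permutation: its three cells are the maxima of the corresponding cells.\<close>

lemma sym_corr_typical:
  assumes V: "finite V"
    and h: "\<And>X Y. X \<subseteq> Y \<Longrightarrow> Y \<subseteq> V \<Longrightarrow> h X \<le> h Y" "\<And>X. X \<subseteq> V \<Longrightarrow> \<bar>h X\<bar> \<le> 1"
    and t: "typical V j w X Y" "typical V j w X' Y'"
    and small: "j \<le> card V / 8" "w \<le> 3 * card V / 32"
    and LH: "L \<subseteq> V" "H \<subseteq> V" "card L \<le> card V / 2 - 3 * w" "card V / 2 + 3 * w \<le> card H"
  shows "\<bar>sym_corr V h X Y - sym_corr V h X' Y'\<bar> \<le> 4 * (sym_mean V h H - sym_mean V h L)"
proof -
  let ?g = "sym_mean V h" and ?\<Delta> = "sym_mean V h H - sym_mean V h L"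
  let ?a = "max (card (X \<inter> Y)) (card (X' \<inter> Y'))" and ?b = "max (card (X - Y)) (card (X' - Y'))"
    and ?c = "max (card (Y - X)) (card (Y' - X'))"
  have sizes: "card A = card (A \<inter> B) + card (A - B)" if "A \<subseteq> V" for A B :: "'a set"
    using that V by (metis card_Int_Diff finite_subset)
  have cell: "real (card (A \<inter> B)) \<le> card V / 2 - j + 2 * w" "card L \<le> card A" "card L \<le> card B"
    if "typical V j w A B" for A B
  proof -
    have *: "real (card A) = card (A \<inter> B) + card (A - B)" "real (card B) = card (A \<inter> B) + card (B - A)"
      using that sizes[of A B] sizes[of B A] by (simp_all add: typical_def Int_commute)
    show "real (card (A \<inter> B)) \<le> card V / 2 - j + 2 * w"
      using * that by (auto simp: typical_def)
    have "real (card L) \<le> card A" "real (card L) \<le> card B"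
      using * that LH(3) by (auto simp: typical_def)
    thus "card L \<le> card A" "card L \<le> card B" by auto
  qed
  have a: "real ?a \<le> card V / 2 - j + 2 * w"
    using cell(1)[OF t(1)] cell(1)[OF t(2)] by auto
  have b: "real ?b \<le> j + w" "real ?c \<le> j + w"
    using t by (auto simp: typical_def)
  \<comment> \<open>The sum is at most \<open>card V / 2 + j + 4 * w\<close>, and the two bounds in
    \<open>small\<close> are chosen so that this does not exceed \<open>card V\<close>.\<close>
  have "real (?a + ?b + ?c) \<le> card V"
    using a b small by simp
  hence abc: "?a + ?b + ?c \<le> card V"
    by linarith
  have *: "\<exists>X1 Y1. X1 \<subseteq> V \<and> Y1 \<subseteq> V \<and> card (X1 \<inter> Y1) = ?a \<and> card (X1 - Y1) = ?b \<and> card (Y1 - X1) = ?c \<and>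
      \<bar>sym_corr V h X1 Y1 - sym_corr V h A B\<bar> \<le> 2 * ?\<Delta>"
    if AB: "typical V j w A B" and le: "card (A \<inter> B) \<le> ?a" "card (A - B) \<le> ?b" "card (B - A) \<le> ?c" for A B
  proof -
    have ABV: "A \<subseteq> V" "B \<subseteq> V" using AB by (auto simp: typical_def)
    obtain X1 Y1 where X1: "A \<subseteq> X1" "B \<subseteq> Y1" "X1 \<subseteq> V" "Y1 \<subseteq> V"
      "card (X1 \<inter> Y1) = ?a" "card (X1 - Y1) = ?b" "card (Y1 - X1) = ?c"
      using grow_pair[OF V ABV le abc] by blast
    \<comment> \<open>Each enlarged set is the union of two cells, of total size at most
      \<open>card V / 2 + 3 * w\<close>: the terms in \<open>j\<close> cancel.\<close>
    have "real (card X1) \<le> card H" "real (card Y1) \<le> card H"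
      using sizes[of X1 Y1] sizes[of Y1 X1] X1 a b LH(4) by (simp_all add: Int_commute)
    hence "?g X1 \<le> ?g H" "?g Y1 \<le> ?g H"
      using X1 LH by (auto intro!: sym_mean_mono_card V h)
    moreover have "?g L \<le> ?g A" "?g L \<le> ?g B"
      using ABV LH cell[OF AB] by (auto intro!: sym_mean_mono_card V h)
    moreover have "\<bar>sym_corr V h X1 Y1 - sym_corr V h A B\<bar> \<le> (?g X1 - ?g A) + (?g Y1 - ?g B)"
      using X1 by (intro sym_corr_mono_bound h)
    ultimately show ?thesis
      using X1 by (intro exI[of _ X1] exI[of _ Y1]) auto
  qed
  obtain X1 Y1 where 1: "X1 \<subseteq> V" "Y1 \<subseteq> V" "card (X1 \<inter> Y1) = ?a" "card (X1 - Y1) = ?b"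
      "card (Y1 - X1) = ?c" "\<bar>sym_corr V h X1 Y1 - sym_corr V h X Y\<bar> \<le> 2 * ?\<Delta>"
    using *[OF t(1)] by auto
  obtain X2 Y2 where 2: "X2 \<subseteq> V" "Y2 \<subseteq> V" "card (X2 \<inter> Y2) = ?a" "card (X2 - Y2) = ?b"
      "card (Y2 - X2) = ?c" "\<bar>sym_corr V h X2 Y2 - sym_corr V h X' Y'\<bar> \<le> 2 * ?\<Delta>"
    using *[OF t(2)] by auto
  obtain \<tau> where "\<tau> permutes V" "\<tau> ` X1 = X2" "\<tau> ` Y1 = Y2"
    using ex_permutes_pair[OF V 1(1,2) 2(1,2)] 1 2 by metis
  hence "sym_corr V h X2 Y2 = sym_corr V h X1 Y1"
    using sym_corr_image by metis
  thus ?thesis using 1(6) 2(6) by linarith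
qed

section \<open>Level averages of monotone functions\<close>

lemma av_card:
  assumes "finite V"
  shows "av V (\<lambda>S. \<phi> (card S)) = (\<Sum>m\<le>card V. real (card V choose m) * \<phi> m) / 2 ^ card V"
proof -
  have "(\<Sum>S\<in>Pow V. \<phi> (card S)) = (\<Sum>m\<le>card V. \<Sum>S\<in>{S \<in> Pow V. card S = m}. \<phi> (card S))"
    using assms by (intro sum.group[symmetric]) (auto intro: card_mono)
  also have "\<dots> = (\<Sum>m\<le>card V. real (card V choose m) * \<phi> m)"
    using n_subsets[OF assms] by (intro sum.cong refl) (simp add: Pow_def)
  finally show ?thesis using assms by (simp add: av_eq)
qed

lemma magnetization_eq:
  "finite V \<Longrightarrow> S \<subseteq> V \<Longrightarrow> magnetization V S = (2 * real (card S) - real (card V)) / sqrt (card V)"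
  by (simp add: magnetization_def sum_spin)

text \<open>Chebyshev for the magnetization, which is \<open>2 / sqrt (card V)\<close> times the
  deviation of \<open>card S\<close>.\<close>

lemma av_card_deviation:
  assumes "finite V" "w > 0"
  shows "av V (\<lambda>S. if \<bar>real (card S) - card V / 2\<bar> > w then 1 else 0) \<le> card V / (4 * w\<^sup>2)"
proof (cases "V = {}")
  case False
  hence n: "real (card V) > 0" using assms by (simp add: card_gt_0_iff)
  have "av V (\<lambda>S. if \<bar>real (card S) - card V / 2\<bar> > w then 1 else 0) \<le>
      av V (\<lambda>S. card V / (4 * w\<^sup>2) * (magnetization V S)\<^sup>2)"
  proof (rule bav_mono)
    fix S assume S: "S \<subseteq> V"
    have "w\<^sup>2 \<le> (real (card S) - card V / 2)\<^sup>2" if "\<bar>real (card S) - card V / 2\<bar> > w"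
      using that assms(2) by (metis abs_le_square_iff abs_of_pos less_imp_le)
    moreover have "(2 * real (card S) - card V)\<^sup>2 = 4 * (real (card S) - card V / 2)\<^sup>2"
      by (simp add: power2_eq_square algebra_simps)
    hence "card V / (4 * w\<^sup>2) * (magnetization V S)\<^sup>2 = (real (card S) - card V / 2)\<^sup>2 / w\<^sup>2"
      using n S assms False by (simp add: magnetization_eq power_divide)
    ultimately show "(if \<bar>real (card S) - card V / 2\<bar> > w then 1 else 0) \<le>
        card V / (4 * w\<^sup>2) * (magnetization V S)\<^sup>2"
      using assms(2) by auto
  qed auto
  also have "\<dots> \<le> card V / (4 * w\<^sup>2) * 1"
    unfolding bav_cmult using assms by (intro mult_left_mono av_magnetization_sq) auto
  finally show ?thesis by simp
qed (use assms in auto)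

section \<open>Binomial coefficients near the middle level\<close>

lemma binomial_ratio:
  assumes "m < n"
  shows "real (n choose Suc m) = real (n choose m) * (real n - real m) / (real m + 1)"
proof -
  have "Suc m * (n choose Suc m) = (n - m) * (n choose m)"
    using assms by (metis Suc_times_binomial_eq binomial_absorb_comp binomial_absorption diff_Suc_1 less_imp_Suc_add mult.commute)
  hence "(real m + 1) * real (n choose Suc m) = (real n - real m) * real (n choose m)"
    using assms by (metis of_nat_Suc of_nat_diff of_nat_mult less_imp_le add.commute)
  thus ?thesis by (simp add: field_simps)
qed

lemma exp_minus_double_le:
  fixes y :: real
  assumes "0 \<le> y" "y \<le> 1 / 2"
  shows "exp (- (2 * y)) \<le> 1 - y"
proof -
  have "0 \<le> y * (1 - 2 * y)"
    using assms by (intro mult_nonneg_nonneg) auto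
  hence "1 \<le> (1 - y) * (1 + 2 * y)"
    by (simp add: algebra_simps)
  also have "\<dots> \<le> (1 - y) * exp (2 * y)"
    using assms by (intro mult_left_mono exp_ge_add_one_self) auto
  finally show ?thesis
    by (simp add: exp_minus field_simps)
qed

text \<open>One step up from level k multiplies by (n - k) / (k + 1), which is at least
  \<open>1 - (4 * u + 2) / n\<close> while k + 1 does not exceed \<open>n / 2 + u\<close>. Bounding
  this factor below by an exponential lets the \<open>s\<close> steps add up in the
  exponent.\<close>

lemma binomial_shift:
  fixes n m s :: nat
  assumes "n > 0" "real m + s \<le> n / 2 + u" "0 \<le> u" "(4 * u + 2) / n \<le> 1 / 2"
  shows "exp (- (2 * real s * ((4 * u + 2) / n))) * (n choose m) \<le> (n choose (m + s))"
  using assms(2)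
proof (induction s)
  case (Suc s)
  let ?x = "(4 * u + 2) / n"
  have n: "4 * u + 2 \<le> n / 2" using assms by (simp add: field_simps)
  have k: "real (m + s) + 1 \<le> n / 2 + u" using Suc.prems by simp
  have lt: "m + s < n" using k n assms by linarith
  have "exp (- (2 * ?x)) \<le> 1 - ?x"
    using assms by (intro exp_minus_double_le) auto
  also have "\<dots> \<le> (real n - (m + s)) / (real (m + s) + 1)"
  proof -
    have "(1 - ?x) * (real (m + s) + 1) \<le> (1 - ?x) * (n / 2 + u)"
      using k by (rule mult_left_mono) (use assms(4) in linarith)
    also have "\<dots> = n / 2 + u - ((4 * u + 2) / 2 + u * ?x)"
      using assms(1) by (simp add: field_simps)
    also have "\<dots> \<le> n / 2 - u"
    proof -
      have "n / 2 + u - ((4 * u + 2) / 2 + t) \<le> n / 2 - u" if "0 \<le> t" for t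
        using that by (simp add: add_divide_distrib)
      moreover have "0 \<le> u * ?x" using assms by (intro mult_nonneg_nonneg) auto
      ultimately show ?thesis by blast
    qed
    also have "\<dots> \<le> real n - (m + s)"
      using k by simp
    finally show ?thesis by (simp add: field_simps)
  qed
  finally have r: "exp (- (2 * ?x)) \<le> (real n - (m + s)) / (real (m + s) + 1)" .
  have "- (2 * real (Suc s) * y) = - (2 * y) + - (2 * real s * y)" for y :: real
    by (simp add: algebra_simps)
  hence "exp (- (2 * real (Suc s) * ?x)) * (n choose m) =
      exp (- (2 * ?x)) * (exp (- (2 * real s * ?x)) * (n choose m))"
    by (simp only: exp_add mult.assoc)
  also have "\<dots> \<le> (real n - (m + s)) / (real (m + s) + 1) * (n choose (m + s))"
    using r Suc lt by (intro mult_mono) auto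
  also have "\<dots> = (n choose (m + Suc s))"
    using binomial_ratio[OF lt] by simp
  finally show ?case .
qed simp

text \<open>The binomial weights near the middle have total mass at least \<open>3 / 4\<close>. Shifting them by at
  most \<open>(K + 2) sqrt n\<close> steps costs a factor \<open>exp (- 2 (4 K + 14) / sqrt n)\<close> in each step.\<close>

definition tail_const :: "real \<Rightarrow> real" where
  "tail_const K = 3 / 4 * exp (- ((8 * K + 28) * (K + 2)))"

lemma tail_const_pos: "tail_const K > 0"
  by (simp add: tail_const_def)

lemma av_upper_tail:
  assumes "finite V" "K \<ge> 0" "2 * (4 * K + 14) \<le> sqrt (card V)" "real k \<le> card V / 2 + K * sqrt (card V)"
  shows "tail_const K \<le> av V (\<lambda>S. if k \<le> card S then 1 else 0)"
proof -
  define n r where "n = card V" and "r = sqrt (card V)"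
  have r: "r \<ge> 28" using assms by (simp add: r_def)
  have nr: "real n = r * r" by (simp add: n_def r_def)
  have n0: "n > 0" using r nr by (cases n) auto
  \<comment> \<open>Levels within \<open>r\<close> of the middle, shifted by \<open>s\<close>, lie
    at or above \<open>card V / 2 + K * r\<close>; rounding up costs at most one further
    \<open>r\<close>.\<close>
  define s where "s = nat \<lceil>(K + 1) * r\<rceil>"
  have s: "(K + 1) * r \<le> s" "s \<le> (K + 2) * r"
  proof -
    have "0 \<le> (K + 1) * r" using assms r by auto
    thus "(K + 1) * r \<le> s" "s \<le> (K + 2) * r"
      using r unfolding s_def by (simp_all add: algebra_simps) linarith+
  qed
  \<comment> \<open>The shifted levels reach at most \<open>n / 2 + r + s\<close>, hence at most
    \<open>n / 2 + u\<close>.\<close>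
  define u where "u = (K + 3) * r"
  have u: "0 \<le> u" using assms r by (simp add: u_def)
  have x: "(4 * u + 2) / n \<le> (4 * K + 14) / r"
    using r by (simp add: u_def nr field_simps)
  have x2: "(4 * K + 14) / r \<le> 1 / 2"
  proof -
    have "2 * (4 * K + 14) \<le> r" using assms(3) by (simp add: r_def)
    thus ?thesis using r by (simp add: pos_divide_le_eq)
  qed
  \<comment> \<open>The product \<open>s * ((4 * u + 2) / n)\<close> is at most
    \<open>(K + 2) * (4 * K + 14)\<close>, a bound free of \<open>n\<close>; this is the exponent in
    \<open>tail_const\<close>, up to the factor 2.\<close>
  have e: "exp (- ((8 * K + 28) * (K + 2))) \<le> exp (- (2 * real s * ((4 * u + 2) / n)))"
  proof -
    define y where "y = (4 * u + 2) / n"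
    have "s * y \<le> ((K + 2) * r) * ((4 * K + 14) / r)"
      using s x u assms r unfolding y_def by (intro mult_mono) auto
    also have "\<dots> = (4 * K + 14) * (K + 2)"
      using r by simp
    finally show ?thesis
      unfolding y_def[symmetric] by (simp add: algebra_simps)
  qed
  define W where "W = {m. m \<le> n \<and> \<bar>real m - n / 2\<bar> \<le> r}"
  have finW: "finite W" unfolding W_def by (rule finite_subset[of _ "{..n}"]) auto
  have W: "3 / 4 * 2 ^ n \<le> (\<Sum>m\<in>W. real (n choose m))"
  proof -
    \<comment> \<open>Chebyshev at width \<open>r\<close>, which is two standard deviations: the
      levels outside \<open>W\<close> carry at most a quarter of the mass.\<close>
    have "av V (\<lambda>S. if \<bar>real (card S) - card V / 2\<bar> > r then 1 else 0) \<le> card V / (4 * r\<^sup>2)"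
      using r by (intro av_card_deviation assms) auto
    also have "\<dots> = 1 / 4"
      using r nr by (simp add: n_def power2_eq_square)
    finally have 1: "(\<Sum>m\<le>n. real (n choose m) * (if \<bar>real m - n / 2\<bar> > r then 1 else 0)) \<le> 2 ^ n / 4"
      by (subst (asm) av_card[OF assms(1), of "\<lambda>m. if \<bar>real m - card V / 2\<bar> > r then 1 else 0"])
        (simp add: n_def field_simps)
    have "(\<Sum>m\<le>n. real (n choose m) * (if \<bar>real m - n / 2\<bar> > r then 1 else 0)) +
        (\<Sum>m\<le>n. real (n choose m) * (if \<bar>real m - n / 2\<bar> \<le> r then 1 else 0)) = (\<Sum>m\<le>n. real (n choose m))"
      by (subst sum.distrib[symmetric], intro sum.cong) auto
    also have "\<dots> = 2 ^ n"
      using choose_row_sum[of n] by (metis of_nat_numeral of_nat_power of_nat_sum)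
    finally have "3 / 4 * 2 ^ n \<le> (\<Sum>m\<le>n. real (n choose m) * (if \<bar>real m - n / 2\<bar> \<le> r then 1 else 0))"
      using 1 by simp
    also have "\<dots> = (\<Sum>m\<in>W. real (n choose m))"
      by (rule sum.mono_neutral_cong_right) (auto simp: W_def)
    finally show ?thesis .
  qed
  have "exp (- ((8 * K + 28) * (K + 2))) * (3 / 4 * 2 ^ n) \<le>
      exp (- ((8 * K + 28) * (K + 2))) * (\<Sum>m\<in>W. real (n choose m))"
    using W by (intro mult_left_mono) auto
  also have "\<dots> = (\<Sum>m\<in>W. exp (- ((8 * K + 28) * (K + 2))) * real (n choose m))"
    by (simp add: sum_distrib_left)
  also have "\<dots> \<le> (\<Sum>m\<in>W. real (n choose (m + s)))"
  proof (rule sum_mono)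
    fix m assume m: "m \<in> W"
    have "exp (- ((8 * K + 28) * (K + 2))) * real (n choose m) \<le>
        exp (- (2 * real s * ((4 * u + 2) / n))) * real (n choose m)"
      using e by (intro mult_right_mono) auto
    also have "\<dots> \<le> real (n choose (m + s))"
    proof (rule binomial_shift)
      show "real m + s \<le> n / 2 + u"
        using m s by (auto simp: W_def u_def algebra_simps)
    qed (use n0 u x x2 in linarith)+
    finally show "exp (- ((8 * K + 28) * (K + 2))) * real (n choose m) \<le> real (n choose (m + s))" .
  qed
  also have "\<dots> = (\<Sum>m\<in>(\<lambda>m. m + s) ` W. real (n choose m))"
    by (subst sum.reindex) (auto simp: inj_on_def)
  also have "\<dots> = (\<Sum>m\<in>(\<lambda>m. m + s) ` W \<inter> {..n}. real (n choose m))"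
    using finW by (intro sum.mono_neutral_right) (auto simp: binomial_eq_0)
  also have "\<dots> \<le> (\<Sum>m | k \<le> m \<and> m \<le> n. real (n choose m))"
  proof (rule sum_mono2)
    have "k \<le> m + s" if "m \<in> W" for m
    proof -
      have "real k \<le> real m + s"
        using that s(1) assms(4) by (auto simp: W_def n_def r_def algebra_simps)
      thus ?thesis by linarith
    qed
    thus "(\<lambda>m. m + s) ` W \<inter> {..n} \<subseteq> {m. k \<le> m \<and> m \<le> n}" by auto
  qed auto
  also have "\<dots> = (\<Sum>m\<le>n. real (n choose m) * (if k \<le> m then 1 else 0))"
    by (rule sum.mono_neutral_cong_left) auto
  finally have "tail_const K * 2 ^ n \<le> \<dots>"
    by (simp add: tail_const_def mult_ac)
  thus ?thesis
    by (subst av_card[OF assms(1), of "\<lambda>m. if k \<le> m then 1 else 0"]) (simp add: n_def field_simps)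
qed

lemma av_complement: "finite V \<Longrightarrow> av V (\<lambda>S. h (V - S)) = av V h"
proof -
  assume V: "finite V"
  have "(\<Sum>S\<in>Pow V. h (V - S)) = (\<Sum>S\<in>Pow V. h S)"
    by (rule sum.reindex_bij_witness[where i = "\<lambda>S. V - S" and j = "\<lambda>S. V - S"]) auto
  thus ?thesis using V by (simp add: av_eq)
qed

text \<open>Complementation reflects level \<open>k\<close> to \<open>card V - k\<close> and turns
  this tail into the upper one.\<close>

lemma av_lower_tail:
  assumes "finite V" "K \<ge> 0" "2 * (4 * K + 14) \<le> sqrt (card V)" "card V / 2 - K * sqrt (card V) \<le> real k"
    "k \<le> card V"
  shows "tail_const K \<le> av V (\<lambda>S. if card S \<le> k then 1 else 0)"
proof -
  have "tail_const K \<le> av V (\<lambda>S. if card V - k \<le> card S then 1 else 0)"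
    using assms by (intro av_upper_tail) (auto simp: of_nat_diff)
  also have "\<dots> = av V (\<lambda>S. if card V - k \<le> card (V - S) then 1 else 0)"
    using av_complement[OF assms(1), of "\<lambda>S. if card V - k \<le> card S then 1 else 0"] by simp
  also have "\<dots> = av V (\<lambda>S. if card S \<le> k then 1 else 0)"
  proof (rule bav_cong)
    fix S assume "S \<subseteq> V"
    hence "card (V - S) = card V - card S" "card S \<le> card V"
      using assms(1) by (auto simp: card_Diff_subset finite_subset card_mono)
    thus "(if card V - k \<le> card (V - S) then 1 else 0 :: real) = (if card S \<le> k then 1 else 0)"
      using assms(5) by auto
  qed
  finally show ?thesis .
qed

lemma av_sym_mean:
  assumes "finite V"
  shows "av V h = av V (sym_mean V h)"
proof -
  have "av V (sym_mean V h) = perm_mean V (\<lambda>\<sigma>. av V (\<lambda>S. h (\<sigma> ` S)))"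
    by (simp add: sym_mean_def[abs_def] perm_mean_def bav_divide bav_sum)
  also have "\<dots> = perm_mean V (\<lambda>\<sigma>. av V h)"
    using assms by (intro perm_mean_cong bav_bij) (auto simp: permutes_imp_bij)
  finally show ?thesis using assms by (simp add: perm_mean_const)
qed

text \<open>The magnetization and the deviation of the level averages from the middle one have the same
  sign, and on the levels beyond \<open>L\<close> and \<open>H\<close> the magnetization is at least 2 in absolute value.\<close>

lemma sym_mean_flat:
  assumes V: "finite V" and K: "K \<ge> 0" "2 * (4 * K + 14) \<le> sqrt (card V)"
    and h: "\<And>X Y. X \<subseteq> Y \<Longrightarrow> Y \<subseteq> V \<Longrightarrow> h X \<le> h Y"
    and LH: "L \<subseteq> V" "H \<subseteq> V"
      "card V / 2 - K * sqrt (card V) \<le> card L" "card L \<le> card V / 2 - sqrt (card V)"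
      "card V / 2 + sqrt (card V) \<le> card H" "card H \<le> card V / 2 + K * sqrt (card V)"
  shows "2 * tail_const K * (sym_mean V h H - sym_mean V h L) \<le> av V (\<lambda>S. h S * magnetization V S)"
proof -
  let ?g = "sym_mean V h" and ?Z = "magnetization V" and ?n = "card V"
  have r: "sqrt ?n \<ge> 28" using K by simp
  hence r0: "sqrt ?n > 0" by linarith
  obtain Mid where Mid: "Mid \<subseteq> V" "card Mid = ?n div 2"
    by (metis div_le_dividend obtain_subset_with_card_n)
  have g: "?g X \<le> ?g Y" if "X \<subseteq> V" "Y \<subseteq> V" "card X \<le> card Y" for X Y
    using that by (intro sym_mean_mono_card V h)
  have Z: "?Z S = (2 * real (card S) - ?n) / sqrt ?n" if "S \<subseteq> V" for S
    using magnetization_eq[OF V that] .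
  have Zim: "?Z (\<sigma> ` S) = ?Z S" if "\<sigma> permutes V" "S \<subseteq> V" for \<sigma> S
    using that Z[of S] Z[of "\<sigma> ` S"] permutes_image_subset[OF that]
    by (simp add: card_image permutes_inj_on)
  \<comment> \<open>The magnetization depends only on the size of the set, so averaging over
    permutations replaces \<open>h\<close> by its level average.\<close>
  have "av V (\<lambda>S. h S * ?Z S) = av V (\<lambda>S. ?g S * ?Z S)"
  proof -
    have "sym_mean V (\<lambda>S. h S * ?Z S) S = ?g S * ?Z S" if "S \<subseteq> V" for S
      using Zim that by (simp add: sym_mean_def perm_mean_def sum_distrib_right)
    thus ?thesis by (subst av_sym_mean[OF V]) (intro bav_cong)
  qed
  \<comment> \<open>Recentring at the middle level is free, because the magnetization has mean
    zero.\<close>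
  also have "\<dots> = av V (\<lambda>S. (?g S - ?g Mid) * ?Z S)"
    using V by (simp add: left_diff_distrib bav_diff bav_cmult av_magnetization)
  also have "\<dots> \<ge> av V (\<lambda>S. (2 * (?g H - ?g Mid)) * (if card H \<le> card S then 1 else 0) +
      (2 * (?g Mid - ?g L)) * (if card S \<le> card L then 1 else 0))"
  proof (rule bav_mono)
    fix S assume S: "S \<subseteq> V"
    have LM: "card L < ?n div 2" using LH r by linarith
    have MH: "?n div 2 < card H" using LH r by linarith
    consider "card H \<le> card S" | "card S \<le> card L" | "card L < card S" "card S \<le> ?n div 2"
      | "?n div 2 < card S" "card S < card H"
      by linarith
    thus "(2 * (?g H - ?g Mid)) * (if card H \<le> card S then 1 else 0) +
      (2 * (?g Mid - ?g L)) * (if card S \<le> card L then 1 else 0) \<le> (?g S - ?g Mid) * ?Z S"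
    proof cases
      case 1
      have "2 * sqrt ?n \<le> 2 * real (card S) - ?n" using 1 LH by linarith
      hence "2 \<le> ?Z S" using r0 by (simp add: Z[OF S] pos_le_divide_eq)
      moreover have "0 \<le> ?g H - ?g Mid" "?g H \<le> ?g S"
        using 1 MH S Mid LH by (auto intro!: g)
      ultimately have "(?g H - ?g Mid) * 2 \<le> (?g S - ?g Mid) * ?Z S"
        by (intro mult_mono) auto
      thus ?thesis using 1 LM MH by simp
    next
      case 2
      have "2 * real (card S) - ?n \<le> - 2 * sqrt ?n" using 2 LH by linarith
      hence "?Z S \<le> -2" using r0 by (simp add: Z[OF S] pos_divide_le_eq)
      moreover have "0 \<le> ?g Mid - ?g L" "?g S \<le> ?g L"
        using 2 LM S Mid LH by (auto intro!: g)
      ultimately have "(?g Mid - ?g L) * 2 \<le> (?g Mid - ?g S) * (- ?Z S)"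
        by (intro mult_mono) auto
      thus ?thesis using 2 LM MH by (simp add: algebra_simps)
    next
      case 3
      have "2 * real (card S) \<le> ?n" using 3 by linarith
      hence "?Z S \<le> 0" using Z[OF S] by (simp add: divide_nonpos_nonneg)
      moreover have "?g S \<le> ?g Mid" using 3 S Mid by (auto intro!: g)
      ultimately show ?thesis using 3 MH by (simp add: mult_nonpos_nonpos)
    next
      case 4
      have "?n \<le> 2 * real (card S)" using 4 by linarith
      hence "0 \<le> ?Z S" using Z[OF S] by simp
      moreover have "?g Mid \<le> ?g S" using 4 S Mid by (auto intro!: g)
      ultimately show ?thesis using 4 LM by simp
    qed
  qed auto
  \<comment> \<open>Both coefficients are nonnegative, so each tail probability may be replaced by
    its lower bound.\<close>
  also (xtrans) have "av V (\<lambda>S. (2 * (?g H - ?g Mid)) * (if card H \<le> card S then 1 else 0) +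
      (2 * (?g Mid - ?g L)) * (if card S \<le> card L then 1 else 0)) \<ge>
      (2 * (?g H - ?g Mid)) * tail_const K + (2 * (?g Mid - ?g L)) * tail_const K"
  proof -
    have "?g Mid \<le> ?g H" "?g L \<le> ?g Mid"
      using Mid LH r by (auto intro!: g)
    moreover have "card L \<le> ?n" using V LH by (auto intro: card_mono)
    ultimately show ?thesis
      unfolding bav_add bav_cmult using V K LH
      by (intro add_mono mult_left_mono av_upper_tail av_lower_tail) auto
  qed
  finally (xtrans) show ?thesis by (simp add: algebra_simps)
qed

section \<open>Typical pairs\<close>

text \<open>\<open>R\<close> is the marked set with parameter \<open>\<epsilon>\<close>,
  \<open>S\<close> the configuration and \<open>T\<close> the fresh bits, all independent;
  \<open>mix R S T\<close> is then the noisy copy of \<open>S\<close>.\<close>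

definition triple_mean :: "'v set \<Rightarrow> real \<Rightarrow> ('v set \<Rightarrow> 'v set \<Rightarrow> 'v set \<Rightarrow> real) \<Rightarrow> real" where
  "triple_mean V \<epsilon> h = bav V \<epsilon> (\<lambda>R. av V (\<lambda>S. av V (\<lambda>T. h R S T)))"

lemma triple_mean_add:
  "triple_mean V \<epsilon> (\<lambda>R S T. h R S T + k R S T) = triple_mean V \<epsilon> h + triple_mean V \<epsilon> k"
  by (simp add: triple_mean_def bav_add)

lemma triple_mean_diff:
  "triple_mean V \<epsilon> (\<lambda>R S T. h R S T - k R S T) = triple_mean V \<epsilon> h - triple_mean V \<epsilon> k"
  by (simp add: triple_mean_def bav_diff)

lemma triple_mean_cmult: "triple_mean V \<epsilon> (\<lambda>R S T. a * h R S T) = a * triple_mean V \<epsilon> h"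
  by (simp add: triple_mean_def bav_cmult)

lemma triple_mean_sum:
  "triple_mean V \<epsilon> (\<lambda>R S T. \<Sum>i\<in>I. h i R S T) = (\<Sum>i\<in>I. triple_mean V \<epsilon> (h i))"
  by (simp add: triple_mean_def bav_sum)

lemma triple_mean_const: "finite V \<Longrightarrow> triple_mean V \<epsilon> (\<lambda>R S T. a) = a"
  by (simp add: triple_mean_def bav_const)

lemma triple_mean_mono:
  assumes "0 \<le> \<epsilon>" "\<epsilon> \<le> 1"
    "\<And>R S T. R \<subseteq> V \<Longrightarrow> S \<subseteq> V \<Longrightarrow> T \<subseteq> V \<Longrightarrow> h R S T \<le> k R S T"
  shows "triple_mean V \<epsilon> h \<le> triple_mean V \<epsilon> k"
  unfolding triple_mean_def using assms by (intro bav_mono) auto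

lemma triple_mean_cong:
  assumes "\<And>R S T. R \<subseteq> V \<Longrightarrow> S \<subseteq> V \<Longrightarrow> T \<subseteq> V \<Longrightarrow> h R S T = k R S T"
  shows "triple_mean V \<epsilon> h = triple_mean V \<epsilon> k"
  unfolding triple_mean_def using assms by (intro bav_cong) auto

lemma triple_mean_swap: "triple_mean V \<epsilon> (\<lambda>R S T. h R T S) = triple_mean V \<epsilon> h"
  unfolding triple_mean_def by (intro bav_cong bav_swap)

lemma triple_mean_product:
  "triple_mean V \<epsilon> (\<lambda>R S T. a R * (b S * c T)) = bav V \<epsilon> a * (av V b * av V c)"
  by (simp add: triple_mean_def bav_cmult bav_multc)

lemma triple_mean_permute:
  assumes "finite V" "\<sigma> permutes V"
  shows "triple_mean V \<epsilon> (\<lambda>R S T. h (\<sigma> ` R) (\<sigma> ` S) (\<sigma> ` T)) = triple_mean V \<epsilon> h"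
proof -
  note bij = bav_bij[OF assms(1) permutes_imp_bij[OF assms(2)]]
  show ?thesis
    unfolding triple_mean_def
    by (subst bij, subst bij, subst bij[of _ "\<lambda>R. av V (\<lambda>S. av V (\<lambda>T. h R S T))"]) simp
qed

lemma mix_image: "inj \<sigma> \<Longrightarrow> \<sigma> ` mix R S T = mix (\<sigma> ` R) (\<sigma> ` S) (\<sigma> ` T)"
  by (auto simp: mix_def inj_def)

lemma card_eq_sum_indicator: "finite V \<Longrightarrow> A \<subseteq> V \<Longrightarrow> real (card A) = (\<Sum>x\<in>V. if x \<in> A then 1 else 0)"
  by (simp add: sum.If_cases Int_absorb1)

text \<open>A point leaves \<open>S\<close> exactly when it is in \<open>R\<close>, in
  \<open>S\<close> and not in \<open>T\<close>. These events are independent over the points and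
  have probability \<open>\<epsilon> / 4\<close>, so the variance is a sum over points, each
  contributing at most 1.\<close>

lemma triple_mean_flips:
  fixes \<epsilon> :: real
  assumes V: "finite V" and \<epsilon>: "0 \<le> \<epsilon>" "\<epsilon> \<le> 1"
  shows "triple_mean V \<epsilon> (\<lambda>R S T. (real (card (S - mix R S T)) - card V * \<epsilon> / 4)\<^sup>2) \<le> card V"
proof -
  define a where "a x R S T = (if x \<in> R then 1 else 0) * ((if x \<in> S then 1 else 0) * (if x \<in> T then 0 else 1 :: real))"
    for x :: 'a and R S T :: "'a set"
  let ?p = "\<epsilon> / 4"
  let ?E = "triple_mean V \<epsilon>"
  have ea: "?E (a x) = ?p" if "x \<in> V" for x
    unfolding a_def triple_mean_product using V that by (simp add: bav_mem)
  have ea2: "?E (\<lambda>R S T. a x R S T * a y R S T) = (if x = y then ?p else ?p * ?p)" if "x \<in> V" "y \<in> V" for x y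
  proof (cases "x = y")
    case True
    have "?E (\<lambda>R S T. a x R S T * a y R S T) = ?E (a x)"
      by (rule triple_mean_cong) (auto simp: a_def True)
    thus ?thesis using True ea that by simp
  next
    case False
    have "?E (\<lambda>R S T. a x R S T * a y R S T) =
        ?E (\<lambda>R S T. ((if x \<in> R then 1 else 0) * (if y \<in> R then 1 else 0)) *
          (((if x \<in> S then 1 else 0) * (if y \<in> S then 1 else 0)) *
           ((if x \<in> T then 0 else 1) * (if y \<in> T then 0 else 1))))"
      by (rule triple_mean_cong) (auto simp: a_def)
    also have "\<dots> = ?p * ?p"
      unfolding triple_mean_product using V that False by (simp add: bav_mem2)
    finally show ?thesis using False by simp
  qed
  have "?E (\<lambda>R S T. (real (card (S - mix R S T)) - card V * \<epsilon> / 4)\<^sup>2) =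
      ?E (\<lambda>R S T. \<Sum>x\<in>V. \<Sum>y\<in>V. a x R S T * a y R S T - ?p * a x R S T - ?p * a y R S T + ?p * ?p)"
  proof (rule triple_mean_cong)
    fix R S T assume sub: "R \<subseteq> V" "S \<subseteq> V" "T \<subseteq> V"
    have "real (card (S - mix R S T)) - card V * \<epsilon> / 4 = (\<Sum>x\<in>V. a x R S T) - (\<Sum>x\<in>V. ?p)"
      using V sub by (subst card_eq_sum_indicator[OF V]) (auto simp: mix_def a_def intro!: sum.cong)
    also have "\<dots> = (\<Sum>x\<in>V. a x R S T - ?p)"
      by (simp add: sum_subtractf)
    finally show "(real (card (S - mix R S T)) - card V * \<epsilon> / 4)\<^sup>2 =
        (\<Sum>x\<in>V. \<Sum>y\<in>V. a x R S T * a y R S T - ?p * a x R S T - ?p * a y R S T + ?p * ?p)"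
      by (simp add: power2_eq_square sum_product algebra_simps)
  qed
  also have "\<dots> = (\<Sum>x\<in>V. \<Sum>y\<in>V. (if x = y then ?p else ?p * ?p) - ?p * ?p)"
    unfolding triple_mean_sum
  proof (intro sum.cong refl)
    fix x y assume xy: "x \<in> V" "y \<in> V"
    have "?E (\<lambda>R S T. a x R S T * a y R S T - ?p * a x R S T - ?p * a y R S T + ?p * ?p) =
        ?E (\<lambda>R S T. a x R S T * a y R S T) - ?p * ?E (a x) - ?p * ?E (a y) + ?p * ?p"
      using V by (simp only: triple_mean_add triple_mean_diff triple_mean_cmult triple_mean_const)
    thus "?E (\<lambda>R S T. a x R S T * a y R S T - ?p * a x R S T - ?p * a y R S T + ?p * ?p) =
        (if x = y then ?p else ?p * ?p) - ?p * ?p"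
      by (simp add: ea ea2 xy)
  qed
  also have "\<dots> \<le> (\<Sum>x\<in>V. \<Sum>y\<in>V. if x = y then 1 else 0)"
  proof (intro sum_mono)
    fix x y :: 'a
    have *: "(if b then p else q) - q \<le> (if b then 1 else 0)" if "0 \<le> q" "p \<le> 1" for p q :: real and b
      using that by simp
    show "(if x = y then ?p else ?p * ?p) - ?p * ?p \<le> (if x = y then 1 else 0)"
      using \<epsilon> by (intro *) simp_all
  qed
  also have "\<dots> = card V"
    using V by simp
  finally show ?thesis .
qed

lemma triple_mean_flips_deviation:
  fixes \<epsilon> w :: real
  assumes V: "finite V" and \<epsilon>: "0 \<le> \<epsilon>" "\<epsilon> \<le> 1" and w: "w > 0"
  shows "triple_mean V \<epsilon> (\<lambda>R S T. if \<bar>real (card (S - mix R S T)) - card V * \<epsilon> / 4\<bar> > w then 1 else 0)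
    \<le> card V / w\<^sup>2"
proof -
  have "triple_mean V \<epsilon> (\<lambda>R S T. if \<bar>real (card (S - mix R S T)) - card V * \<epsilon> / 4\<bar> > w then 1 else 0)
      \<le> triple_mean V \<epsilon> (\<lambda>R S T. (1 / w\<^sup>2) * (real (card (S - mix R S T)) - card V * \<epsilon> / 4)\<^sup>2)"
  proof (rule triple_mean_mono[OF \<epsilon>])
    fix R S T
    have "w\<^sup>2 \<le> y\<^sup>2" if "\<bar>y\<bar> > w" for y :: real
      using that w by (metis abs_le_square_iff abs_of_pos less_imp_le)
    thus "(if \<bar>real (card (S - mix R S T)) - card V * \<epsilon> / 4\<bar> > w then 1 else 0) \<le>
        (1 / w\<^sup>2) * (real (card (S - mix R S T)) - card V * \<epsilon> / 4)\<^sup>2"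
      using w by simp
  qed
  also have "\<dots> \<le> (1 / w\<^sup>2) * card V"
    unfolding triple_mean_cmult using assms by (intro mult_left_mono triple_mean_flips) auto
  finally show ?thesis by simp
qed

text \<open>The points gained are the points lost with \<open>S\<close> and \<open>T\<close>
  exchanged, since \<open>mix R S T - S\<close> equals \<open>T - mix R T S\<close>; the symmetry of
  the two uniform sets then reuses the bound for points lost.\<close>

lemma noise_typical:
  fixes \<epsilon> w :: real
  assumes V: "finite V" and \<epsilon>: "0 \<le> \<epsilon>" "\<epsilon> \<le> 1" and w: "w > 0"
  shows "triple_mean V \<epsilon> (\<lambda>R S T. if typical V (card V * \<epsilon> / 4) w S (mix R S T) then 0 else 1)
    \<le> 3 * card V / w\<^sup>2"
proof -
  let ?A = "\<lambda>R S T. if \<bar>real (card (S - mix R S T)) - card V * \<epsilon> / 4\<bar> > w then 1 else 0 :: real"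
  let ?B = "\<lambda>R S T. if \<bar>real (card (T - mix R T S)) - card V * \<epsilon> / 4\<bar> > w then 1 else 0 :: real"
  let ?C = "\<lambda>R S T. if \<bar>real (card S) - card V / 2\<bar> > w then 1 else 0 :: real"
  have "triple_mean V \<epsilon> (\<lambda>R S T. if typical V (card V * \<epsilon> / 4) w S (mix R S T) then 0 else 1) \<le>
      triple_mean V \<epsilon> (\<lambda>R S T. ?A R S T + ?B R S T + ?C R S T)"
  proof (rule triple_mean_mono[OF \<epsilon>])
    fix R S T assume "R \<subseteq> V" "S \<subseteq> V" "T \<subseteq> V"
    moreover have "mix R S T - S = T - mix R T S" if "R \<subseteq> V"
      by (auto simp: mix_def)
    ultimately show "(if typical V (card V * \<epsilon> / 4) w S (mix R S T) then 0 else 1) \<le>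
        ?A R S T + ?B R S T + ?C R S T"
      using mix_subset[of S V T R] by (auto simp: typical_def)
  qed
  also have "\<dots> = triple_mean V \<epsilon> ?A + triple_mean V \<epsilon> ?B + triple_mean V \<epsilon> ?C"
    by (simp add: triple_mean_add)
  also have "triple_mean V \<epsilon> ?B = triple_mean V \<epsilon> ?A"
    by (rule triple_mean_swap)
  also have "triple_mean V \<epsilon> ?C \<le> card V / (4 * w\<^sup>2)"
    using av_card_deviation[OF V w] V by (simp add: triple_mean_def bav_const)
  also have "card V / (4 * w\<^sup>2) \<le> card V / w\<^sup>2"
    using w by (intro divide_left_mono) auto
  finally show ?thesis
    using triple_mean_flips_deviation[OF assms] by simp
qed

lemma sym_corr_abs_le:
  assumes "finite V" "\<And>X. X \<subseteq> V \<Longrightarrow> \<bar>h X\<bar> \<le> 1" "X \<subseteq> V" "Y \<subseteq> V"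
  shows "\<bar>sym_corr V h X Y\<bar> \<le> 1"
proof -
  have "\<bar>sym_corr V h X Y\<bar> \<le> perm_mean V (\<lambda>\<sigma>. \<bar>h (\<sigma> ` X) * h (\<sigma> ` Y)\<bar>)"
    unfolding sym_corr_def by (rule perm_mean_abs)
  also have "\<dots> \<le> perm_mean V (\<lambda>\<sigma>. 1)"
    unfolding abs_mult
    by (intro perm_mean_mono mult_le_one abs_ge_zero assms(2-4) permutes_image_subset)
  finally show ?thesis using assms(1) by (simp add: perm_mean_const)
qed

text \<open>Relabelling all three random sets by a fixed permutation preserves their joint law and
  commutes with \<open>mix\<close>; averaging over permutations produces
  \<open>sym_corr\<close>.\<close>

lemma noise_correlation_sym:
  assumes "finite V"
  shows "bav V \<epsilon> (noise_energy V h) = triple_mean V \<epsilon> (\<lambda>R S T. sym_corr V h S (mix R S T))"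
proof -
  have "triple_mean V \<epsilon> (\<lambda>R S T. sym_corr V h S (mix R S T)) =
      perm_mean V (\<lambda>\<sigma>. triple_mean V \<epsilon> (\<lambda>R S T. h (\<sigma> ` S) * h (\<sigma> ` mix R S T)))"
    by (simp add: triple_mean_def sym_corr_def perm_mean_def bav_divide bav_sum)
  also have "\<dots> = perm_mean V (\<lambda>\<sigma>. triple_mean V \<epsilon> (\<lambda>R S T. h S * h (mix R S T)))"
  proof (rule perm_mean_cong)
    fix \<sigma> assume \<sigma>: "\<sigma> permutes V"
    show "triple_mean V \<epsilon> (\<lambda>R S T. h (\<sigma> ` S) * h (\<sigma> ` mix R S T)) =
        triple_mean V \<epsilon> (\<lambda>R S T. h S * h (mix R S T))"
      unfolding mix_image[OF permutes_inj[OF \<sigma>]]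
      using triple_mean_permute[OF assms \<sigma>, of \<epsilon> "\<lambda>R S T. h S * h (mix R S T)"] .
  qed
  also have "\<dots> = bav V \<epsilon> (noise_energy V h)"
    using assms by (simp add: perm_mean_const triple_mean_def noise_energy_eq[OF assms] cong: bav_cong)
  finally show ?thesis ..
qed

text \<open>The noise correlation is the mean of \<open>sym_corr\<close> over noise pairs. Typical
  ones differ from the given pair by at most four increments of the level average; the others have
  weight at most \<open>3 * card V / w\<^sup>2\<close> and cost at most 2 each.\<close>

lemma typical_noise_correlation:
  fixes \<epsilon> w :: real
  assumes V: "finite V" and \<epsilon>: "0 \<le> \<epsilon>" "\<epsilon> \<le> 1 / 2" and w: "w > 0" "w \<le> 3 * card V / 32"
    and h: "\<And>X Y. X \<subseteq> Y \<Longrightarrow> Y \<subseteq> V \<Longrightarrow> h X \<le> h Y" "\<And>X. X \<subseteq> V \<Longrightarrow> \<bar>h X\<bar> \<le> 1"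
    and t: "typical V (card V * \<epsilon> / 4) w X Y"
    and LH: "L \<subseteq> V" "H \<subseteq> V" "card L \<le> card V / 2 - 3 * w" "card V / 2 + 3 * w \<le> card H"
  shows "\<bar>sym_corr V h X Y - bav V \<epsilon> (noise_energy V h)\<bar> \<le>
    4 * (sym_mean V h H - sym_mean V h L) + 6 * card V / w\<^sup>2"
proof -
  let ?D = "4 * (sym_mean V h H - sym_mean V h L)"
  let ?E = "triple_mean V \<epsilon>" and ?u = "sym_corr V h X Y"
  let ?bad = "\<lambda>R S T. if typical V (card V * \<epsilon> / 4) w S (mix R S T) then 0 else 1 :: real"
  have XY: "X \<subseteq> V" "Y \<subseteq> V" using t by (auto simp: typical_def)
  have D0: "0 \<le> ?D"
  proof -
    have "real (card L) \<le> card H" using LH w by linarith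
    thus ?thesis using sym_mean_mono_card[OF V h(1) LH(1,2)] by simp
  qed
  have *: "\<bar>?u - sym_corr V h S (mix R S T)\<bar> \<le> ?D + 2 * ?bad R S T"
    if "R \<subseteq> V" "S \<subseteq> V" "T \<subseteq> V" for R S T
  proof (cases "typical V (card V * \<epsilon> / 4) w S (mix R S T)")
    case True
    have "card V * \<epsilon> / 4 \<le> card V / 8"
      using mult_left_mono[OF \<epsilon>(2), of "real (card V)"] by (simp add: mult_ac)
    thus ?thesis using sym_corr_typical[where h = h, OF V h t True _ w(2) LH] True by simp
  next
    case False
    have "\<bar>?u\<bar> \<le> 1" "\<bar>sym_corr V h S (mix R S T)\<bar> \<le> 1"
      using sym_corr_abs_le[where h = h, OF V h(2) XY]
        sym_corr_abs_le[where h = h, OF V h(2) that(2) mix_subset[OF that(2,3)]] by auto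
    thus ?thesis using False D0 by simp
  qed
  have E: "?E (\<lambda>R S T. ?D + 2 * ?bad R S T) \<le> ?D + 6 * card V / w\<^sup>2"
    using noise_typical[OF V \<epsilon>(1) _ w(1)] \<epsilon> V
    by (simp only: triple_mean_add triple_mean_cmult triple_mean_const) simp
  have "?E (\<lambda>R S T. ?u - sym_corr V h S (mix R S T)) \<le> ?E (\<lambda>R S T. ?D + 2 * ?bad R S T)"
    using * \<epsilon> by (intro triple_mean_mono) (auto simp: abs_le_iff)
  moreover have "?E (\<lambda>R S T. sym_corr V h S (mix R S T) - ?u) \<le> ?E (\<lambda>R S T. ?D + 2 * ?bad R S T)"
    using * \<epsilon> by (intro triple_mean_mono) (auto simp: abs_le_iff)
  ultimately show ?thesis
    using E V by (simp add: triple_mean_diff triple_mean_const noise_correlation_sym abs_le_iff)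
qed

section \<open>Correlations along a random permutation with conjugation-invariant law\<close>

lemma sum_permutes_conj:
  assumes "\<tau> permutes V"
  shows "(\<Sum>\<sigma> | \<sigma> permutes V. h (\<tau> \<circ> \<sigma> \<circ> inv \<tau>)) = (\<Sum>\<sigma> | \<sigma> permutes V. h \<sigma>)"
proof (rule sum.reindex_bij_witness[where i = "\<lambda>\<sigma>. inv \<tau> \<circ> \<sigma> \<circ> \<tau>" and j = "\<lambda>\<sigma>. \<tau> \<circ> \<sigma> \<circ> inv \<tau>"])
  have inv: "inv \<tau> permutes V" using permutes_inv[OF assms] .
  have 1: "\<tau> \<circ> inv \<tau> = id" "inv \<tau> \<circ> \<tau> = id"
    using permutes_inv_o[OF assms] by auto
  fix \<sigma> assume "\<sigma> \<in> {\<sigma>. \<sigma> permutes V}"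
  thus "\<tau> \<circ> \<sigma> \<circ> inv \<tau> \<in> {\<sigma>. \<sigma> permutes V}" "inv \<tau> \<circ> \<sigma> \<circ> \<tau> \<in> {\<sigma>. \<sigma> permutes V}"
    using assms inv by (auto intro!: permutes_compose)
  show "inv \<tau> \<circ> (\<tau> \<circ> \<sigma> \<circ> inv \<tau>) \<circ> \<tau> = \<sigma>" "\<tau> \<circ> (inv \<tau> \<circ> \<sigma> \<circ> \<tau>) \<circ> inv \<tau> = \<sigma>"
    using 1 by (metis comp_assoc comp_id id_comp)+
qed auto

text \<open>For each fixed \<tau>, reindexing the sum by conjugation and \<open>S\<close> by its
  image under \<tau> leaves the value unchanged and applies \<tau> to both arguments of
  \<open>h\<close>. Averaging over \<tau> produces \<open>sym_corr\<close>.\<close>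

lemma conj_invariant_correlation:
  assumes V: "finite V"
    and conj: "\<And>\<sigma> \<tau>. \<sigma> permutes V \<Longrightarrow> \<tau> permutes V \<Longrightarrow> pl (\<tau> \<circ> \<sigma> \<circ> inv \<tau>) = pl \<sigma>"
  shows "(\<Sum>\<sigma> | \<sigma> permutes V. pl \<sigma> * av V (\<lambda>S. h S * h (\<sigma> ` S))) =
    av V (\<lambda>S. \<Sum>\<sigma> | \<sigma> permutes V. pl \<sigma> * sym_corr V h S (\<sigma> ` S))"
proof -
  let ?P = "{\<sigma>. \<sigma> permutes V}"
  let ?C = "\<Sum>\<sigma>\<in>?P. pl \<sigma> * av V (\<lambda>S. h S * h (\<sigma> ` S))"
  have "(\<Sum>\<sigma>\<in>?P. pl \<sigma> * av V (\<lambda>S. h (\<tau> ` S) * h (\<tau> ` \<sigma> ` S))) = ?C" if \<tau>: "\<tau> permutes V" for \<tau>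
  proof -
    have "?C = (\<Sum>\<sigma>\<in>?P. pl (\<tau> \<circ> \<sigma> \<circ> inv \<tau>) * av V (\<lambda>S. h S * h ((\<tau> \<circ> \<sigma> \<circ> inv \<tau>) ` S)))"
      by (rule sum_permutes_conj[OF \<tau>, symmetric])
    also have "\<dots> = (\<Sum>\<sigma>\<in>?P. pl \<sigma> * av V (\<lambda>S. h (\<tau> ` S) * h (\<tau> ` \<sigma> ` S)))"
    proof (intro sum.cong refl arg_cong2[of _ _ _ _ "(*)"])
      fix \<sigma> assume "\<sigma> \<in> ?P"
      thus "pl (\<tau> \<circ> \<sigma> \<circ> inv \<tau>) = pl \<sigma>" using conj \<tau> by simp
      have "(\<tau> \<circ> \<sigma> \<circ> inv \<tau>) ` (\<tau> ` S) = \<tau> ` \<sigma> ` S" for S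
        using permutes_inverses(2)[OF \<tau>] by (simp add: image_comp comp_def)
      thus "av V (\<lambda>S. h S * h ((\<tau> \<circ> \<sigma> \<circ> inv \<tau>) ` S)) = av V (\<lambda>S. h (\<tau> ` S) * h (\<tau> ` \<sigma> ` S))"
        using bav_bij[OF V permutes_imp_bij[OF \<tau>], of "1/2" "\<lambda>S. h S * h ((\<tau> \<circ> \<sigma> \<circ> inv \<tau>) ` S)"] by simp
    qed
    finally show ?thesis ..
  qed
  hence "?C = perm_mean V (\<lambda>\<tau>. \<Sum>\<sigma>\<in>?P. pl \<sigma> * av V (\<lambda>S. h (\<tau> ` S) * h (\<tau> ` \<sigma> ` S)))"
    using perm_mean_const[OF V, of ?C] by (simp cong: perm_mean_cong)
  also have "\<dots> = (\<Sum>\<sigma>\<in>?P. pl \<sigma> * perm_mean V (\<lambda>\<tau>. av V (\<lambda>S. h (\<tau> ` S) * h (\<tau> ` \<sigma> ` S))))"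
    unfolding perm_mean_def
    by (subst sum.swap) (simp add: sum_distrib_left sum_divide_distrib)
  also have "\<dots> = (\<Sum>\<sigma>\<in>?P. pl \<sigma> * av V (\<lambda>S. sym_corr V h S (\<sigma> ` S)))"
    by (simp add: perm_mean_def sym_corr_def bav_sum bav_divide)
  finally show ?thesis by (simp add: bav_sum bav_cmult)
qed

text \<open>An unbalanced \<open>S\<close>, of probability at most
  \<open>card V / (4 * w\<^sup>2)\<close>, and a bad permutation, of probability at most
  \<open>q\<close>, each cost at most 2; elsewhere the error is at most
  \<open>\<eta>\<close>.\<close>

lemma exclusion_correlation_bound:
  fixes w q \<eta> :: real
  assumes V: "finite V" and w: "w > 0"
    and h: "\<And>X. X \<subseteq> V \<Longrightarrow> \<bar>h X\<bar> \<le> 1"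
    and pl: "\<And>\<sigma>. 0 \<le> pl \<sigma>" "(\<Sum>\<sigma> | \<sigma> permutes V. pl \<sigma>) = 1"
      "\<And>\<sigma> \<tau>. \<sigma> permutes V \<Longrightarrow> \<tau> permutes V \<Longrightarrow> pl (\<tau> \<circ> \<sigma> \<circ> inv \<tau>) = pl \<sigma>"
    and bad: "\<And>S. S \<subseteq> V \<Longrightarrow> \<bar>real (card S) - card V / 2\<bar> \<le> w \<Longrightarrow>
      (\<Sum>\<sigma> | \<sigma> permutes V. if good S \<sigma> then 0 else pl \<sigma>) \<le> q"
    and good: "\<And>S \<sigma>. S \<subseteq> V \<Longrightarrow> \<sigma> permutes V \<Longrightarrow> \<bar>real (card S) - card V / 2\<bar> \<le> w \<Longrightarrow> good S \<sigma> \<Longrightarrow>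
      \<bar>sym_corr V h S (\<sigma> ` S) - c\<bar> \<le> \<eta>"
    and c: "\<bar>c\<bar> \<le> 1" and \<eta>: "0 \<le> \<eta>" and q: "0 \<le> q"
  shows "\<bar>(\<Sum>\<sigma> | \<sigma> permutes V. pl \<sigma> * av V (\<lambda>S. h S * h (\<sigma> ` S))) - c\<bar> \<le>
    card V / (2 * w\<^sup>2) + 2 * q + \<eta>"
proof -
  let ?P = "{\<sigma>. \<sigma> permutes V}"
  let ?dev = "\<lambda>S. if \<bar>real (card S) - card V / 2\<bar> > w then 1 else 0 :: real"
  let ?G = "\<lambda>S. \<Sum>\<sigma>\<in>?P. pl \<sigma> * sym_corr V h S (\<sigma> ` S)"
  have two: "\<bar>sym_corr V h S (\<sigma> ` S) - c\<bar> \<le> 2" if "S \<subseteq> V" "\<sigma> permutes V" for S \<sigma>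
    using sym_corr_abs_le[where h = h, OF V h that(1) permutes_image_subset[OF that(2,1)]] c by auto
  have G: "\<bar>?G S - c\<bar> \<le> 2 * ?dev S + 2 * q + \<eta>" if S: "S \<subseteq> V" for S
  proof -
    have "?G S - c = (\<Sum>\<sigma>\<in>?P. pl \<sigma> * (sym_corr V h S (\<sigma> ` S) - c))"
      using pl(2) by (simp add: right_diff_distrib sum_subtractf flip: sum_distrib_right)
    also have "\<bar>\<dots>\<bar> \<le> (\<Sum>\<sigma>\<in>?P. pl \<sigma> * \<bar>sym_corr V h S (\<sigma> ` S) - c\<bar>)"
      using sum_abs[of "\<lambda>\<sigma>. pl \<sigma> * (sym_corr V h S (\<sigma> ` S) - c)" ?P] pl(1) by (simp add: abs_mult)
    also have "\<dots> \<le> 2 * ?dev S + 2 * q + \<eta>"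
    proof (cases "\<bar>real (card S) - card V / 2\<bar> > w")
      case True
      have "(\<Sum>\<sigma>\<in>?P. pl \<sigma> * \<bar>sym_corr V h S (\<sigma> ` S) - c\<bar>) \<le> (\<Sum>\<sigma>\<in>?P. pl \<sigma> * 2)"
        using two[OF S] pl(1) by (intro sum_mono mult_left_mono) auto
      thus ?thesis using True pl(2) \<eta> q by (simp flip: sum_distrib_right)
    next
      case False
      have "(\<Sum>\<sigma>\<in>?P. pl \<sigma> * \<bar>sym_corr V h S (\<sigma> ` S) - c\<bar>) \<le>
          (\<Sum>\<sigma>\<in>?P. 2 * (if good S \<sigma> then 0 else pl \<sigma>) + pl \<sigma> * \<eta>)"
      proof (rule sum_mono)
        fix \<sigma> assume "\<sigma> \<in> ?P"
        hence "good S \<sigma> \<Longrightarrow> pl \<sigma> * \<bar>sym_corr V h S (\<sigma> ` S) - c\<bar> \<le> pl \<sigma> * \<eta>"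
          "pl \<sigma> * \<bar>sym_corr V h S (\<sigma> ` S) - c\<bar> \<le> pl \<sigma> * 2" "0 \<le> pl \<sigma> * \<eta>"
          using two[OF S] good[OF S] False pl(1) \<eta> by (auto intro!: mult_left_mono)
        thus "pl \<sigma> * \<bar>sym_corr V h S (\<sigma> ` S) - c\<bar> \<le> 2 * (if good S \<sigma> then 0 else pl \<sigma>) + pl \<sigma> * \<eta>"
          by auto
      qed
      also have "\<dots> = 2 * (\<Sum>\<sigma>\<in>?P. if good S \<sigma> then 0 else pl \<sigma>) + \<eta>"
        using pl(2) by (simp only: sum.distrib sum_distrib_left[symmetric] sum_distrib_right[symmetric])
      also have "\<dots> \<le> 2 * q + \<eta>"
        using bad[OF S] False by simp
      finally show ?thesis using False by simp
    qed
    finally show ?thesis .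
  qed
  have *: "?G S - c \<le> 2 * ?dev S + 2 * q + \<eta>" "c - ?G S \<le> 2 * ?dev S + 2 * q + \<eta>" if "S \<subseteq> V" for S
    using abs_le_D1[OF G[OF that]] abs_le_D2[OF G[OF that]] by (simp_all only: minus_diff_eq)
  have b: "av V (\<lambda>S. 2 * ?dev S + 2 * q + \<eta>) \<le> card V / (2 * w\<^sup>2) + 2 * q + \<eta>"
    using av_card_deviation[OF V w]
    by (simp only: bav_add bav_cmult bav_const[OF V])
  have "av V (\<lambda>S. ?G S - c) \<le> av V (\<lambda>S. 2 * ?dev S + 2 * q + \<eta>)"
       "av V (\<lambda>S. c - ?G S) \<le> av V (\<lambda>S. 2 * ?dev S + 2 * q + \<eta>)"
    using * by (intro bav_mono; simp)+
  hence "\<bar>av V ?G - c\<bar> \<le> card V / (2 * w\<^sup>2) + 2 * q + \<eta>"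
    using b unfolding bav_diff bav_const[OF V] by linarith
  thus ?thesis
    using conj_invariant_correlation[where pl = pl and h = h, OF V pl(3)] by simp
qed

text \<open>A pair at distance \<open>j\<close> on the same level is typical for the noise parameter \<open>\<epsilon> = 4 j / n\<close>.\<close>

lemma noise_implies_exclusion_bound:
  fixes M q :: real
  assumes V: "finite V" and M: "M \<ge> 1" "24 * M + 36 \<le> sqrt (card V)"
    and h: "\<And>X Y. X \<subseteq> Y \<Longrightarrow> Y \<subseteq> V \<Longrightarrow> h X \<le> h Y" "\<And>X. X \<subseteq> V \<Longrightarrow> \<bar>h X\<bar> \<le> 1"
    and pl: "\<And>\<sigma>. 0 \<le> pl \<sigma>" "(\<Sum>\<sigma> | \<sigma> permutes V. pl \<sigma>) = 1"
      "\<And>\<sigma> \<tau>. \<sigma> permutes V \<Longrightarrow> \<tau> permutes V \<Longrightarrow> pl (\<tau> \<circ> \<sigma> \<circ> inv \<tau>) = pl \<sigma>"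
    and bad: "\<And>S. S \<subseteq> V \<Longrightarrow> card V / 4 \<le> card S \<Longrightarrow> card S \<le> 3 * card V / 4 \<Longrightarrow>
      (\<Sum>\<sigma> | \<sigma> permutes V. if card V / 512 \<le> card (S - \<sigma> ` S) \<and> card (S - \<sigma> ` S) \<le> card V / 8
        then 0 else pl \<sigma>) \<le> q"
    and q: "0 \<le> q"
  defines "\<beta> \<equiv> bav V (1 / 128) (noise_energy V h) - (av V h)\<^sup>2"
  shows "\<bar>(\<Sum>\<sigma> | \<sigma> permutes V. pl \<sigma> * av V (\<lambda>S. h S * h (\<sigma> ` S))) - (av V h)\<^sup>2\<bar> \<le>
    7 / M\<^sup>2 + 2 * q + \<beta> + 4 * sqrt \<beta> / tail_const (3 * M + 1)"
proof -
  define r where "r = sqrt (card V)"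
  define w where "w = M * r"
  let ?K = "3 * M + 1"
  have r: "r \<ge> 60" using M unfolding r_def by linarith
  have rr: "r * r = card V" by (simp add: r_def)
  have n0: "real (card V) > 0" using r rr by (metis mult_pos_pos less_le_trans zero_less_numeral)
  have wr: "r \<le> w" using M(1) r by (simp add: w_def)
  have w0: "w > 0" using wr r by linarith
  have Mr: "(24 * M + 36) * r \<le> card V"
    using mult_right_mono[of "24 * M + 36" r r] M(2) r rr by (simp add: r_def)
  have w_small: "24 * w + 36 * r \<le> card V" using Mr by (simp add: w_def algebra_simps)
  have nw: "card V / w\<^sup>2 = 1 / M\<^sup>2"
    using r M n0 by (simp add: w_def power2_eq_square divide_simps flip: rr)
  define k where "k = nat \<lceil>card V / 2 + 3 * w\<rceil>"
  have k: "card V / 2 + 3 * w \<le> k" "k \<le> card V / 2 + 3 * w + 1"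
    using w0 n0 by (simp_all add: k_def)
  have kV: "k \<le> card V"
    using k w_small r by linarith
  obtain H where H: "H \<subseteq> V" "card H = k"
    using obtain_subset_with_card_n[OF kV] by metis
  obtain L where L: "L \<subseteq> V" "card L = card V - k"
    by (metis diff_le_self obtain_subset_with_card_n)
  have Lr: "real (card L) = card V - real k" using L kV by (simp add: of_nat_diff)
  have LH: "card L \<le> card V / 2 - 3 * w" "card V / 2 + 3 * w \<le> card H"
    using k Lr H by linarith+
  let ?\<Delta> = "sym_mean V h H - sym_mean V h L"
  define a where "a = av V (\<lambda>S. h S * magnetization V S)"
  have Kr: "?K * r = 3 * w + r" by (simp add: w_def algebra_simps)
  have flat: "2 * tail_const ?K * ?\<Delta> \<le> a"
    unfolding a_def
  proof (rule sym_mean_flat[OF V _ _ h(1) L(1) H(1)])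
    show "2 * (4 * ?K + 14) \<le> sqrt (card V)" using M by simp
    show "card V / 2 - ?K * sqrt (card V) \<le> card L"
      unfolding r_def[symmetric] Kr using k Lr r by linarith
    show "card H \<le> card V / 2 + ?K * sqrt (card V)"
      unfolding r_def[symmetric] Kr using k H r by linarith
    show "card L \<le> card V / 2 - sqrt (card V)" "card V / 2 + sqrt (card V) \<le> card H"
      unfolding r_def[symmetric] using LH wr r by linarith+
  qed (use M in auto)
  \<comment> \<open>Sensitivity at \<open>1 / 128\<close> bounds the covariance \<open>a\<close>
    with the magnetization, and through \<open>flat\<close> the increment of the level
    averages.\<close>
  have \<beta>: "(127 / 128 * a)\<^sup>2 \<le> \<beta>"
    using noise_correlation_ge_magnetization[OF V, of "1 / 128" h] by (simp add: a_def \<beta>_def)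
  have \<beta>0: "0 \<le> \<beta>" using \<beta> zero_le_power2[of "127 / 128 * a"] by linarith
  have "127 / 128 * a \<le> sqrt \<beta>"
    using \<beta> by (rule real_le_rsqrt)
  hence "a \<le> 2 * sqrt \<beta>"
    using real_sqrt_ge_zero[OF \<beta>0] by linarith
  hence "tail_const ?K * ?\<Delta> \<le> sqrt \<beta>" using flat by linarith
  hence "?\<Delta> \<le> sqrt \<beta> / tail_const ?K"
    using tail_const_pos[of ?K] by (simp add: field_simps)
  then obtain \<delta> where \<delta>: "\<delta> = sqrt \<beta> / tail_const ?K" "?\<Delta> \<le> \<delta>"
    by blast
  define good where "good S \<sigma> \<longleftrightarrow> card V / 512 \<le> card (S - \<sigma> ` S) \<and> card (S - \<sigma> ` S) \<le> card V / 8"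
    for S and \<sigma> :: "'a \<Rightarrow> 'a"
  define \<eta> where "\<eta> = 4 * \<delta> + 6 / M\<^sup>2 + \<beta>"
  have "\<bar>(\<Sum>\<sigma> | \<sigma> permutes V. pl \<sigma> * av V (\<lambda>S. h S * h (\<sigma> ` S))) - (av V h)\<^sup>2\<bar> \<le>
    card V / (2 * w\<^sup>2) + 2 * q + \<eta>"
  proof (rule exclusion_correlation_bound[where good = good, OF V w0 h(2) pl])
    fix S assume S: "S \<subseteq> V" "\<bar>real (card S) - card V / 2\<bar> \<le> w"
    have "\<bar>x - y / 2\<bar> \<le> w \<Longrightarrow> 4 * w \<le> y \<Longrightarrow> y / 4 \<le> x \<and> x \<le> 3 * y / 4" for x y :: real
      by (simp add: abs_le_iff)
    moreover have "4 * w \<le> card V"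
      using w_small r w0 by linarith
    ultimately have "card V / 4 \<le> card S" "card S \<le> 3 * card V / 4"
      using S(2) by (metis of_nat_mult of_nat_numeral)+
    thus "(\<Sum>\<sigma> | \<sigma> permutes V. if good S \<sigma> then 0 else pl \<sigma>) \<le> q"
      unfolding good_def by (intro bad S(1))
    fix \<sigma> assume \<sigma>: "\<sigma> permutes V" and g: "good S \<sigma>"
    define j where "j = card (S - \<sigma> ` S)"
    define \<epsilon> where "\<epsilon> = 4 * real j / card V"
    have \<epsilon>: "1 / 128 \<le> \<epsilon>" "\<epsilon> \<le> 1 / 2"
      using g n0 by (auto simp: good_def \<epsilon>_def j_def field_simps)
    have j: "card V * \<epsilon> / 4 = j" using n0 by (simp add: \<epsilon>_def)
    have fin: "finite S" using S(1) V finite_subset by blast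
    have "card (\<sigma> ` S - S) = card (S - \<sigma> ` S)"
    proof -
      have "card (\<sigma> ` S) = card S" using \<sigma> by (simp add: card_image permutes_inj_on)
      thus ?thesis
        using fin card_Diff_subset_Int[of "\<sigma> ` S" S] card_Diff_subset_Int[of S "\<sigma> ` S"]
        by (simp add: Int_commute)
    qed
    hence t: "typical V (card V * \<epsilon> / 4) w S (\<sigma> ` S)"
      unfolding j using S w0 permutes_image_subset[OF \<sigma> S(1)] by (simp add: typical_def j_def)
    have "\<bar>sym_corr V h S (\<sigma> ` S) - bav V \<epsilon> (noise_energy V h)\<bar> \<le> 4 * ?\<Delta> + 6 * card V / w\<^sup>2"
    proof (rule typical_noise_correlation[where h = h, OF V _ \<epsilon>(2) w0 _ h t L(1) H(1) LH])
      show "0 \<le> \<epsilon>" using \<epsilon> by linarith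
      show "w \<le> 3 * card V / 32" using w_small r w0 by simp
    qed
    \<comment> \<open>The correlation at \<open>\<epsilon>\<close>, which depends on
      \<open>S\<close> and \<open>\<sigma>\<close>, is squeezed between the squared mean and the
      correlation at \<open>1 / 128\<close>; this makes the bound uniform.\<close>
    moreover have "bav V \<epsilon> (noise_energy V h) \<le> bav V (1 / 128) (noise_energy V h)"
      using \<epsilon> by (intro bav_antimono_prob V noise_energy_antimono) auto
    moreover have "bav V \<epsilon> (\<lambda>R. (av V h)\<^sup>2) \<le> bav V \<epsilon> (noise_energy V h)"
      using \<epsilon> by (intro bav_mono noise_energy_ge_square_mean V) auto
    hence "(av V h)\<^sup>2 \<le> bav V \<epsilon> (noise_energy V h)" by (simp add: bav_const[OF V])
    moreover have "6 * card V / w\<^sup>2 = 6 / M\<^sup>2"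
      using nw by (metis times_divide_eq_right mult.right_neutral of_nat_mult of_nat_numeral)
    moreover have "bav V (1 / 128) (noise_energy V h) = \<beta> + (av V h)\<^sup>2"
      by (simp add: \<beta>_def)
    moreover have "\<bar>s - c\<bar> \<le> 4 * d + x + b"
      if "\<bar>s - B\<bar> \<le> 4 * D + y" "B \<le> B'" "c \<le> B" "y = x" "B' = b + c" "D \<le> d"
      for s c d x b B D y B' :: real
      using that by linarith
    ultimately show "\<bar>sym_corr V h S (\<sigma> ` S) - (av V h)\<^sup>2\<bar> \<le> \<eta>"
      using \<delta>(2) unfolding \<eta>_def by blast
  next
    have "\<bar>av V h\<bar> \<le> 1"
    proof -
      have "av V h \<le> av V (\<lambda>_. 1)" "av V (\<lambda>_. -1) \<le> av V h"
        using h(2) by (intro bav_mono; force simp: abs_le_iff)+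
      thus ?thesis using bav_const[OF V, of "1/2" 1] bav_const[OF V, of "1/2" "-1"] by linarith
    qed
    thus "\<bar>(av V h)\<^sup>2\<bar> \<le> 1" by (simp add: abs_square_le_1)
    show "0 \<le> \<eta>"
      using \<beta>0 tail_const_pos[of ?K] by (simp add: \<eta>_def \<delta>(1))
  qed (use q in auto)
  \<comment> \<open>The numerator 7 in the claim is this 1 plus the 6 in
    \<open>\<eta>\<close>.\<close>
  moreover have "card V / (2 * w\<^sup>2) \<le> 1 / M\<^sup>2"
    using nw M by (simp add: field_simps)
  ultimately show ?thesis unfolding \<eta>_def \<delta>(1) by simp
qed

section \<open>The interchange permutation\<close>

lemma edgesE:
  assumes "e \<in> edges V"
  obtains x y where "x \<in> V" "y \<in> V" "x \<noteq> y" "e = {x, y}"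
  using assms by (auto simp: edges_def card_2_iff)

lemma doubleton_in_edges: "x \<in> V \<Longrightarrow> y \<in> V \<Longrightarrow> x \<noteq> y \<Longrightarrow> {x, y} \<in> edges V"
  by (auto simp: edges_def)

lemma finite_edges: "finite V \<Longrightarrow> finite (edges V)"
  unfolding edges_def by (rule finite_subset[of _ "Pow V"]) auto

lemma edge_swap_doubleton: "x \<noteq> y \<Longrightarrow> edge_swap {x, y} = Transposition.transpose x y"
proof
  fix z assume "x \<noteq> y"
  hence "{x, y} - {x} = {y}" "{x, y} - {y} = {x}" by auto
  thus "edge_swap {x, y} z = Transposition.transpose x y z"
    by (auto simp: edge_swap_def Transposition.transpose_def)
qed

lemma edge_swap_permutes: "e \<in> edges V \<Longrightarrow> edge_swap e permutes V"
  by (elim edgesE) (simp add: edge_swap_doubleton permutes_swap_id)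

lemma edge_swap_image:
  assumes "e \<in> edges V" "bij \<tau>"
  shows "edge_swap (\<tau> ` e) = \<tau> \<circ> edge_swap e \<circ> inv \<tau>"
proof -
  obtain x y where xy: "x \<noteq> y" "e = {x, y}" using assms(1) by (elim edgesE)
  have inj: "\<tau> u = \<tau> v \<longleftrightarrow> u = v" for u v using assms(2) by (auto simp: bij_def inj_def)
  show ?thesis
  proof
    fix w
    obtain z where w: "w = \<tau> z" using assms(2) by (metis bij_pointE)
    have "inv \<tau> w = z" using assms(2) by (simp add: w bij_is_inj)
    thus "edge_swap (\<tau> ` e) w = (\<tau> \<circ> edge_swap e \<circ> inv \<tau>) w"
      using xy inj by (simp add: w edge_swap_doubleton Transposition.transpose_def)
  qed
qed

definition swaps :: "'v set list \<Rightarrow> 'v \<Rightarrow> 'v" where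
  "swaps es = fold (\<lambda>e \<pi>. edge_swap e \<circ> \<pi>) es id"

lemma fold_swaps:
  fixes \<pi> :: "'v \<Rightarrow> 'v"
  shows "fold (\<lambda>e \<pi>. edge_swap e \<circ> \<pi>) es \<pi> = swaps es \<circ> \<pi>"
proof (induction es arbitrary: \<pi>)
  case (Cons e es)
  have "swaps (e # es) = swaps es \<circ> edge_swap e"
    using Cons[of "edge_swap e"] by (simp only: swaps_def fold_simps comp_id)
  thus ?case
    using Cons[of "edge_swap e \<circ> \<pi>"] by (simp only: fold_simps comp_assoc)
qed (simp add: swaps_def)

lemma swaps_Nil [simp]: "swaps [] = id"
  by (simp add: swaps_def)

lemma swaps_Cons: "swaps (e # es) = swaps es \<circ> edge_swap e"
  using fold_swaps[of es "edge_swap e"] by (simp only: swaps_def fold_simps comp_id)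

lemma swaps_append: "swaps (es @ es') = swaps es' \<circ> swaps es"
  by (induction es) (simp_all add: swaps_Cons comp_assoc)

lemma swaps_permutes: "set es \<subseteq> edges V \<Longrightarrow> swaps es permutes V"
  by (induction es) (auto simp: swaps_Cons permutes_id edge_swap_permutes intro: permutes_compose)

lemma swaps_fixed: "(\<And>e. e \<in> set es \<Longrightarrow> x \<notin> e) \<Longrightarrow> swaps es x = x"
  by (induction es) (auto simp: swaps_Cons edge_swap_def)

lemma swaps_image:
  assumes "set es \<subseteq> edges V" "bij \<tau>"
  shows "swaps (map ((`) \<tau>) es) = \<tau> \<circ> swaps es \<circ> inv \<tau>"
  using assms(1)
proof (induction es)
  case Nil
  show ?case using assms(2) by (auto simp: fun_eq_iff bij_is_surj surj_f_inv_f)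
next
  case (Cons e es)
  show ?case
    using Cons edge_swap_image[of e V \<tau>] assms(2) by (simp add: swaps_Cons fun_eq_iff bij_is_inj)
qed

definition ringing_edges :: "'v set \<Rightarrow> real \<Rightarrow> ('v set \<times> nat \<Rightarrow> real) \<Rightarrow> 'v set list" where
  "ringing_edges V t c = map (ringing_edge V c) (sorted_list_of_set (ring_times V t c))"

lemma interchange_perm_eq_swaps: "interchange_perm V t c = swaps (ringing_edges V t c)"
  by (simp add: interchange_perm_def ringing_edges_def swaps_def fold_map comp_def)

lemma ringing_edge_props:
  assumes "s \<in> ring_times V t c"
  shows "ringing_edge V c s \<in> edges V" "\<exists>k. ring_time c (ringing_edge V c s) k = s"
proof -
  have "\<exists>e. e \<in> edges V \<and> (\<exists>k. ring_time c e k = s)"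
    using assms by (auto simp: ring_times_def)
  from someI_ex[OF this] show "ringing_edge V c s \<in> edges V" "\<exists>k. ring_time c (ringing_edge V c s) k = s"
    by (auto simp: ringing_edge_def)
qed

lemma set_sorted_list_subset: "set (sorted_list_of_set A) \<subseteq> A"
  by (cases "finite A") auto

lemma ringing_edges_subset: "set (ringing_edges V t c) \<subseteq> edges V"
  using set_sorted_list_subset[of "ring_times V t c"] ringing_edge_props(1)
  by (fastforce simp: ringing_edges_def)

lemma interchange_permutes: "interchange_perm V t c permutes V"
  unfolding interchange_perm_eq_swaps by (intro swaps_permutes ringing_edges_subset)

text \<open>These properties hold almost surely.\<close>

definition regular_clocks :: "'v set \<Rightarrow> real \<Rightarrow> ('v set \<times> nat \<Rightarrow> real) \<Rightarrow> bool" where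
  "regular_clocks V t c \<longleftrightarrow> (\<forall>e\<in>edges V. \<forall>k. 0 \<le> c (e, k)) \<and> finite (ring_times V t c) \<and>
    (\<forall>e\<in>edges V. \<forall>e'\<in>edges V. \<forall>k k'. ring_time c e k = ring_time c e' k' \<longrightarrow> e = e')"

lemma ringing_edge_eq:
  assumes "regular_clocks V t c" "e \<in> edges V"
  shows "ringing_edge V c (ring_time c e k) = e"
  unfolding ringing_edge_def using assms unfolding regular_clocks_def by (intro some_equality) blast+

lemma ring_time_ge:
  assumes "regular_clocks V t c" "e \<in> edges V" "j \<le> k"
  shows "c (e, j) \<le> ring_time c e k"
  unfolding ring_time_def using assms
  by (intro member_le_sum[where f = "\<lambda>j. c (e, j)"]) (auto simp: regular_clocks_def)

text \<open>Waiting times are nonnegative, so an edge whose first ring comes after \<open>t\<close>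
  does not ring up to \<open>t\<close>; the absence of ties makes \<open>ringing_edge\<close> return
  the edge that really rings.\<close>

lemma untouched_fixed:
  assumes "regular_clocks V t c" "\<And>e. e \<in> edges V \<Longrightarrow> x \<in> e \<Longrightarrow> t < c (e, 0)"
  shows "interchange_perm V t c x = x"
  unfolding interchange_perm_eq_swaps
proof (rule swaps_fixed)
  fix e assume "e \<in> set (ringing_edges V t c)"
  then obtain s where s: "s \<in> ring_times V t c" "e = ringing_edge V c s"
    using set_sorted_list_subset[of "ring_times V t c"] by (auto simp: ringing_edges_def)
  then obtain e' k where e': "e' \<in> edges V" "s = ring_time c e' k" "s \<le> t"
    by (auto simp: ring_times_def)
  have "e' = e" using ringing_edge_eq[OF assms(1) e'(1)] s e' by simp
  thus "x \<notin> e"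
    using ring_time_ge[OF assms(1) e'(1), of 0 k] assms(2)[of e] e' by fastforce
qed

text \<open>The second condition bounds the second waiting time, not the second ring time. This is
  stronger than having a single ring up to \<open>t\<close>, but it makes the event a product over
  independent coordinates.\<close>

definition isolated_ring :: "'v set \<Rightarrow> real \<Rightarrow> 'v \<Rightarrow> 'v \<Rightarrow> ('v set \<times> nat \<Rightarrow> real) \<Rightarrow> bool" where
  "isolated_ring V t x y c \<longleftrightarrow> c ({x, y}, 0) \<le> t \<and> t < c ({x, y}, 1) \<and>
     (\<forall>e\<in>edges V. e \<noteq> {x, y} \<longrightarrow> e \<inter> {x, y} \<noteq> {} \<longrightarrow> t < c (e, 0))"

lemma isolated_ring_swap:
  assumes c: "regular_clocks V t c" and xy: "x \<in> V" "y \<in> V" "x \<noteq> y" and i: "isolated_ring V t x y c"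
  shows "interchange_perm V t c y = x"
proof -
  let ?e = "{x, y}" and ?s = "c ({x, y}, 0)"
  have e: "?e \<in> edges V" using xy by (rule doubleton_in_edges)
  have s: "ring_time c ?e 0 = ?s" by (simp add: ring_time_def)
  have "?s \<in> ring_times V t c"
    unfolding ring_times_def
    by (rule CollectI, rule exI[of _ ?e], rule exI[of _ 0]) (use e s i in \<open>simp add: isolated_ring_def\<close>)
  hence s_mem: "?s \<in> set (sorted_list_of_set (ring_times V t c))"
    using c by (simp add: regular_clocks_def)
  \<comment> \<open>All other transpositions avoid \<open>x\<close> and \<open>y\<close>, so the
    list splits into a part fixing \<open>y\<close>, the swap, and a part fixing
    \<open>x\<close>.\<close>
  obtain as bs where l: "sorted_list_of_set (ring_times V t c) = as @ ?s # bs"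
    using split_list[OF s_mem] by blast
  have d: "?s \<notin> set as" "?s \<notin> set bs"
    using distinct_sorted_list_of_set[of "ring_times V t c"] unfolding l by auto
  have sub: "set as \<union> set bs \<subseteq> ring_times V t c"
    using set_sorted_list_subset[of "ring_times V t c"] unfolding l by auto
  have disj: "ringing_edge V c u \<inter> ?e = {}" if u: "u \<in> set as \<union> set bs" for u
  proof -
    obtain e' k where e': "e' \<in> edges V" "u = ring_time c e' k" "u \<le> t"
      using sub u by (auto simp: ring_times_def)
    have re: "ringing_edge V c u = e'" using ringing_edge_eq[OF c e'(1)] e'(2) by simp
    have "e' \<noteq> ?e"
    proof
      assume e'e: "e' = ?e"
      \<comment> \<open>A later ring of the same edge would come no earlier than its second waiting
        time, which exceeds \<open>t\<close>.\<close>
      have "k = 0"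
      proof (rule ccontr)
        assume "k \<noteq> 0"
        hence "c (?e, 1) \<le> u" using ring_time_ge[OF c e, of 1 k] e' e'e by simp
        thus False using i e' by (simp add: isolated_ring_def)
      qed
      hence "u = ?s" using s e'(2) e'e by simp
      thus False using d u by auto
    qed
    moreover have "c (e', 0) \<le> t" using ring_time_ge[OF c e'(1), of 0 k] e' by simp
    ultimately show ?thesis using i e'(1) unfolding re isolated_ring_def by force
  qed
  have "swaps (map (ringing_edge V c) as) y = y"
    using disj by (intro swaps_fixed) auto
  moreover have "swaps (map (ringing_edge V c) bs) x = x"
    using disj by (intro swaps_fixed) auto
  moreover have "ringing_edge V c ?s = ?e"
    using ringing_edge_eq[OF c e, of 0] s by simp
  ultimately show ?thesis
    using xy(3) unfolding interchange_perm_eq_swaps ringing_edges_def l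
    by (simp add: swaps_append swaps_Cons edge_swap_doubleton)
qed

text \<open>An isolated ring between \<open>x\<close> in \<open>S\<close> and \<open>y\<close>
  outside makes the permutation send \<open>y\<close> to \<open>x\<close>, so \<open>x\<close> is
  not in the image of \<open>S\<close>. The same relation recovers \<open>y\<close> from
  \<open>x\<close>, so the first projection is injective on such pairs.\<close>

lemma displaced_lower:
  assumes c: "regular_clocks V t c" and S: "finite V" "S \<subseteq> V"
  shows "card {z \<in> S \<times> (V - S). isolated_ring V t (fst z) (snd z) c} \<le>
    card (S - interchange_perm V t c ` S)"
proof (rule card_inj_on_le[where f = fst])
  let ?\<pi> = "interchange_perm V t c"
  have \<pi>: "?\<pi> y = x" if "x \<in> S" "y \<in> V - S" "isolated_ring V t x y c" for x y
    using that S by (intro isolated_ring_swap c) auto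
  have inj: "inj ?\<pi>" using interchange_permutes permutes_inj by metis
  show "fst ` {z \<in> S \<times> (V - S). isolated_ring V t (fst z) (snd z) c} \<subseteq> S - ?\<pi> ` S"
  proof
    fix x assume "x \<in> fst ` {z \<in> S \<times> (V - S). isolated_ring V t (fst z) (snd z) c}"
    then obtain y where y: "x \<in> S" "y \<in> V - S" "isolated_ring V t x y c" by auto
    have "x \<notin> ?\<pi> ` S"
    proof
      assume "x \<in> ?\<pi> ` S"
      then obtain u where "u \<in> S" "?\<pi> u = ?\<pi> y" using \<pi>[OF y] by auto
      thus False using inj y(2) by (auto dest: injD)
    qed
    thus "x \<in> S - ?\<pi> ` S" using y by simp
  qed
  show "inj_on fst {z \<in> S \<times> (V - S). isolated_ring V t (fst z) (snd z) c}"
  proof (rule inj_onI)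
    fix z z'
    assume z: "z \<in> {z \<in> S \<times> (V - S). isolated_ring V t (fst z) (snd z) c}"
      "z' \<in> {z \<in> S \<times> (V - S). isolated_ring V t (fst z) (snd z) c}" "fst z = fst z'"
    have "?\<pi> (snd z) = fst z" "?\<pi> (snd z') = fst z'"
      using z(1,2) by (auto intro!: \<pi>)
    hence "?\<pi> (snd z) = ?\<pi> (snd z')" using z(3) by simp
    hence "snd z = snd z'" by (rule injD[OF inj])
    thus "z = z'" using z(3) by (simp add: prod_eq_iff)
  qed
  show "finite (S - ?\<pi> ` S)" using finite_subset[OF S(2,1)] by simp
qed

text \<open>A point none of whose edges rings is fixed, so it cannot lie in \<open>S\<close> and be
  missing from the image of \<open>S\<close>.\<close>

lemma displaced_upper:
  assumes c: "regular_clocks V t c" and S: "finite V" "S \<subseteq> V"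
  shows "card (S - interchange_perm V t c ` S) + card {x \<in> V. \<forall>e\<in>edges V. x \<in> e \<longrightarrow> t < c (e, 0)} \<le> card V"
proof -
  let ?U = "{x \<in> V. \<forall>e\<in>edges V. x \<in> e \<longrightarrow> t < c (e, 0)}" and ?\<pi> = "interchange_perm V t c"
  have "x \<in> ?\<pi> ` S" if "x \<in> S" "x \<in> ?U" for x
  proof -
    have "x = ?\<pi> x" using that by (intro untouched_fixed[symmetric] c) auto
    thus ?thesis using that(1) by (rule image_eqI)
  qed
  hence "(S - ?\<pi> ` S) \<inter> ?U = {}" by blast
  hence "card (S - ?\<pi> ` S) + card ?U = card ((S - ?\<pi> ` S) \<union> ?U)"
    using S finite_subset[OF S(2,1)] by (intro card_Un_disjoint[symmetric]) simp_all
  also have "\<dots> \<le> card V"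
    using S by (intro card_mono) auto
  finally show ?thesis .
qed

text \<open>The clock of an edge is replaced by that of its image under \<tau>; the restriction
  keeps the result in the product space.\<close>

definition relabel :: "'v set \<Rightarrow> ('v \<Rightarrow> 'v) \<Rightarrow> ('v set \<times> nat \<Rightarrow> real) \<Rightarrow> 'v set \<times> nat \<Rightarrow> real" where
  "relabel V \<tau> c = (\<lambda>z\<in>edges V \<times> UNIV. c (\<tau> ` fst z, snd z))"

lemma edges_image: "\<tau> permutes V \<Longrightarrow> e \<in> edges V \<Longrightarrow> \<tau> ` e \<in> edges V"
  by (auto simp: edges_def card_image permutes_inj_on permutes_in_image subset_iff)

lemma edges_image_surj:
  assumes "\<tau> permutes V" "e \<in> edges V"
  obtains e' where "e' \<in> edges V" "e = \<tau> ` e'"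
proof
  show "inv \<tau> ` e \<in> edges V" using edges_image[OF permutes_inv[OF assms(1)] assms(2)] .
  show "e = \<tau> ` inv \<tau> ` e" using permutes_inverses(1)[OF assms(1)] by (simp add: image_comp)
qed

lemma ring_time_relabel: "e \<in> edges V \<Longrightarrow> ring_time (relabel V \<tau> c) e k = ring_time c (\<tau> ` e) k"
  by (simp add: ring_time_def relabel_def)

lemma ring_times_relabel:
  assumes "\<tau> permutes V"
  shows "ring_times V t (relabel V \<tau> c) = ring_times V t c"
proof (intro equalityI subsetI)
  fix s assume "s \<in> ring_times V t (relabel V \<tau> c)"
  then obtain e k where "e \<in> edges V" "s = ring_time c (\<tau> ` e) k" "s \<le> t"
    by (auto simp: ring_times_def ring_time_relabel)
  thus "s \<in> ring_times V t c"
    using edges_image[OF assms, of e] unfolding ring_times_def by blast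
next
  fix s assume "s \<in> ring_times V t c"
  then obtain e k where e: "e \<in> edges V" "s = ring_time c e k" "s \<le> t" by (auto simp: ring_times_def)
  obtain e' where e': "e' \<in> edges V" "e = \<tau> ` e'" using edges_image_surj[OF assms e(1)] .
  hence "s = ring_time (relabel V \<tau> c) e' k" using e by (simp add: ring_time_relabel)
  thus "s \<in> ring_times V t (relabel V \<tau> c)"
    using e' e(3) unfolding ring_times_def by blast
qed

text \<open>The ring times are the same for both families of clocks, and each ringing edge of
  \<open>c\<close> is the image under \<tau> of the one for the relabelled clocks. The absence of
  ties makes the choices in \<open>ringing_edge\<close> agree with this.\<close>

lemma interchange_perm_relabel:
  assumes c: "regular_clocks V t c" and \<tau>: "\<tau> permutes V"
  shows "interchange_perm V t c = \<tau> \<circ> interchange_perm V t (relabel V \<tau> c) \<circ> inv \<tau>"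
proof -
  let ?c = "relabel V \<tau> c"
  have *: "ringing_edge V c s = \<tau> ` ringing_edge V ?c s" if s: "s \<in> ring_times V t c" for s
  proof -
    have s': "s \<in> ring_times V t ?c" using s ring_times_relabel[OF \<tau>] by metis
    obtain k where k: "ring_time ?c (ringing_edge V ?c s) k = s"
      using ringing_edge_props(2)[OF s'] by auto
    have e: "ringing_edge V ?c s \<in> edges V" using ringing_edge_props(1)[OF s'] .
    have "ring_time c (\<tau> ` ringing_edge V ?c s) k = s"
      using k ring_time_relabel[OF e] by metis
    thus ?thesis
      using ringing_edge_eq[OF c edges_image[OF \<tau> e], of k] by simp
  qed
  have "ringing_edges V t c = map ((`) \<tau>) (ringing_edges V t ?c)"
    unfolding ringing_edges_def ring_times_relabel[OF \<tau>]
    using * set_sorted_list_subset[of "ring_times V t c"] by auto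
  thus ?thesis
    unfolding interchange_perm_eq_swaps
    using swaps_image[OF ringing_edges_subset permutes_bij[OF \<tau>]] by metis
qed

section \<open>Measurability of the interchange permutation\<close>

text \<open>The permutation computed from finitely many rings, with the ring times an arbitrary
  function \<open>r\<close> on \<open>D\<close>. It reads \<open>r\<close> only through comparisons,
  which gives measurability; \<open>interchange_perm\<close> is recovered as \<open>D\<close>
  grows.\<close>

definition partial_perm :: "('v set \<times> nat) set \<Rightarrow> real \<Rightarrow> ('v set \<times> nat \<Rightarrow> real) \<Rightarrow> 'v \<Rightarrow> 'v" where
  "partial_perm D t r = swaps (map (\<lambda>s. SOME e. \<exists>k. (e, k) \<in> D \<and> r (e, k) = s)
     (sorted_list_of_set (r ` {z \<in> D. r z \<le> t})))"

lemma sorted_list_of_set_image_strict_mono: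
  fixes \<phi> :: "'a :: linorder \<Rightarrow> 'b :: linorder"
  assumes "finite A" "\<And>x y. x \<in> A \<Longrightarrow> y \<in> A \<Longrightarrow> x < y \<Longrightarrow> \<phi> x < \<phi> y"
  shows "sorted_list_of_set (\<phi> ` A) = map \<phi> (sorted_list_of_set A)"
proof (rule strict_sorted_equal)
  show "sorted_wrt (<) (map \<phi> (sorted_list_of_set A))"
    using assms by (intro sorted_wrt_map_mono[of "(<)"]) auto
  show "set (sorted_list_of_set (\<phi> ` A)) = set (map \<phi> (sorted_list_of_set A))"
    using assms(1) by simp
qed simp

text \<open>Hence the permutation is a function of finitely many measurable comparisons.\<close>

lemma partial_perm_cong_order:
  assumes D: "finite D"
    and ord: "\<And>z z'. z \<in> D \<Longrightarrow> z' \<in> D \<Longrightarrow> r z \<le> r z' \<longleftrightarrow> r' z \<le> r' z'"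
    and t: "\<And>z. z \<in> D \<Longrightarrow> r z \<le> t \<longleftrightarrow> r' z \<le> t"
  shows "partial_perm D t r = partial_perm D t r'"
proof -
  let ?D = "{z \<in> D. r z \<le> t}"
  have D': "{z \<in> D. r' z \<le> t} = ?D" using t by auto
  \<comment> \<open>Carries the value of a ring time under \<open>r\<close> to its value under
    \<open>r'\<close>; equal order patterns make it well defined and strictly increasing on the
    values that occur.\<close>
  define \<phi> where "\<phi> s = r' (SOME z. z \<in> ?D \<and> r z = s)" for s
  have eq: "r z = r z' \<longleftrightarrow> r' z = r' z'" if "z \<in> D" "z' \<in> D" for z z'
    using ord[OF that] ord[OF that(2,1)] by (metis order_antisym order_refl)
  have \<phi>: "\<phi> (r z) = r' z" if "z \<in> ?D" for z
  proof -
    have "\<exists>z'. z' \<in> ?D \<and> r z' = r z" using that by blast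
    from someI_ex[OF this] show ?thesis
      using that unfolding \<phi>_def by (subst eq[symmetric]) auto
  qed
  have im: "r' ` ?D = \<phi> ` r ` ?D"
    using \<phi> by (simp add: image_comp)
  have "sorted_list_of_set (r' ` ?D) = map \<phi> (sorted_list_of_set (r ` ?D))"
    unfolding im
  proof (rule sorted_list_of_set_image_strict_mono)
    fix x y assume "x \<in> r ` ?D" "y \<in> r ` ?D" "x < y"
    then obtain z z' where z: "z \<in> ?D" "z' \<in> ?D" "x = r z" "y = r z'" "r z < r z'" by blast
    hence "r' z < r' z'" using ord[of z' z] by (simp add: not_le[symmetric])
    thus "\<phi> x < \<phi> y" using z \<phi> by simp
  qed (use D in auto)
  moreover have "(SOME e. \<exists>k. (e, k) \<in> D \<and> r' (e, k) = \<phi> s) = (SOME e. \<exists>k. (e, k) \<in> D \<and> r (e, k) = s)"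
    if s: "s \<in> set (sorted_list_of_set (r ` ?D))" for s
  proof -
    obtain z where z: "z \<in> ?D" "s = r z"
      using s set_sorted_list_subset[of "r ` ?D"] by blast
    have "(e, k) \<in> D \<and> r' (e, k) = \<phi> s \<longleftrightarrow> (e, k) \<in> D \<and> r (e, k) = s" for e k
      using z eq[of "(e, k)" z] by (auto simp: \<phi>[OF z(1)])
    thus ?thesis by simp
  qed
  ultimately show ?thesis
    unfolding partial_perm_def D' by (simp cong: map_cong)
qed

text \<open>Only finitely many order patterns are possible and, by
  \<open>partial_perm_cong_order\<close>, each determines the permutation; the event is the union of
  the pattern events in \<open>P\<close>.\<close>

lemma measurable_partial_perm:
  assumes D: "finite D" and r [measurable]: "\<And>z. z \<in> D \<Longrightarrow> r z \<in> borel_measurable M"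
  shows "{c \<in> space M. partial_perm D t (\<lambda>z. r z c) = \<sigma>} \<in> sets M"
proof -
  define pat where "pat c = ({zz \<in> D \<times> D. r (fst zz) c \<le> r (snd zz) c}, {z \<in> D. r z c \<le> t})" for c
  define P where "P = {p \<in> Pow (D \<times> D) \<times> Pow D. \<exists>c\<in>space M. pat c = p \<and> partial_perm D t (\<lambda>z. r z c) = \<sigma>}"
  have cong: "partial_perm D t (\<lambda>z. r z c) = partial_perm D t (\<lambda>z. r z c')" if "pat c = pat c'" for c c'
  proof (rule partial_perm_cong_order[OF D])
    fix z z' assume "z \<in> D" "z' \<in> D"
    moreover have "(z, z') \<in> fst (pat c) \<longleftrightarrow> (z, z') \<in> fst (pat c')" using that by simp
    ultimately show "r z c \<le> r z' c \<longleftrightarrow> r z c' \<le> r z' c'" by (simp add: pat_def)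
  next
    fix z assume "z \<in> D"
    moreover have "z \<in> snd (pat c) \<longleftrightarrow> z \<in> snd (pat c')" using that by simp
    ultimately show "r z c \<le> t \<longleftrightarrow> r z c' \<le> t" by (simp add: pat_def)
  qed
  have "{c \<in> space M. partial_perm D t (\<lambda>z. r z c) = \<sigma>} = (\<Union>p\<in>P. {c \<in> space M. pat c = p})"
  proof (intro equalityI subsetI)
    fix c assume "c \<in> {c \<in> space M. partial_perm D t (\<lambda>z. r z c) = \<sigma>}"
    moreover have "pat c \<in> Pow (D \<times> D) \<times> Pow D" by (auto simp: pat_def)
    ultimately show "c \<in> (\<Union>p\<in>P. {c \<in> space M. pat c = p})"
      unfolding P_def by blast
  next
    fix c assume "c \<in> (\<Union>p\<in>P. {c \<in> space M. pat c = p})"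
    then obtain p where p: "p \<in> P" "c \<in> space M" "pat c = p" by blast
    then obtain c' where "pat c' = pat c" "partial_perm D t (\<lambda>z. r z c') = \<sigma>"
      unfolding P_def by auto
    thus "c \<in> {c \<in> space M. partial_perm D t (\<lambda>z. r z c) = \<sigma>}"
      using cong[of c' c] p(2) by simp
  qed
  moreover have "{c \<in> space M. pat c = p} \<in> sets M" if "p \<in> Pow (D \<times> D) \<times> Pow D" for p
  proof -
    have "{c \<in> space M. pat c = p} =
        {c \<in> space M. (\<forall>zz\<in>D \<times> D. (r (fst zz) c \<le> r (snd zz) c) = (zz \<in> fst p)) \<and>
           (\<forall>z\<in>D. (r z c \<le> t) = (z \<in> snd p))}"
      using that by (cases p) (auto simp: pat_def)
    also have "\<dots> \<in> sets M"
    proof (intro sets.sets_Collect_conj sets.sets_Collect_finite_All)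
      fix zz assume "zz \<in> D \<times> D"
      hence [measurable]: "r (fst zz) \<in> borel_measurable M" "r (snd zz) \<in> borel_measurable M"
        by (auto intro: r)
      show "{c \<in> space M. (r (fst zz) c \<le> r (snd zz) c) = (zz \<in> fst p)} \<in> sets M"
        by measurable
    next
      fix z assume "z \<in> D"
      hence [measurable]: "r z \<in> borel_measurable M" by (rule r)
      show "{c \<in> space M. (r z c \<le> t) = (z \<in> snd p)} \<in> sets M"
        by measurable
    qed (use D in auto)
    finally show ?thesis .
  qed
  moreover have "finite P"
    unfolding P_def using D by (intro finite_subset[OF Collect_restrict]) simp
  moreover have "P \<subseteq> Pow (D \<times> D) \<times> Pow D"
    unfolding P_def by (rule Collect_restrict)
  ultimately show ?thesis by (simp only: sets.finite_UN subsetD)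
qed

text \<open>For each of the finitely many ring times and each edge, \<open>\<kappa>\<close> is the
  first index attaining that time, if there is one, and \<open>K0\<close> bounds them all. Every
  edge is covered, not just one per time, so that the choice of the ringing edge sees the same
  candidates in both permutations.\<close>

lemma interchange_perm_eventually_partial:
  assumes V: "finite V" and fin: "finite (ring_times V t c)"
  shows "\<exists>K0. \<forall>K\<ge>K0. partial_perm (edges V \<times> {..K}) t (\<lambda>z. ring_time c (fst z) (snd z)) = interchange_perm V t c"
proof -
  let ?A = "ring_times V t c"
  define \<kappa> where "\<kappa> s e = (LEAST k. ring_time c e k = s)" for s e
  define K0 where "K0 = Max (insert 0 ((\<lambda>z. \<kappa> (fst z) (snd z)) ` (?A \<times> edges V)))"
  have K0: "\<kappa> s e \<le> K0" if "s \<in> ?A" "e \<in> edges V" for s e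
  proof -
    have "\<kappa> s e \<in> (\<lambda>z. \<kappa> (fst z) (snd z)) ` (?A \<times> edges V)"
      by (rule image_eqI[of _ _ "(s, e)"]) (use that in auto)
    thus ?thesis unfolding K0_def using fin finite_edges[OF V] by (intro Max_ge) auto
  qed
  have "partial_perm (edges V \<times> {..K}) t (\<lambda>z. ring_time c (fst z) (snd z)) = interchange_perm V t c"
    if K: "K \<ge> K0" for K
  proof -
    let ?D = "edges V \<times> {..K}"
    have ex: "\<exists>k\<le>K. ring_time c e k = s" if "s \<in> ?A" "e \<in> edges V" "ring_time c e k = s" for s e k
    proof (intro exI[of _ "\<kappa> s e"] conjI)
      show "\<kappa> s e \<le> K" using K0[OF that(1,2)] K by linarith
      show "ring_time c e (\<kappa> s e) = s" unfolding \<kappa>_def using that(3) by (rule LeastI)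
    qed
    have A: "(\<lambda>z. ring_time c (fst z) (snd z)) ` {z \<in> ?D. ring_time c (fst z) (snd z) \<le> t} = ?A"
    proof (intro equalityI subsetI)
      fix s assume s: "s \<in> ?A"
      then obtain e k where e: "e \<in> edges V" "ring_time c e k = s" "s \<le> t"
        by (auto simp: ring_times_def)
      obtain k' where "k' \<le> K" "ring_time c e k' = s" using ex[OF s e(1,2)] by blast
      thus "s \<in> (\<lambda>z. ring_time c (fst z) (snd z)) ` {z \<in> ?D. ring_time c (fst z) (snd z) \<le> t}"
        using e by (intro image_eqI[of _ _ "(e, k')"]) auto
    next
      fix s assume "s \<in> (\<lambda>z. ring_time c (fst z) (snd z)) ` {z \<in> ?D. ring_time c (fst z) (snd z) \<le> t}"
      then obtain e k where "e \<in> edges V" "s = ring_time c e k" "ring_time c e k \<le> t" by auto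
      thus "s \<in> ?A" unfolding ring_times_def by blast
    qed
    have edge: "(SOME e. \<exists>k. (e, k) \<in> ?D \<and> ring_time c (fst (e, k)) (snd (e, k)) = s) = ringing_edge V c s"
      if "s \<in> ?A" for s
    proof -
      have "(\<exists>k. (e, k) \<in> ?D \<and> ring_time c e k = s) \<longleftrightarrow> e \<in> edges V \<and> (\<exists>k. ring_time c e k = s)" for e
        using ex[OF that, of e] by auto
      thus ?thesis unfolding ringing_edge_def by simp
    qed
    show ?thesis
      unfolding partial_perm_def A interchange_perm_eq_swaps ringing_edges_def
      using set_sorted_list_subset[of ?A]
      by (intro arg_cong[of _ _ swaps] map_cong refl edge) blast
  qed
  thus ?thesis by blast
qed

text \<open>Turns finiteness into countable quantifiers over comparisons of ring times, as
  measurability requires. A value may recur at infinitely many indices, so \<open>K\<close> only has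
  to ensure that each value is attained early.\<close>

lemma ring_times_finite_iff:
  assumes V: "finite V"
  shows "finite (ring_times V t c) \<longleftrightarrow>
    (\<exists>K. \<forall>e\<in>edges V. \<forall>k. ring_time c e k \<le> t \<longrightarrow>
      (\<exists>e'\<in>edges V. \<exists>k'\<in>{..K}. ring_time c e' k' = ring_time c e k))"
    (is "_ \<longleftrightarrow> (\<exists>K. ?P K)")
proof
  assume fin: "finite (ring_times V t c)"
  define \<kappa> where "\<kappa> s = (SOME k. \<exists>e\<in>edges V. ring_time c e k = s)" for s
  have \<kappa>: "\<exists>e\<in>edges V. ring_time c e (\<kappa> s) = s" if "s \<in> ring_times V t c" for s
  proof -
    have "\<exists>k. \<exists>e\<in>edges V. ring_time c e k = s" using that by (auto simp: ring_times_def)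
    from someI_ex[OF this] show ?thesis unfolding \<kappa>_def .
  qed
  have "?P (Max (insert 0 (\<kappa> ` ring_times V t c)))"
  proof (intro ballI allI impI)
    fix e k assume "e \<in> edges V" "ring_time c e k \<le> t"
    hence s: "ring_time c e k \<in> ring_times V t c" by (auto simp: ring_times_def)
    have "\<kappa> (ring_time c e k) \<le> Max (insert 0 (\<kappa> ` ring_times V t c))"
      using fin s by (intro Max_ge) auto
    thus "\<exists>e'\<in>edges V. \<exists>k'\<in>{..Max (insert 0 (\<kappa> ` ring_times V t c))}. ring_time c e' k' = ring_time c e k"
      using \<kappa>[OF s] by blast
  qed
  thus "\<exists>K. ?P K" by blast
next
  assume "\<exists>K. ?P K"
  then obtain K where K: "?P K" by blast
  have "ring_times V t c \<subseteq> (\<lambda>z. ring_time c (fst z) (snd z)) ` (edges V \<times> {..K})"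
  proof
    fix s assume "s \<in> ring_times V t c"
    then obtain e k where "e \<in> edges V" "ring_time c e k = s" "s \<le> t" by (auto simp: ring_times_def)
    then obtain e' k' where "e' \<in> edges V" "k' \<in> {..K}" "ring_time c e' k' = s" using K by blast
    thus "s \<in> (\<lambda>z. ring_time c (fst z) (snd z)) ` (edges V \<times> {..K})"
      by (intro image_eqI[of _ _ "(e', k')"]) auto
  qed
  thus "finite (ring_times V t c)"
    by (rule finite_subset) (simp add: finite_edges[OF V])
qed

lemma measurable_interchange_perm:
  assumes V: "finite V"
    and M: "\<And>z. z \<in> edges V \<times> UNIV \<Longrightarrow> (\<lambda>c. c z) \<in> borel_measurable M"
  shows "{c \<in> space M. finite (ring_times V t c)} \<in> sets M"
    and "{c \<in> space M. interchange_perm V t c = \<sigma>} \<in> sets M"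
proof -
  have r: "(\<lambda>c. ring_time c e k) \<in> borel_measurable M" if "e \<in> edges V" for e k
    unfolding ring_time_def using that by (intro borel_measurable_sum M) auto
  have [simp]: "finite (edges V)" using finite_edges[OF V] .
  have fin: "{c \<in> space M. finite (ring_times V t c)} \<in> sets M"
    unfolding ring_times_finite_iff[OF V]
  proof (intro sets.sets_Collect_countable_Ex sets.sets_Collect_finite_All sets.sets_Collect_countable_All
      sets.sets_Collect_imp sets.sets_Collect_finite_Ex)
    fix K e k e' k' assume e: "e \<in> edges V" "e' \<in> edges V"
    note [measurable] = r[OF e(1)] r[OF e(2)]
    show "{c \<in> space M. ring_time c e k \<le> t} \<in> sets M"
      by measurable
    show "{c \<in> space M. ring_time c e' k' = ring_time c e k} \<in> sets M"
      by measurable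
  qed auto
  have part: "{c \<in> space M. partial_perm (edges V \<times> {..K}) t (\<lambda>z. ring_time c (fst z) (snd z)) = \<sigma>} \<in> sets M"
    for K
    by (rule measurable_partial_perm) (auto intro: r)
  \<comment> \<open>If the ring times are finite in number, the truncated permutations stabilize,
    and equality for all large \<open>K\<close> is a countable condition; otherwise
    \<open>sorted_list_of_set\<close> is empty and the permutation is \<open>id\<close>.\<close>
  have "interchange_perm V t c = \<sigma> \<longleftrightarrow>
      finite (ring_times V t c) \<and> (\<exists>K0. \<forall>K\<in>{K0..}. partial_perm (edges V \<times> {..K}) t (\<lambda>z. ring_time c (fst z) (snd z)) = \<sigma>)
      \<or> \<not> finite (ring_times V t c) \<and> \<sigma> = id" for c
  proof (cases "finite (ring_times V t c)")
    case True
    obtain K1 where K1: "\<forall>K\<ge>K1. partial_perm (edges V \<times> {..K}) t (\<lambda>z. ring_time c (fst z) (snd z)) = interchange_perm V t c"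
      using interchange_perm_eventually_partial[OF V True] by blast
    have "interchange_perm V t c = \<sigma>"
      if "\<forall>K\<in>{K0..}. partial_perm (edges V \<times> {..K}) t (\<lambda>z. ring_time c (fst z) (snd z)) = \<sigma>" for K0
      using that K1 by (metis atLeast_iff max.cobounded1 max.cobounded2)
    thus ?thesis using True K1 by auto
  next
    case False
    thus ?thesis by (auto simp: interchange_perm_def)
  qed
  moreover have "{c \<in> space M. finite (ring_times V t c) \<and> (\<exists>K0. \<forall>K\<in>{K0..}. partial_perm (edges V \<times> {..K}) t (\<lambda>z. ring_time c (fst z) (snd z)) = \<sigma>)
      \<or> \<not> finite (ring_times V t c) \<and> \<sigma> = id} \<in> sets M"
    by (intro sets.sets_Collect_disj sets.sets_Collect_conj sets.sets_Collect_neg fin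
        sets.sets_Collect_countable_Ex sets.sets_Collect_countable_All' part sets.sets_Collect_const) auto
  ultimately show "{c \<in> space M. interchange_perm V t c = \<sigma>} \<in> sets M" by simp
  show "{c \<in> space M. finite (ring_times V t c)} \<in> sets M" by (rule fin)
qed

section \<open>The clocks\<close>

text \<open>Chebyshev for a count of almost pairwise independent events. The diagonal of the second
  moment contributes the mean, and \<open>\<kappa> - 1\<close> measures the excess correlation
  relative to the squared mean.\<close>

lemma (in prob_space) count_deviation:
  fixes p \<kappa> w :: real
  assumes I: "finite I" and G: "\<And>i. i \<in> I \<Longrightarrow> G i \<in> events" "\<And>i. i \<in> I \<Longrightarrow> prob (G i) = p"
    and G2: "\<And>i j. i \<in> I \<Longrightarrow> j \<in> I \<Longrightarrow> i \<noteq> j \<Longrightarrow> prob (G i \<inter> G j) \<le> \<kappa> * p\<^sup>2"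
    and w: "w > 0" and \<kappa>: "\<kappa> \<ge> 0"
  shows "{\<omega> \<in> space M. w \<le> \<bar>real (card {i \<in> I. \<omega> \<in> G i}) - card I * p\<bar>} \<in> events"
    and "prob {\<omega> \<in> space M. w \<le> \<bar>real (card {i \<in> I. \<omega> \<in> G i}) - card I * p\<bar>} \<le>
    (card I * p + (card I * p)\<^sup>2 * (\<kappa> - 1)) / w\<^sup>2"
proof -
  define X where "X \<omega> = (\<Sum>i\<in>I. indicator (G i) \<omega> :: real)" for \<omega>
  have X: "real (card {i \<in> I. \<omega> \<in> G i}) = X \<omega>" for \<omega>
    using I by (simp add: X_def indicator_def sum.If_cases Collect_conj_eq)
  have Xm [measurable]: "random_variable borel X"
    unfolding X_def using G(1) by (intro borel_measurable_sum borel_measurable_indicator) auto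
  show "{\<omega> \<in> space M. w \<le> \<bar>real (card {i \<in> I. \<omega> \<in> G i}) - card I * p\<bar>} \<in> events"
    unfolding X by measurable
  have ind: "integrable M (indicator A :: 'a \<Rightarrow> real)" "expectation (indicator A) = prob A" if "A \<in> events" for A
    using that by (simp_all add: emeasure_eq_measure)
  have EX: "expectation X = card I * p"
    unfolding X_def by (subst Bochner_Integration.integral_sum) (simp_all add: ind G)
  have sq: "(X \<omega>)\<^sup>2 = (\<Sum>i\<in>I. \<Sum>j\<in>I. indicator (G i \<inter> G j) \<omega>)" for \<omega>
    by (simp add: X_def power2_eq_square sum_product indicator_inter_arith)
  have intX: "integrable M X"
    unfolding X_def by (intro Bochner_Integration.integrable_sum ind G(1))
  have int2: "integrable M (\<lambda>\<omega>. (X \<omega>)\<^sup>2)"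
    unfolding sq by (intro Bochner_Integration.integrable_sum ind sets.Int G(1))
  have "expectation (\<lambda>\<omega>. (X \<omega>)\<^sup>2) = (\<Sum>i\<in>I. \<Sum>j\<in>I. prob (G i \<inter> G j))"
    unfolding sq
    by (simp add: Bochner_Integration.integral_sum Bochner_Integration.integrable_sum ind G(1) sets.Int)
  also have "\<dots> \<le> (\<Sum>i\<in>I. \<Sum>j\<in>I. (if i = j then p else 0) + \<kappa> * p\<^sup>2)"
    using G2 G(2) \<kappa> by (intro sum_mono) auto
  also have "\<dots> = card I * p + (card I)\<^sup>2 * (\<kappa> * p\<^sup>2)"
    using I by (simp add: sum.distrib power2_eq_square algebra_simps)
  finally have "variance X \<le> card I * p + (card I * p)\<^sup>2 * (\<kappa> - 1)"
    by (subst variance_eq[OF intX int2]) (simp add: EX power_mult_distrib algebra_simps)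
  moreover have "prob {\<omega> \<in> space M. w \<le> \<bar>X \<omega> - expectation X\<bar>} \<le> variance X / w\<^sup>2"
    using Chebyshev_inequality[OF Xm int2 w] .
  ultimately show "prob {\<omega> \<in> space M. w \<le> \<bar>real (card {i \<in> I. \<omega> \<in> G i}) - card I * p\<bar>} \<le>
    (card I * p + (card I * p)\<^sup>2 * (\<kappa> - 1)) / w\<^sup>2"
    unfolding X EX using w by (meson divide_right_mono order_trans zero_le_power2)
qed

section \<open>The product space of exponential waiting times\<close>

abbreviation waiting_law :: "'v set \<Rightarrow> real measure" where
  "waiting_law V \<equiv> density lborel (exponential_density (1 / real (card V)))"

definition clock_space :: "'v set \<Rightarrow> ('v set \<times> nat \<Rightarrow> real) measure" where
  "clock_space V = (\<Pi>\<^sub>M _\<in>edges V \<times> UNIV. waiting_law V)"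

lemma prob_space_waiting_law:
  assumes "finite V" "V \<noteq> {}"
  shows "prob_space (waiting_law V)"
  using assms by (intro prob_space_exponential_density) (simp add: card_gt_0_iff)

lemma prob_space_clock_space:
  assumes V: "finite V"
  shows "prob_space (clock_space V)"
  unfolding clock_space_def
proof (rule prob_space_PiM)
  fix z assume "z \<in> edges V \<times> (UNIV :: nat set)"
  hence "V \<noteq> {}" by (auto simp: edges_def)
  thus "prob_space (waiting_law V)" by (rule prob_space_waiting_law[OF V])
qed

lemma measurable_clock: "z \<in> edges V \<times> UNIV \<Longrightarrow> (\<lambda>c. c z) \<in> borel_measurable (clock_space V)"
  unfolding clock_space_def by (auto intro!: measurable_component_singleton[THEN measurable_compose])

context
  fixes V :: "'v set" and n :: real
  assumes V: "finite V" "V \<noteq> {}" and n_def: "n = real (card V)"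
begin

lemma real_card_pos: "n > 0"
  using V by (simp add: n_def card_gt_0_iff)

interpretation W: product_prob_space "\<lambda>_. waiting_law V" "edges V \<times> UNIV :: ('v set \<times> nat) set"
  by (intro product_prob_spaceI prob_space_waiting_law V)

lemma waiting_law_le:
  assumes "t \<ge> 0"
  shows "measure (waiting_law V) {..t} = 1 - exp (- t / n)" "measure (waiting_law V) {t<..} = exp (- t / n)"
proof -
  have "emeasure (waiting_law V) {..t} = ennreal (1 - exp (- t / n))"
    using emeasure_erlang_density[of "1 / n" 0 t] real_card_pos assms
    by (simp add: n_def erlang_CDF_def field_simps)
  thus 1: "measure (waiting_law V) {..t} = 1 - exp (- t / n)"
    using assms real_card_pos by (intro measure_eq_emeasure_eq_ennreal) auto
  have "{t<..} = space (waiting_law V) - {..t}" by auto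
  thus "measure (waiting_law V) {t<..} = exp (- t / n)"
    using prob_space.prob_compl[OF prob_space_waiting_law[OF V], of "{..t}"] 1 by simp
qed

lemma clock_event:
  assumes "A \<subseteq> edges V \<times> UNIV" "B \<subseteq> edges V \<times> UNIV" "finite A" "finite B"
  shows "{c \<in> space (clock_space V). (\<forall>z\<in>A. c z \<le> t) \<and> (\<forall>z\<in>B. t < c z)} \<in> sets (clock_space V)"
proof (intro sets.sets_Collect_conj sets.sets_Collect_finite_All)
  fix z
  show "{c \<in> space (clock_space V). c z \<le> t} \<in> sets (clock_space V)" if "z \<in> A"
    using measurable_clock[of z] assms that by (intro borel_measurable_le) auto
  show "{c \<in> space (clock_space V). t < c z} \<in> sets (clock_space V)" if "z \<in> B"
    using measurable_clock[of z] assms that by (intro borel_measurable_less) auto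
qed (use assms in auto)

lemma clock_prob:
  assumes AB: "A \<subseteq> edges V \<times> UNIV" "B \<subseteq> edges V \<times> UNIV" "finite A" "finite B" "A \<inter> B = {}" and t: "t \<ge> 0"
  shows "measure (clock_space V) {c \<in> space (clock_space V). (\<forall>z\<in>A. c z \<le> t) \<and> (\<forall>z\<in>B. t < c z)} =
    (1 - exp (- t / n)) ^ card A * exp (- t / n) ^ card B"
proof -
  let ?X = "\<lambda>z. if z \<in> A then {..t} else {t<..}"
  have "{c \<in> space (clock_space V). (\<forall>z\<in>A. c z \<le> t) \<and> (\<forall>z\<in>B. t < c z)} =
      {c \<in> space (clock_space V). \<forall>z\<in>A \<union> B. c z \<in> ?X z}"
    using AB(5) by auto
  also have "emeasure (clock_space V) \<dots> = (\<Prod>z\<in>A \<union> B. emeasure (waiting_law V) (?X z))"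
    unfolding clock_space_def using AB by (intro W.emeasure_PiM_Collect) auto
  also have "\<dots> = (\<Prod>z\<in>A \<union> B. ennreal (measure (waiting_law V) (?X z)))"
    by (simp add: finite_measure.emeasure_eq_measure[OF prob_space.finite_measure[OF prob_space_waiting_law[OF V]]])
  also have "\<dots> = ennreal (\<Prod>z\<in>A \<union> B. measure (waiting_law V) (?X z))"
    by (intro prod_ennreal) auto
  also have "(\<Prod>z\<in>A \<union> B. measure (waiting_law V) (?X z)) =
      (\<Prod>z\<in>A. measure (waiting_law V) (?X z)) * (\<Prod>z\<in>B. measure (waiting_law V) (?X z))"
    using AB by (intro prod.union_disjoint) auto
  also have "(\<Prod>z\<in>A. measure (waiting_law V) (?X z)) = (\<Prod>z\<in>A. 1 - exp (- t / n))"
    using waiting_law_le[OF t] by (intro prod.cong) auto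
  also have "(\<Prod>z\<in>B. measure (waiting_law V) (?X z)) = (\<Prod>z\<in>B. exp (- t / n))"
    using waiting_law_le[OF t] AB(5) by (intro prod.cong) auto
  finally show ?thesis
    using t real_card_pos by (intro measure_eq_emeasure_eq_ennreal) auto
qed

lemma AE_clock_nonneg: "AE c in clock_space V. \<forall>z\<in>edges V \<times> UNIV. 0 \<le> c z"
proof (rule AE_ball_countable')
  fix z assume "z \<in> edges V \<times> (UNIV :: nat set)"
  moreover have "AE x in waiting_law V. 0 \<le> x"
    by (subst AE_density) (auto simp: exponential_density_def)
  ultimately show "AE c in clock_space V. 0 \<le> c z"
    unfolding clock_space_def by (intro AE_PiM_component prob_space_waiting_law V) auto
qed (use finite_edges[OF V(1)] in \<open>simp add: countable_finite\<close>)

text \<open>The first K waiting times of \<open>e\<close> are all at most \<open>t\<close> with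
  probability \<open>(1 - exp (- t / n)) ^ K\<close>, which tends to 0. Together with nonnegativity,
  one waiting time above \<open>t\<close> leaves only finitely many rings of \<open>e\<close> up to
  \<open>t\<close>.\<close>

lemma AE_clock_large:
  assumes e: "e \<in> edges V" and t: "t \<ge> 0"
  shows "AE c in clock_space V. \<exists>k. t < c (e, k)"
proof -
  interpret C: prob_space "clock_space V" by (rule prob_space_clock_space[OF V(1)])
  let ?q = "1 - exp (- t / n)"
  let ?N = "{c \<in> space (clock_space V). \<forall>k. c (e, k) \<le> t}"
  have N: "?N \<in> sets (clock_space V)"
    using e measurable_clock by (intro sets.sets_Collect_countable_All borel_measurable_le) auto
  have q: "0 \<le> ?q" "?q < 1" using t real_card_pos by auto
  have "C.prob ?N \<le> ?q ^ K" for K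
  proof -
    let ?A = "(\<lambda>k. (e, k)) ` {..<K}"
    have cA: "card ?A = K" by (simp add: card_image inj_on_def)
    have "C.prob ?N \<le> C.prob {c \<in> space (clock_space V). (\<forall>z\<in>?A. c z \<le> t) \<and> (\<forall>z\<in>{}. t < c z)}"
      using e by (intro C.finite_measure_mono clock_event) auto
    also have "\<dots> = ?q ^ K"
      using e t by (subst clock_prob) (auto simp: cA)
    finally show ?thesis .
  qed
  moreover have "(\<lambda>K. ?q ^ K) \<longlonglongrightarrow> 0"
    using q by (intro LIMSEQ_power_zero) auto
  ultimately have "C.prob ?N \<le> 0"
    by (intro LIMSEQ_le_const[of "\<lambda>K. ?q ^ K"]) auto
  hence "C.prob ?N = 0" using measure_nonneg[of "clock_space V" ?N] by linarith
  hence "AE c in clock_space V. \<not> (\<forall>k. c (e, k) \<le> t)"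
    using N by (intro AE_I[of _ _ ?N]) (auto simp: C.emeasure_eq_measure)
  thus ?thesis by eventually_elim (auto simp: not_le)
qed

text \<open>Fix all coordinates except the first waiting time of \<open>e\<close>. A tie prescribes
  the single value \<open>g X\<close> for it, and the exponential law has no atoms; splitting off
  this coordinate and Fubini give the claim.\<close>

lemma AE_no_tie:
  assumes e: "e \<in> edges V" "e' \<in> edges V" "e \<noteq> e'"
  shows "AE c in clock_space V. ring_time c e k \<noteq> ring_time c e' k'"
proof -
  let ?i = "(e, 0 :: nat)" and ?J = "edges V \<times> UNIV - {(e, 0 :: nat)}"
  let ?P = "\<Pi>\<^sub>M _\<in>?J. waiting_law V"
  interpret J: product_prob_space "\<lambda>_. waiting_law V" ?J
    by (intro product_prob_spaceI prob_space_waiting_law V)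
  interpret pair_sigma_finite "waiting_law V" ?P
    by unfold_locales
  have ins: "insert ?i ?J = edges V \<times> UNIV" using e by auto
  have distr: "distr (waiting_law V \<Otimes>\<^sub>M ?P) (clock_space V) (\<lambda>(x, X). X(?i := x)) = clock_space V"
    using distr_pair_PiM_eq_PiM[of ?J "\<lambda>_. waiting_law V" ?i] prob_space_waiting_law[OF V]
    unfolding ins clock_space_def by simp
  define g where "g X = (\<Sum>j\<le>k'. X (e', j)) - (\<Sum>j\<in>{1..k}. X (e, j))" for X :: "'v set \<times> nat \<Rightarrow> real"
  have gm [measurable]: "g \<in> borel_measurable ?P"
    unfolding g_def using e
    by (intro borel_measurable_diff borel_measurable_sum measurable_component_singleton[THEN measurable_compose]) auto
  have upd: "ring_time (X(?i := x)) e k \<noteq> ring_time (X(?i := x)) e' k' \<longleftrightarrow> x \<noteq> g X" for x X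
  proof -
    have "{..k} = insert 0 {1..k}" by auto
    hence "ring_time (X(?i := x)) e k = x + (\<Sum>j\<in>{1..k}. X (e, j))"
      by (simp add: ring_time_def)
    moreover have "ring_time (X(?i := x)) e' k' = (\<Sum>j\<le>k'. X (e', j))"
      using e by (simp add: ring_time_def)
    ultimately show ?thesis by (auto simp: g_def)
  qed
  have m: "{z \<in> space (waiting_law V \<Otimes>\<^sub>M ?P). fst z \<noteq> g (snd z)} \<in> sets (waiting_law V \<Otimes>\<^sub>M ?P)"
    by measurable
  have "AE x in waiting_law V. x \<noteq> a" for a
    using AE_lborel_singleton[of a] by (subst AE_density) auto
  hence "AE X in ?P. AE x in waiting_law V. x \<noteq> g X" by simp
  hence "AE x in waiting_law V. AE X in ?P. x \<noteq> g X"
    using AE_commute[OF m] by simp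
  hence ae: "AE z in waiting_law V \<Otimes>\<^sub>M ?P. fst z \<noteq> g (snd z)"
    by (intro AE_pair_measure m) simp
  have meas: "(\<lambda>(x, X). X(?i := x)) \<in> measurable (waiting_law V \<Otimes>\<^sub>M ?P) (clock_space V)"
    unfolding clock_space_def split_beta
  proof (rule measurable_fun_upd[where J = ?J])
    show "edges V \<times> UNIV = ?J \<union> {?i}" using ins by blast
  qed (rule measurable_snd measurable_fst)+
  have rt: "(\<lambda>c. ring_time c e'' j) \<in> borel_measurable (clock_space V)" if "e'' \<in> edges V" for e'' j
    unfolding ring_time_def using that by (intro borel_measurable_sum measurable_clock) auto
  have sets: "{c \<in> space (clock_space V). ring_time c e k \<noteq> ring_time c e' k'} \<in> sets (clock_space V)"
    by (intro borel_measurable_neq rt e)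
  have "AE z in waiting_law V \<Otimes>\<^sub>M ?P.
      ring_time ((\<lambda>(x, X). X(?i := x)) z) e k \<noteq> ring_time ((\<lambda>(x, X). X(?i := x)) z) e' k'"
    using ae unfolding split_beta upd .
  hence "AE c in distr (waiting_law V \<Otimes>\<^sub>M ?P) (clock_space V) (\<lambda>(x, X). X(?i := x)).
      ring_time c e k \<noteq> ring_time c e' k'"
    unfolding AE_distr_iff[OF meas sets] .
  thus ?thesis unfolding distr .
qed

lemma AE_regular_clocks:
  assumes t: "t \<ge> 0"
  shows "AE c in clock_space V. regular_clocks V t c"
proof -
  have cnt: "countable (edges V)" using finite_edges[OF V(1)] by (rule countable_finite)
  have "AE c in clock_space V. \<forall>e\<in>edges V. \<exists>k. t < c (e, k)"
    using AE_clock_large t cnt by (intro AE_ball_countable') auto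
  moreover have "AE c in clock_space V. \<forall>e\<in>edges V. \<forall>e'\<in>edges V. \<forall>k k'. e \<noteq> e' \<longrightarrow> ring_time c e k \<noteq> ring_time c e' k'"
    using AE_no_tie cnt by (intro AE_ball_countable' AE_all_countable[THEN iffD2] allI) auto
  ultimately show ?thesis
    using AE_clock_nonneg
  proof eventually_elim
    case (elim c)
    have nn: "0 \<le> c (e, k)" if "e \<in> edges V" for e k using elim(3) that by auto
    obtain K where K: "t < c (e, K e)" if "e \<in> edges V" for e using elim(1) by metis
    have "ring_times V t c \<subseteq> (\<lambda>z. ring_time c (fst z) (snd z)) ` (SIGMA e:edges V. {..<K e})"
    proof
      fix s assume "s \<in> ring_times V t c"
      then obtain e k where e: "e \<in> edges V" "s = ring_time c e k" "s \<le> t" by (auto simp: ring_times_def)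
      have "k < K e"
      proof (rule ccontr)
        assume "\<not> k < K e"
        hence "c (e, K e) \<le> ring_time c e k"
          unfolding ring_time_def using nn[OF e(1)]
          by (intro member_le_sum[where f = "\<lambda>j. c (e, j)"]) auto
        thus False using K[OF e(1)] e by linarith
      qed
      thus "s \<in> (\<lambda>z. ring_time c (fst z) (snd z)) ` (SIGMA e:edges V. {..<K e})"
        using e by (intro image_eqI[of _ _ "(e, k)"]) auto
    qed
    hence "finite (ring_times V t c)"
      by (rule finite_subset) (simp add: finite_edges[OF V(1)])
    moreover have "e = e'" if "e \<in> edges V" "e' \<in> edges V" "ring_time c e k = ring_time c e' k'" for e e' k k'
      using elim(2) that by metis
    ultimately show ?case unfolding regular_clocks_def using nn by (intro conjI ballI allI impI)
  qed
qed

end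

section \<open>Displaced points\<close>

lemma card_edges_at:
  assumes "finite V" "x \<in> V"
  shows "card {e \<in> edges V. x \<in> e} = card V - 1"
proof -
  have "{e \<in> edges V. x \<in> e} = (\<lambda>y. {x, y}) ` (V - {x})"
    using assms(2) by (auto elim!: edgesE intro!: doubleton_in_edges)
  moreover have "inj_on (\<lambda>y. {x, y}) (V - {x})"
    by (auto simp: inj_on_def doubleton_eq_iff)
  ultimately show ?thesis
    using assms by (simp add: card_image)
qed

lemma card_edges_common:
  assumes "x \<noteq> y"
  shows "card {e \<in> edges V. x \<in> e \<and> y \<in> e} \<le> 1"
proof -
  have "{e \<in> edges V. x \<in> e \<and> y \<in> e} \<subseteq> {{x, y}}"
    using assms by (auto elim!: edgesE)
  from card_mono[OF _ this] show ?thesis by simp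
qed

definition adjacent_edges :: "'v set \<Rightarrow> 'v \<Rightarrow> 'v \<Rightarrow> 'v set set" where
  "adjacent_edges V x y = {e \<in> edges V. e \<noteq> {x, y} \<and> e \<inter> {x, y} \<noteq> {}}"

lemma card_adjacent_edges:
  assumes V: "finite V" and xy: "x \<in> V" "y \<in> V" "x \<noteq> y"
  shows "card (adjacent_edges V x y) = 2 * (card V - 2)"
proof -
  let ?f = "\<lambda>z. {fst z, snd z}"
  have "adjacent_edges V x y = ?f ` ({x, y} \<times> (V - {x, y}))"
  proof (intro equalityI subsetI)
    fix e assume e: "e \<in> adjacent_edges V x y"
    hence "e \<in> edges V" by (simp add: adjacent_edges_def)
    then obtain a b where ab: "a \<in> V" "b \<in> V" "a \<noteq> b" "e = {a, b}"
      by (rule edgesE)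
    have "e \<noteq> {x, y}" "e \<inter> {x, y} \<noteq> {}" using e by (auto simp: adjacent_edges_def)
    hence "a \<in> {x, y} \<and> b \<notin> {x, y} \<or> b \<in> {x, y} \<and> a \<notin> {x, y}"
      using ab(3,4) by auto
    thus "e \<in> ?f ` ({x, y} \<times> (V - {x, y}))"
    proof
      assume "a \<in> {x, y} \<and> b \<notin> {x, y}"
      thus ?thesis using ab(1,2,4) by (intro image_eqI[of _ _ "(a, b)"]) auto
    next
      assume "b \<in> {x, y} \<and> a \<notin> {x, y}"
      thus ?thesis using ab by (intro image_eqI[of _ _ "(b, a)"]) auto
    qed
  next
    fix e assume "e \<in> ?f ` ({x, y} \<times> (V - {x, y}))"
    then obtain z where z: "z \<in> {x, y} \<times> (V - {x, y})" "e = ?f z" by blast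
    obtain a b where ab: "a \<in> {x, y}" "b \<in> V" "b \<notin> {x, y}" "e = {a, b}"
      by (rule that[of "fst z" "snd z"]) (use z in auto)
    have "e \<in> edges V" unfolding ab(4) using ab xy by (intro doubleton_in_edges) auto
    moreover have "b \<in> e" "a \<in> e" using ab by auto
    ultimately show "e \<in> adjacent_edges V x y"
      unfolding adjacent_edges_def using ab by blast
  qed
  moreover have "inj_on ?f ({x, y} \<times> (V - {x, y}))"
    by (rule inj_onI) (auto simp: doubleton_eq_iff)
  ultimately have "card (adjacent_edges V x y) = card ({x, y} \<times> (V - {x, y}))"
    by (simp only: card_image)
  thus ?thesis using V xy by (simp add: card_cartesian_product)
qed

text \<open>A common edge joins an endpoint of one pair to an endpoint of the other.\<close>

lemma card_adjacent_edges_Int: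
  assumes V: "finite V" and d: "{x, y} \<inter> {x', y'} = {}"
  shows "card (adjacent_edges V x y \<inter> adjacent_edges V x' y') \<le> 4"
proof -
  let ?f = "\<lambda>z. {fst z, snd z}"
  have "adjacent_edges V x y \<inter> adjacent_edges V x' y' \<subseteq> ?f ` ({x, y} \<times> {x', y'})"
  proof
    fix e assume e: "e \<in> adjacent_edges V x y \<inter> adjacent_edges V x' y'"
    hence "e \<in> edges V" by (simp add: adjacent_edges_def)
    then obtain a b where ab: "a \<in> V" "b \<in> V" "a \<noteq> b" "e = {a, b}"
      by (rule edgesE)
    obtain u v where uv: "u \<in> {x, y}" "v \<in> {x', y'}" "u \<in> e" "v \<in> e"
      using e unfolding adjacent_edges_def by blast
    have "u \<noteq> v" using uv d by blast
    hence "e = {u, v}" using uv(3,4) ab(4) by blast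
    thus "e \<in> ?f ` ({x, y} \<times> {x', y'})"
      using uv by (intro image_eqI[of _ _ "(u, v)"]) auto
  qed
  hence "card (adjacent_edges V x y \<inter> adjacent_edges V x' y') \<le> card (?f ` ({x, y} \<times> {x', y'}))"
    by (intro card_mono) auto
  also have "\<dots> \<le> card ({x, y} \<times> {x', y'})"
    by (intro card_image_le) auto
  also have "\<dots> \<le> 2 * 2"
    unfolding card_cartesian_product by (intro mult_le_mono) (auto simp: card_insert_if)
  finally show ?thesis by simp
qed

section \<open>Exponential estimates for short times\<close>

lemma exp_le_double:
  fixes x :: real
  assumes "0 \<le> x" "x \<le> 1"
  shows "exp x - 1 \<le> 2 * x"
proof -
  have "exp x \<le> 1 + x + x\<^sup>2" using assms by (intro exp_bound) auto
  moreover have "x\<^sup>2 \<le> x" using assms by (simp add: power2_eq_square mult_left_le)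
  ultimately show ?thesis by simp
qed

lemma one_minus_exp_ge:
  fixes x :: real
  assumes "0 \<le> x" "x \<le> 1"
  shows "x / 2 \<le> 1 - exp (- x)"
proof -
  have "exp (- x) \<le> 1 / (1 + x)"
    using exp_ge_add_one_self[of x] assms by (simp add: exp_minus field_simps)
  moreover have "x / 2 \<le> 1 - 1 / (1 + x)"
    using assms by (simp add: field_simps mult_left_le)
  ultimately show ?thesis by simp
qed

section \<open>The law of the interchange permutation\<close>

definition perm_law :: "'v set \<Rightarrow> real \<Rightarrow> ('v \<Rightarrow> 'v) \<Rightarrow> real" where
  "perm_law V t \<sigma> = measure (clock_space V) {c \<in> space (clock_space V). interchange_perm V t c = \<sigma>}"

lemma perm_event:
  assumes "finite V"
  shows "{c \<in> space (clock_space V). interchange_perm V t c = \<sigma>} \<in> sets (clock_space V)"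
  by (rule measurable_interchange_perm(2)[OF assms measurable_clock])

lemma perm_law_sum:
  assumes V: "finite V"
  shows "(\<Sum>\<sigma> | \<sigma> permutes V. if Q \<sigma> then perm_law V t \<sigma> else 0) =
    measure (clock_space V) {c \<in> space (clock_space V). Q (interchange_perm V t c)}"
proof -
  interpret C: prob_space "clock_space V" by (rule prob_space_clock_space[OF V])
  let ?P = "{\<sigma>. \<sigma> permutes V \<and> Q \<sigma>}"
    and ?E = "\<lambda>\<sigma>. {c \<in> space (clock_space V). interchange_perm V t c = \<sigma>}"
  have fin: "finite ?P"
    using finite_permutations[OF V] by (rule rev_finite_subset) auto
  have eq: "{c \<in> space (clock_space V). Q (interchange_perm V t c)} = (\<Union>\<sigma>\<in>?P. ?E \<sigma>)"
    using interchange_permutes by blast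
  have "(\<Sum>\<sigma> | \<sigma> permutes V. if Q \<sigma> then perm_law V t \<sigma> else 0) = (\<Sum>\<sigma>\<in>?P. perm_law V t \<sigma>)"
    using finite_permutations[OF V] by (intro sum.mono_neutral_cong_right) auto
  also have "\<dots> = C.prob (\<Union>\<sigma>\<in>?P. ?E \<sigma>)"
    unfolding perm_law_def using fin perm_event[OF V]
    by (intro C.finite_measure_finite_Union[symmetric]) (auto simp: disjoint_family_on_def)
  finally show ?thesis unfolding eq .
qed

lemma perm_law_total:
  assumes "finite V"
  shows "(\<Sum>\<sigma> | \<sigma> permutes V. perm_law V t \<sigma>) = 1"
  using perm_law_sum[OF assms, of "\<lambda>_. True" t] prob_space.prob_space[OF prob_space_clock_space[OF assms]]
  by simp

context
  fixes V :: "'v set" and n t :: real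
  assumes V: "finite V" "V \<noteq> {}" and n_def: "n = real (card V)" and t_def: "t = 1 / 16"
begin

lemma real_card_ge_1: "n \<ge> 1"
  using real_card_pos[OF V n_def] by (simp add: n_def)

lemma time_nonneg: "t \<ge> 0"
  by (simp add: t_def)

interpretation C: prob_space "clock_space V"
  by (rule prob_space_clock_space[OF V(1)])

text \<open>All clocks have the same waiting law and \<tau> acts injectively on the index set, so
  reindexing preserves the product measure.\<close>

lemma distr_relabel:
  assumes \<tau>: "\<tau> permutes V"
  shows "relabel V \<tau> \<in> measurable (clock_space V) (clock_space V)" "distr (clock_space V) (clock_space V) (relabel V \<tau>) = clock_space V"
proof -
  let ?I = "edges V \<times> (UNIV :: nat set)" and ?f = "\<lambda>z. (\<tau> ` fst z, snd z)"
  have f: "?f \<in> ?I \<rightarrow> ?I" using edges_image[OF \<tau>] by auto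
  have "inj_on ?f ?I"
    using permutes_inj[OF \<tau>] by (auto simp: inj_on_def inj_image_eq_iff)
  from distr_PiM_reindex[of ?I "\<lambda>_. waiting_law V", OF prob_space_waiting_law[OF V] this f]
  show "distr (clock_space V) (clock_space V) (relabel V \<tau>) = clock_space V"
    by (simp add: clock_space_def relabel_def[abs_def])
  show "relabel V \<tau> \<in> measurable (clock_space V) (clock_space V)"
    unfolding clock_space_def relabel_def[abs_def]
  proof (rule measurable_restrict)
    fix z :: "'v set \<times> nat" assume "z \<in> ?I"
    hence "?f z \<in> ?I" using f by blast
    thus "(\<lambda>c. c (?f z)) \<in> measurable (Pi\<^sub>M ?I (\<lambda>_. waiting_law V)) (waiting_law V)"
      by (rule measurable_component_singleton)
  qed
qed

text \<open>Relabelled clocks have the same law, and for regular clocks relabelling conjugates the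
  permutation.\<close>

lemma perm_law_conj:
  assumes \<sigma>: "\<sigma> permutes V" and \<tau>: "\<tau> permutes V"
  shows "perm_law V t (\<tau> \<circ> \<sigma> \<circ> inv \<tau>) = perm_law V t \<sigma>"
proof -
  let ?T = "relabel V \<tau>"
  have "perm_law V t \<sigma> = measure (distr (clock_space V) (clock_space V) ?T) {c \<in> space (clock_space V). interchange_perm V t c = \<sigma>}"
    unfolding distr_relabel(2)[OF \<tau>] perm_law_def ..
  also have "\<dots> = C.prob (?T -` {c \<in> space (clock_space V). interchange_perm V t c = \<sigma>} \<inter> space (clock_space V))"
    by (rule measure_distr[OF distr_relabel(1)[OF \<tau>] perm_event[OF V(1)]])
  also have "\<dots> = perm_law V t (\<tau> \<circ> \<sigma> \<circ> inv \<tau>)"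
    unfolding perm_law_def
  proof (rule C.finite_measure_eq_AE)
    show "AE c in clock_space V. (c \<in> ?T -` {c \<in> space (clock_space V). interchange_perm V t c = \<sigma>} \<inter> space (clock_space V)) =
        (c \<in> {c \<in> space (clock_space V). interchange_perm V t c = \<tau> \<circ> \<sigma> \<circ> inv \<tau>})"
      using AE_regular_clocks[OF V refl time_nonneg] AE_space
    proof eventually_elim
      case (elim c)
      have Tc: "?T c \<in> space (clock_space V)" using distr_relabel(1)[OF \<tau>] elim(2) by (rule measurable_space)
      have eq: "interchange_perm V t c = \<tau> \<circ> interchange_perm V t (?T c) \<circ> inv \<tau>"
        by (rule interchange_perm_relabel[OF elim(1) \<tau>])
      have canc: "inv \<tau> \<circ> (\<tau> \<circ> \<rho> \<circ> inv \<tau>) \<circ> \<tau> = \<rho>" for \<rho> :: "'v \<Rightarrow> 'v"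
        using permutes_inverses[OF \<tau>] by (simp add: fun_eq_iff)
      have "interchange_perm V t (?T c) = \<sigma> \<longleftrightarrow> interchange_perm V t c = \<tau> \<circ> \<sigma> \<circ> inv \<tau>"
        unfolding eq using canc by metis
      thus ?case using Tc elim(2) by simp
    qed
    show "?T -` {c \<in> space (clock_space V). interchange_perm V t c = \<sigma>} \<inter> space (clock_space V) \<in> sets (clock_space V)"
      by (rule measurable_sets[OF distr_relabel(1)[OF \<tau>] perm_event[OF V(1)]])
  qed (rule perm_event[OF V(1)])
  finally show ?thesis ..
qed

text \<open>Two points share at most one edge, so both are untouched with probability at most
  \<open>p\<^sup>2 / q\<close>, where \<open>q = exp (- t / n)\<close>. The resulting variance bound
  \<open>9 / 8 * n\<close>, divided by \<open>(n / 16)\<^sup>2\<close>, gives 288 / n.\<close>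

lemma few_touched:
  defines "E \<equiv> {c \<in> space (clock_space V).
    n / 16 \<le> \<bar>real (card {x \<in> V. \<forall>e\<in>edges V. x \<in> e \<longrightarrow> t < c (e, 0)}) - n * exp (- t / n) ^ (card V - 1)\<bar>}"
  shows "E \<in> sets (clock_space V)" and "C.prob E \<le> 288 / n"
proof -
  define q p where "q = exp (- t / n)" and "p = q ^ (card V - 1)"
  define D where "D x = {e \<in> edges V. x \<in> e} \<times> {0 :: nat}" for x
  define G where "G x = {c \<in> space (clock_space V). (\<forall>z\<in>{}. c z \<le> t) \<and> (\<forall>z\<in>D x. t < c z)}" for x
  have finE: "finite (edges V)" using finite_edges[OF V(1)] .
  have D: "D x \<subseteq> edges V \<times> UNIV" "finite (D x)" for x
    using finE by (auto simp: D_def)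
  have q: "0 < q" "q \<le> 1" using real_card_pos[OF V n_def] time_nonneg by (simp_all add: q_def)
  have cD: "card (D x) = card V - 1" if "x \<in> V" for x
    using card_edges_at[OF V(1) that] by (simp add: D_def card_cartesian_product)
  have G1: "G x \<in> sets (clock_space V)" for x
    unfolding G_def by (rule clock_event[OF V refl]) (use D in auto)
  have Gp: "C.prob (G x) = p" if "x \<in> V" for x
    unfolding G_def using D time_nonneg
    by (subst clock_prob[OF V refl]) (auto simp: cD[OF that] q_def p_def n_def)
  have G2: "C.prob (G x \<inter> G y) \<le> exp (t / n) * p\<^sup>2" if xy: "x \<in> V" "y \<in> V" "x \<noteq> y" for x y
  proof -
    have "G x \<inter> G y = {c \<in> space (clock_space V). (\<forall>z\<in>{}. c z \<le> t) \<and> (\<forall>z\<in>D x \<union> D y. t < c z)}"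
      by (auto simp: G_def)
    hence pr: "C.prob (G x \<inter> G y) = q ^ card (D x \<union> D y)"
      using D time_nonneg by (simp only:) (subst clock_prob[OF V refl]; auto simp: q_def n_def)
    have "D x \<inter> D y = {e \<in> edges V. x \<in> e \<and> y \<in> e} \<times> {0}" by (auto simp: D_def)
    hence "card (D x \<inter> D y) \<le> 1"
      using card_edges_common[OF xy(3), of V] by (simp add: card_cartesian_product)
    hence "2 * (card V - 1) \<le> card (D x \<union> D y) + 1"
      using card_Un_Int[OF D(2) D(2), of x y] cD xy by simp
    hence "q ^ (card (D x \<union> D y) + 1) \<le> q ^ (2 * (card V - 1))"
      using q by (intro power_decreasing) auto
    hence "q ^ card (D x \<union> D y) * q \<le> p\<^sup>2"
      by (simp add: p_def power_mult mult.commute flip: power_mult)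
    hence "q ^ card (D x \<union> D y) \<le> p\<^sup>2 / q"
      using q by (simp add: field_simps)
    also have "\<dots> = exp (t / n) * p\<^sup>2"
      by (simp add: q_def exp_minus field_simps)
    finally show ?thesis unfolding pr .
  qed
  have U: "{x \<in> V. \<forall>e\<in>edges V. x \<in> e \<longrightarrow> t < c (e, 0)} = {x \<in> V. c \<in> G x}" if "c \<in> space (clock_space V)" for c
    using that by (auto simp: G_def D_def)
  have eq: "E = {c \<in> space (clock_space V). n / 16 \<le> \<bar>real (card {x \<in> V. c \<in> G x}) - card V * p\<bar>}"
    using U by (auto simp: E_def p_def q_def n_def)
  note dev = C.count_deviation[where G = G, OF V(1) G1 Gp G2, of "n / 16"]
  have p1: "p \<le> 1" "0 \<le> p" using q by (auto simp: p_def power_le_one)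
  have np: "0 \<le> n * p" "n * p \<le> n" using p1 real_card_pos[OF V n_def] by (auto simp: mult_left_le)
  have \<kappa>: "exp (t / n) - 1 \<le> 1 / (8 * n)" "0 \<le> exp (t / n) - 1"
    using exp_le_double[of "t / n"] real_card_ge_1 real_card_pos[OF V n_def] by (auto simp: t_def field_simps)
  have "card V * p + (card V * p)\<^sup>2 * (exp (t / n) - 1) \<le> n + n\<^sup>2 * (1 / (8 * n))"
    unfolding n_def[symmetric] using np \<kappa> by (intro add_mono mult_mono power_mono) auto
  also have "\<dots> = 9 / 8 * n" using real_card_pos[OF V n_def] by (simp add: power2_eq_square field_simps)
  finally have "(card V * p + (card V * p)\<^sup>2 * (exp (t / n) - 1)) / (n / 16)\<^sup>2 \<le> (9 / 8 * n) / (n / 16)\<^sup>2"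
    by (intro divide_right_mono) auto
  also have "\<dots> = 288 / n" using real_card_pos[OF V n_def] by (simp add: power2_eq_square field_simps)
  finally show "C.prob E \<le> 288 / n"
    using order_trans[OF dev(2)] real_card_pos[OF V n_def] unfolding eq by simp
  show "E \<in> sets (clock_space V)"
    unfolding eq by (rule dev(1)) (use real_card_pos[OF V n_def] in simp_all)
qed

text \<open>Isolated rings on two edges with a common point exclude each other, and for disjoint
  edges the required clocks overlap in at most four; so the events are nearly pairwise independent,
  with factor \<open>exp (4 * t / n)\<close>. Pairs point out of \<open>S\<close>, so each crossing
  edge is counted once.\<close>

lemma few_isolated:
  assumes S: "S \<subseteq> V" "n / 4 \<le> card S" "card S \<le> 3 * n / 4"
  defines "E \<equiv> {c \<in> space (clock_space V). card {z \<in> S \<times> (V - S). isolated_ring V t (fst z) (snd z) c} < n / 512}"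
  shows "\<exists>F\<in>sets (clock_space V). E \<subseteq> F \<and> C.prob F \<le> 800 / n"
proof -
  define q p where "q = exp (- t / n)" and "p = (1 - q) * q ^ (2 * (card V - 2) + 1)"
  define I where "I = S \<times> (V - S)"
  define A B where "A z = {({fst z, snd z}, 0 :: nat)}"
    and "B z = insert ({fst z, snd z}, 1 :: nat) (adjacent_edges V (fst z) (snd z) \<times> {0})" for z :: "'v \<times> 'v"
  define G where "G z = {c \<in> space (clock_space V). (\<forall>u\<in>A z. c u \<le> t) \<and> (\<forall>u\<in>B z. t < c u)}" for z
  have finE: "finite (edges V)" using finite_edges[OF V(1)] .
  have adjE: "adjacent_edges V x y \<subseteq> edges V" for x y by (auto simp: adjacent_edges_def)
  have fin_adj: "finite (adjacent_edges V x y)" for x y using finE adjE by (rule rev_finite_subset)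
  have finI: "finite I" unfolding I_def using V(1) finite_subset[OF S(1) V(1)] by simp
  have IV: "fst z \<in> V" "snd z \<in> V" "fst z \<noteq> snd z" if "z \<in> I" for z
    using that S(1) by (auto simp: I_def)
  have AB: "A z \<subseteq> edges V \<times> UNIV" "B z \<subseteq> edges V \<times> UNIV" "finite (A z)" "finite (B z)" "A z \<inter> B z = {}"
    if "z \<in> I" for z
  proof -
    have "{fst z, snd z} \<in> edges V" using IV[OF that] by (rule doubleton_in_edges)
    thus "A z \<subseteq> edges V \<times> UNIV" "B z \<subseteq> edges V \<times> UNIV"
      using adjE[of "fst z" "snd z"] unfolding A_def B_def by blast+
    show "finite (A z)" "finite (B z)" using fin_adj by (simp_all add: A_def B_def)
    show "A z \<inter> B z = {}" by (simp add: A_def B_def adjacent_edges_def)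
  qed
  have cA: "card (A z) = 1" for z by (simp add: A_def)
  have cB: "card (B z) = 2 * (card V - 2) + 1" if "z \<in> I" for z
    using card_adjacent_edges[OF V(1) IV[OF that]] fin_adj
    by (simp add: B_def card_cartesian_product)
  have q: "0 < q" "q < 1" using real_card_pos[OF V n_def] time_nonneg by (simp_all add: q_def t_def)
  have G1: "G z \<in> sets (clock_space V)" if "z \<in> I" for z
    unfolding G_def by (rule clock_event[OF V refl]) (use AB[OF that] in auto)
  have Gp: "C.prob (G z) = p" if "z \<in> I" for z
    unfolding G_def clock_prob[OF V refl AB[OF that] time_nonneg] cA cB[OF that] by (simp add: q_def p_def n_def)
  have G2: "C.prob (G z \<inter> G z') \<le> exp (4 * t / n) * p\<^sup>2" if z: "z \<in> I" "z' \<in> I" "z \<noteq> z'" for z z'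
  proof -
    let ?e = "{fst z, snd z}" and ?e' = "{fst z', snd z'}"
    have ne: "?e \<noteq> ?e'"
      using z by (auto simp: I_def doubleton_eq_iff prod_eq_iff)
    show ?thesis
    proof (cases "?e \<inter> ?e' = {}")
      case False
      have "?e' \<in> edges V" using IV[OF z(2)] by (rule doubleton_in_edges)
      hence "?e' \<in> adjacent_edges V (fst z) (snd z)"
        unfolding adjacent_edges_def using False ne by blast
      hence "(?e', 0) \<in> B z" by (simp add: B_def)
      moreover have "(?e', 0) \<in> A z'" by (simp add: A_def)
      ultimately have "False" if "c \<in> G z" "c \<in> G z'" for c
        using that unfolding G_def by (metis (mono_tags, lifting) mem_Collect_eq not_le)
      hence "G z \<inter> G z' = {}" by blast
      thus ?thesis by simp
    next
      case True
      have eq: "G z \<inter> G z' = {c \<in> space (clock_space V). (\<forall>u\<in>A z \<union> A z'. c u \<le> t) \<and> (\<forall>u\<in>B z \<union> B z'. t < c u)}"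
        by (auto simp: G_def)
      have na: "?e' \<notin> adjacent_edges V (fst z) (snd z)" "?e \<notin> adjacent_edges V (fst z') (snd z')"
        using True by (auto simp: adjacent_edges_def)
      have disj: "(A z \<union> A z') \<inter> (B z \<union> B z') = {}"
        using na AB(5)[OF z(1)] AB(5)[OF z(2)] unfolding A_def B_def by simp
      have cAA: "card (A z \<union> A z') = 2"
        using ne by (simp add: A_def card_insert_if)
      have "B z \<inter> B z' = (adjacent_edges V (fst z) (snd z) \<inter> adjacent_edges V (fst z') (snd z')) \<times> {0}"
        using ne unfolding B_def by auto
      hence "card (B z \<inter> B z') \<le> 4"
        using card_adjacent_edges_Int[OF V(1) True] by (simp add: card_cartesian_product)
      hence cBB: "2 * (2 * (card V - 2) + 1) \<le> card (B z \<union> B z') + 4"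
        using card_Un_Int[OF AB(4)[OF z(1)] AB(4)[OF z(2)]] cB z by simp
      have pr: "C.prob (G z \<inter> G z') = (1 - q)\<^sup>2 * q ^ card (B z \<union> B z')"
        unfolding eq using AB[OF z(1)] AB[OF z(2)] disj time_nonneg
        by (subst clock_prob[OF V refl]) (auto simp: cAA q_def n_def)
      have "q ^ card (B z \<union> B z') * q ^ 4 \<le> q ^ (2 * (2 * (card V - 2) + 1))"
        unfolding power_add[symmetric] using cBB q by (intro power_decreasing) auto
      hence "(1 - q)\<^sup>2 * (q ^ card (B z \<union> B z') * q ^ 4) \<le> (1 - q)\<^sup>2 * q ^ (2 * (2 * (card V - 2) + 1))"
        by (intro mult_left_mono) auto
      also have "\<dots> = p\<^sup>2"
        unfolding p_def power_mult_distrib by (simp only: power_mult[symmetric] mult.commute)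
      finally have "(1 - q)\<^sup>2 * q ^ card (B z \<union> B z') \<le> p\<^sup>2 / q ^ 4"
        using q by (simp add: field_simps)
      also have "q ^ 4 = exp (- (4 * t / n))"
        by (simp add: q_def flip: exp_of_nat_mult)
      hence "p\<^sup>2 / q ^ 4 = exp (4 * t / n) * p\<^sup>2"
        by (simp add: exp_minus divide_inverse mult.commute)
      finally show ?thesis unfolding pr .
    qed
  qed
  have iso: "{z \<in> S \<times> (V - S). isolated_ring V t (fst z) (snd z) c} = {z \<in> I. c \<in> G z}" if "c \<in> space (clock_space V)" for c
    using that by (auto simp: I_def G_def A_def B_def isolated_ring_def adjacent_edges_def)
  define m where "m = card I * p"
  \<comment> \<open>A balanced \<open>S\<close> has at least \<open>3 * n\<^sup>2 / 16\<close>
    crossing pairs; for each, the ring by time \<open>t\<close> has probability at least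
    \<open>1 / (32 * n)\<close> and the required silence at least \<open>7 / 8\<close>.\<close>
  have m: "21 * n / 4096 \<le> m"
  proof -
    define k where "k = real (card S)"
    have "card S \<le> card V" using S(1) V(1) by (rule card_mono[rotated])
    hence cI: "real (card I) = k * (n - k)"
      using card_Diff_subset[OF finite_subset[OF S(1) V(1)] S(1)]
      by (simp add: I_def card_cartesian_product k_def n_def of_nat_diff)
    have "0 \<le> (k - n / 4) * (3 * n / 4 - k)"
      using S(2,3) by (intro mult_nonneg_nonneg) (auto simp: k_def)
    hence N: "3 * n\<^sup>2 / 16 \<le> card I"
      unfolding cI by (simp add: power2_eq_square field_simps)
    have tn: "0 \<le> t / n" "t / n \<le> 1" using real_card_ge_1 real_card_pos[OF V n_def] by (auto simp: t_def field_simps)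
    have p1: "1 / (32 * n) \<le> 1 - q"
      using one_minus_exp_ge[OF tn] by (simp add: q_def t_def)
    have "(2 * real (card V - 2) + 1) * (t / n) \<le> (2 * n) * (t / n)"
      using real_card_pos[OF V n_def] tn by (intro mult_right_mono) (auto simp: n_def)
    also have "\<dots> = 1 / 8" using real_card_pos[OF V n_def] by (simp add: t_def)
    finally have "7 / 8 \<le> 1 + - ((2 * real (card V - 2) + 1) * (t / n))" by simp
    also have "\<dots> \<le> exp (- ((2 * real (card V - 2) + 1) * (t / n)))" by (rule exp_ge_add_one_self)
    also have "\<dots> = q ^ (2 * (card V - 2) + 1)"
      unfolding q_def exp_of_nat_mult[symmetric] by simp
    finally have p2: "7 / 8 \<le> q ^ (2 * (card V - 2) + 1)" .
    have "1 / (32 * n) * (7 / 8) \<le> p"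
      unfolding p_def using p1 p2 real_card_pos[OF V n_def] q by (intro mult_mono) auto
    hence "3 * n\<^sup>2 / 16 * (1 / (32 * n) * (7 / 8)) \<le> m"
      unfolding m_def using N real_card_pos[OF V n_def] by (intro mult_mono) auto
    thus ?thesis using real_card_pos[OF V n_def] by (simp add: power2_eq_square field_simps)
  qed
  have m0: "m > 0" using m real_card_pos[OF V n_def] by (smt (verit) divide_pos_pos mult_pos_pos)
  \<comment> \<open>Half the mean exceeds \<open>n / 512\<close>, so a count below that level
    deviates from the mean by at least \<open>m / 2\<close>; Chebyshev is applied to this larger
    event.\<close>
  define F where "F = {c \<in> space (clock_space V). m / 2 \<le> \<bar>real (card {z \<in> I. c \<in> G z}) - card I * p\<bar>}"
  note dev = C.count_deviation[where G = G and I = I and w = "m / 2", OF finI G1 Gp G2]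
  have F: "F \<in> sets (clock_space V)"
    unfolding F_def by (rule dev(1)) (use m0 in auto)
  have "C.prob F \<le> (m + m\<^sup>2 * (exp (4 * t / n) - 1)) / (m / 2)\<^sup>2"
    unfolding F_def m_def[symmetric] using dev(2) m0 by (simp add: m_def)
  also have "\<dots> = 4 / m + 4 * (exp (4 * t / n) - 1)"
    using m0 by (simp add: power2_eq_square field_simps)
  also have "\<dots> \<le> 798 / n + 2 / n"
  proof (rule add_mono)
    have "4 / m \<le> 4 / (21 * n / 4096)"
      using m real_card_pos[OF V n_def] by (intro divide_left_mono mult_pos_pos) (auto simp: m0)
    also have "\<dots> \<le> 798 / n" using real_card_pos[OF V n_def] by (simp add: field_simps)
    finally show "4 / m \<le> 798 / n" .
    have "exp (4 * t / n) - 1 \<le> 2 * (4 * t / n)"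
      using real_card_ge_1 real_card_pos[OF V n_def] time_nonneg by (intro exp_le_double) (auto simp: t_def field_simps)
    thus "4 * (exp (4 * t / n) - 1) \<le> 2 / n" using real_card_pos[OF V n_def] by (simp add: t_def field_simps)
  qed
  finally have "C.prob F \<le> 800 / n" by simp
  moreover have "E \<subseteq> F"
  proof
    fix c assume "c \<in> E"
    hence c: "c \<in> space (clock_space V)" "real (card {z \<in> I. c \<in> G z}) < n / 512"
      using iso[of c] by (auto simp: E_def)
    have "n / 512 \<le> m / 2" using m real_card_pos[OF V n_def] by simp
    thus "c \<in> F" using c unfolding F_def m_def[symmetric] by simp
  qed
  ultimately show ?thesis using F by blast
qed

text \<open>Outside \<open>F'\<close> at least 15/16 - 1/16 = 7/8 of all points are untouched, which
  leaves at most \<open>n / 8\<close> displaced ones; outside \<open>F\<close> there are at least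
  \<open>n / 512\<close> isolated rings out of \<open>S\<close>. The bounds 800 / n and 288 / n add
  up.\<close>

lemma displacement_bound:
  assumes S: "S \<subseteq> V" "n / 4 \<le> card S" "card S \<le> 3 * n / 4"
  shows "(\<Sum>\<sigma> | \<sigma> permutes V. if n / 512 \<le> card (S - \<sigma> ` S) \<and> card (S - \<sigma> ` S) \<le> n / 8 then 0 else perm_law V t \<sigma>) \<le> 1088 / n"
proof -
  let ?Q = "\<lambda>\<sigma>. \<not> (n / 512 \<le> card (S - \<sigma> ` S) \<and> card (S - \<sigma> ` S) \<le> n / 8)"
  let ?U = "\<lambda>c. card {x \<in> V. \<forall>e\<in>edges V. x \<in> e \<longrightarrow> t < c (e, 0)}"
  let ?p = "exp (- t / n) ^ (card V - 1)"
  obtain F where F: "F \<in> sets (clock_space V)" "C.prob F \<le> 800 / n"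
    "{c \<in> space (clock_space V). card {z \<in> S \<times> (V - S). isolated_ring V t (fst z) (snd z) c} < n / 512} \<subseteq> F"
    using few_isolated[OF S] by blast
  define F' where "F' = {c \<in> space (clock_space V). n / 16 \<le> \<bar>real (?U c) - n * ?p\<bar>}"
  have F': "F' \<in> sets (clock_space V)" "C.prob F' \<le> 288 / n"
    unfolding F'_def by (rule few_touched)+
  have p: "15 / 16 \<le> ?p"
  proof -
    have "real (card V - 1) * (t / n) \<le> n * (t / n)"
      using real_card_pos[OF V n_def] time_nonneg by (intro mult_right_mono) (auto simp: n_def)
    also have "\<dots> = 1 / 16" using real_card_pos[OF V n_def] by (simp add: t_def)
    finally have "15 / 16 \<le> 1 + - (real (card V - 1) * (t / n))" by simp
    also have "\<dots> \<le> exp (- (real (card V - 1) * (t / n)))" by (rule exp_ge_add_one_self)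
    also have "\<dots> = ?p" unfolding exp_of_nat_mult[symmetric] by simp
    finally show ?thesis .
  qed
  have "(\<Sum>\<sigma> | \<sigma> permutes V. if n / 512 \<le> card (S - \<sigma> ` S) \<and> card (S - \<sigma> ` S) \<le> n / 8 then 0 else perm_law V t \<sigma>) =
      (\<Sum>\<sigma> | \<sigma> permutes V. if ?Q \<sigma> then perm_law V t \<sigma> else 0)"
    by (intro sum.cong) auto
  also have "\<dots> = C.prob {c \<in> space (clock_space V). ?Q (interchange_perm V t c)}"
    by (rule perm_law_sum[OF V(1)])
  also have "\<dots> \<le> C.prob (F \<union> F')"
  proof (rule C.finite_measure_mono_AE)
    show "AE c in clock_space V. c \<in> {c \<in> space (clock_space V). ?Q (interchange_perm V t c)} \<longrightarrow> c \<in> F \<union> F'"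
      using AE_regular_clocks[OF V refl time_nonneg] AE_space
    proof eventually_elim
      case (elim c)
      let ?J = "card (S - interchange_perm V t c ` S)"
      have lower: "n / 512 \<le> ?J" if "c \<notin> F"
      proof -
        have "n / 512 \<le> card {z \<in> S \<times> (V - S). isolated_ring V t (fst z) (snd z) c}"
          using that F(3) elim(2) by (auto simp: not_less)
        also have "\<dots> \<le> ?J" using displaced_lower[OF elim(1) V(1) S(1)] by simp
        finally show ?thesis .
      qed
      have upper: "?J \<le> n / 8" if "c \<notin> F'"
      proof -
        have "\<bar>real (?U c) - n * ?p\<bar> < n / 16"
          using that elim(2) by (simp add: F'_def not_le)
        moreover have "n * (15 / 16) \<le> n * ?p" using p real_card_pos[OF V n_def] by (intro mult_left_mono) auto
        moreover have "real ?J + real (?U c) \<le> n"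
          unfolding n_def of_nat_add[symmetric] using displaced_upper[OF elim(1) V(1) S(1)] by (rule of_nat_mono)
        moreover have "j \<le> n / 8" if "\<bar>u - x\<bar> < n / 16" "n * (15 / 16) \<le> x" "j + u \<le> n" for j u x
          using that by linarith
        ultimately show ?thesis by blast
      qed
      show ?case using lower upper by blast
    qed
  qed (use F F' in auto)
  also have "\<dots> \<le> C.prob F + C.prob F'"
    using F F' by (intro measure_Un_le)
  also have "\<dots> \<le> 1088 / n"
    using F(2) F'(2) by (simp add: add_divide_distrib[symmetric])
  finally show ?thesis .
qed

end

section \<open>Noise sensitivity implies exclusion sensitivity\<close>

definition config_of :: "'v set \<Rightarrow> 'v set \<Rightarrow> 'v \<Rightarrow> bool" where
  "config_of V S = (\<lambda>x\<in>V. x \<in> S)"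

lemma config_of_in_configs: "config_of V S \<in> configs V"
  by (simp add: config_of_def configs_def)

lemma config_of_Collect: "\<omega> \<in> configs V \<Longrightarrow> config_of V {x \<in> V. \<omega> x} = \<omega>"
  by (auto simp: config_of_def configs_def PiE_def extensional_def fun_eq_iff)

lemma bij_betw_config_of: "bij_betw (config_of V) (Pow V) (configs V)"
proof (rule bij_betw_byWitness[where f' = "\<lambda>\<omega>. {x \<in> V. \<omega> x}"])
  show "\<forall>S\<in>Pow V. {x \<in> V. config_of V S x} = S"
    by (auto simp: config_of_def)
  show "\<forall>\<omega>\<in>configs V. config_of V {x \<in> V. \<omega> x} = \<omega>"
    by (intro ballI config_of_Collect)
  show "config_of V ` Pow V \<subseteq> configs V"
    by (intro image_subsetI config_of_in_configs)
qed blast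

lemma sum_configs: "(\<Sum>\<omega>\<in>configs V. h \<omega>) = (\<Sum>S\<in>Pow V. h (config_of V S))"
  by (rule sum.reindex_bij_betw[OF bij_betw_config_of, symmetric])

lemma finite_configs: "finite V \<Longrightarrow> finite (configs V)"
  using bij_betw_finite[OF bij_betw_config_of[of V]] by simp

lemma configs_nonempty: "configs V \<noteq> {}"
  using config_of_in_configs by blast

lemma card_configs: "finite V \<Longrightarrow> card (configs V) = 2 ^ card V"
  using bij_betw_same_card[OF bij_betw_config_of[of V]] by (simp add: card_Pow)

lemma config_of_mono: "S \<subseteq> T \<Longrightarrow> config_of V S \<le> config_of V T"
  by (auto simp: config_of_def le_fun_def)

lemma set_uniform_config: "finite V \<Longrightarrow> set_pmf (uniform_config V) = configs V"
  by (simp add: uniform_config_def finite_configs configs_nonempty)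

lemma expectation_uniform_config:
  fixes h :: "('v \<Rightarrow> bool) \<Rightarrow> real"
  assumes "finite V"
  shows "measure_pmf.expectation (uniform_config V) h = av V (\<lambda>S. h (config_of V S))"
  unfolding uniform_config_def using assms
  by (simp add: integral_pmf_of_set finite_configs configs_nonempty card_configs sum_configs av_eq)

lemma expectation_marks:
  fixes h :: "('v \<Rightarrow> bool) \<Rightarrow> real"
  assumes V: "finite V" and \<epsilon>: "0 \<le> \<epsilon>" "\<epsilon> \<le> 1"
  shows "measure_pmf.expectation (Pi_pmf V undefined (\<lambda>_. bernoulli_pmf \<epsilon>)) h =
    bav V \<epsilon> (\<lambda>R. h (config_of V R))"
proof -
  let ?p = "Pi_pmf V undefined (\<lambda>_. bernoulli_pmf \<epsilon>)"
  have "set_pmf ?p \<subseteq> configs V"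
    using set_Pi_pmf_subset[OF V] by (force simp: configs_def PiE_def extensional_def)
  hence "measure_pmf.expectation ?p h = (\<Sum>\<omega>\<in>configs V. h \<omega> * pmf ?p \<omega>)"
    using finite_configs[OF V] by (subst integral_measure_pmf_real[of "configs V"]) auto
  also have "\<dots> = (\<Sum>R\<in>Pow V. h (config_of V R) * pmf ?p (config_of V R))"
    by (rule sum_configs)
  also have "\<dots> = bav V \<epsilon> (\<lambda>R. h (config_of V R))"
    unfolding bav_def
  proof (rule sum.cong[OF refl])
    fix R assume "R \<in> Pow V"
    hence R: "R \<subseteq> V" by simp
    have "pmf ?p (config_of V R) = (\<Prod>x\<in>V. pmf (bernoulli_pmf \<epsilon>) (config_of V R x))"
      using V by (intro pmf_Pi') (auto simp: config_of_def)
    also have "\<dots> = (\<Prod>x\<in>V. if x \<in> R then \<epsilon> else 1 - \<epsilon>)"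
      using \<epsilon> by (intro prod.cong) (auto simp: config_of_def)
    also have "\<dots> = \<epsilon> ^ card R * (1 - \<epsilon>) ^ card (V - R)"
      using V R by (simp add: prod.If_cases Int_absorb1 Diff_eq)
    finally show "h (config_of V R) * pmf ?p (config_of V R) =
        \<epsilon> ^ card R * (1 - \<epsilon>) ^ card (V - R) * h (config_of V R)" by simp
  qed
  finally show ?thesis .
qed

lemma expectation_noise_pair:
  fixes f :: "('v \<Rightarrow> bool) \<Rightarrow> real"
  assumes V: "finite V" and \<epsilon>: "0 \<le> \<epsilon>" "\<epsilon> \<le> 1"
  shows "measure_pmf.expectation (noise_pair V \<epsilon>) (\<lambda>(\<omega>, \<omega>'). f \<omega> * f \<omega>') =
    bav V \<epsilon> (noise_energy V (\<lambda>S. f (config_of V S)))"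
proof -
  let ?U = "uniform_config V" and ?R = "Pi_pmf V undefined (\<lambda>_. bernoulli_pmf \<epsilon>)"
  let ?h = "\<lambda>(\<omega>, \<omega>'). f \<omega> * f \<omega>'"
  let ?E = "measure_pmf.expectation"
  have finU: "finite (set_pmf ?U)" using V by (simp add: set_uniform_config finite_configs)
  have "set_pmf ?R \<subseteq> configs V"
    using set_Pi_pmf_subset[OF V] by (force simp: configs_def PiE_def extensional_def)
  hence finR: "finite (set_pmf ?R)" using finite_configs[OF V] finite_subset by blast
  \<comment> \<open>All laws involved have finite support, so the expectation of a bind is an
    iterated finite sum.\<close>
  have bind: "?E (p \<bind> k) g = ?E p (\<lambda>x. ?E (k x) g)"
    if "finite (set_pmf p)" "\<And>x. finite (set_pmf (k x))"
    for p :: "('v \<Rightarrow> bool) pmf" and k :: "('v \<Rightarrow> bool) \<Rightarrow> (('v \<Rightarrow> bool) \<times> ('v \<Rightarrow> bool)) pmf"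
      and g :: "('v \<Rightarrow> bool) \<times> ('v \<Rightarrow> bool) \<Rightarrow> real"
    using that by (simp add: pmf_expectation_bind[of "set_pmf p"] integral_measure_pmf_real[of "set_pmf p"] mult.commute)
  have "?E (noise_pair V \<epsilon>) ?h =
      ?E ?U (\<lambda>\<omega>. ?E ?R (\<lambda>r. ?E ?U (\<lambda>\<xi>. f \<omega> * f (\<lambda>x\<in>V. if r x then \<xi> x else \<omega> x))))"
    unfolding noise_pair_def using finU finR by (simp add: bind)
  also have "\<dots> = av V (\<lambda>S. bav V \<epsilon> (\<lambda>R. av V (\<lambda>T. f (config_of V S) *
      f (\<lambda>x\<in>V. if config_of V R x then config_of V T x else config_of V S x))))"
    by (simp only: expectation_uniform_config[OF V] expectation_marks[OF assms])
  also have "\<dots> = av V (\<lambda>S. bav V \<epsilon> (\<lambda>R. av V (\<lambda>T. f (config_of V S) * f (config_of V (mix R S T)))))"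
  proof -
    have "(\<lambda>x\<in>V. if config_of V R x then config_of V T x else config_of V S x) = config_of V (mix R S T)"
      for R S T by (auto simp: config_of_def mix_def fun_eq_iff)
    thus ?thesis by simp
  qed
  also have "\<dots> = bav V \<epsilon> (noise_energy V (\<lambda>S. f (config_of V S)))"
    by (subst bav_swap) (auto intro!: bav_cong simp: noise_energy_eq[OF V])
  finally show ?thesis .
qed

text \<open>The product of the two values is a finite sum over permutations of a function of the
  initial configuration times the indicator of a clock event. In this form it is jointly measurable
  and Fubini applies.\<close>

lemma exclusion_expectation:
  fixes f :: "('v \<Rightarrow> bool) \<Rightarrow> real"
  assumes V: "finite V"
  shows "(\<integral>w. f (fst w) * f (exclusion_config V t w) \<partial>exclusion_space V) =
      (\<Sum>\<sigma> | \<sigma> permutes V. perm_law V t \<sigma> * av V (\<lambda>S. f (config_of V S) * f (config_of V (\<sigma> ` S))))"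
    and "(\<integral>w. f (fst w) \<partial>exclusion_space V) = av V (\<lambda>S. f (config_of V S))"
proof -
  let ?U = "measure_pmf (uniform_config V)" and ?C = "clock_space V" and ?P = "{\<sigma>. \<sigma> permutes V}"
  interpret C: prob_space ?C by (rule prob_space_clock_space[OF V])
  interpret pair_sigma_finite ?U ?C ..
  have space: "exclusion_space V = ?U \<Otimes>\<^sub>M ?C"
    by (simp add: exclusion_space_def clock_space_def)
  have finP: "finite ?P" using finite_permutations[OF V] .
  have finU: "finite (set_pmf (uniform_config V))" using V by (simp add: set_uniform_config finite_configs)
  let ?E = "\<lambda>\<sigma>. {c \<in> space ?C. interchange_perm V t c = \<sigma>}"
  define g where "g \<sigma> \<omega> = f \<omega> * f (\<lambda>x\<in>V. \<omega> (inv \<sigma> x))" for \<sigma> \<omega>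
  define k where "k w = (\<Sum>\<sigma>\<in>?P. g \<sigma> (fst w) * indicator (?E \<sigma>) (snd w))" for w :: "('v \<Rightarrow> bool) \<times> ('v set \<times> nat \<Rightarrow> real)"
  have k: "f (fst w) * f (exclusion_config V t w) = k w" if "w \<in> space (?U \<Otimes>\<^sub>M ?C)" for w
  proof -
    let ?\<pi> = "interchange_perm V t (snd w)"
    have "snd w \<in> space ?C" using that by (auto simp: space_pair_measure)
    hence "k w = (\<Sum>\<sigma>\<in>?P. if \<sigma> = ?\<pi> then g \<sigma> (fst w) else 0)"
      unfolding k_def by (intro sum.cong) (auto simp: indicator_def)
    also have "\<dots> = g ?\<pi> (fst w)"
      using finP interchange_permutes[of V t "snd w"] by simp
    finally show ?thesis by (simp add: g_def exclusion_config_def split_beta)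
  qed
  have ind [measurable]: "(\<lambda>c. indicator (?E \<sigma>) c :: real) \<in> borel_measurable ?C" for \<sigma>
    by (rule borel_measurable_indicator[OF perm_event[OF V]])
  have km: "k \<in> borel_measurable (?U \<Otimes>\<^sub>M ?C)"
    unfolding k_def
    by (intro borel_measurable_sum borel_measurable_times measurable_compose[OF measurable_fst]
        measurable_compose[OF measurable_snd] ind) simp
  have inner: "(\<integral>c. k (\<omega>, c) \<partial>?C) = (\<Sum>\<sigma>\<in>?P. g \<sigma> \<omega> * perm_law V t \<sigma>)"
    and inner_int: "integrable ?C (\<lambda>c. k (\<omega>, c))" for \<omega>
  proof -
    have i: "integrable ?C (\<lambda>c. g \<sigma> \<omega> * indicator (?E \<sigma>) c)" for \<sigma>
      using perm_event[OF V] by (intro integrable_mult_right) (simp add: C.emeasure_eq_measure)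
    show "integrable ?C (\<lambda>c. k (\<omega>, c))"
      unfolding k_def fst_conv snd_conv by (intro Bochner_Integration.integrable_sum i)
    show "(\<integral>c. k (\<omega>, c) \<partial>?C) = (\<Sum>\<sigma>\<in>?P. g \<sigma> \<omega> * perm_law V t \<sigma>)"
      unfolding k_def fst_conv snd_conv
      by (subst Bochner_Integration.integral_sum[OF i]) (simp add: perm_law_def perm_event[OF V])
  qed
  have "(\<integral>w. f (fst w) * f (exclusion_config V t w) \<partial>exclusion_space V) = (\<integral>w. k w \<partial>(?U \<Otimes>\<^sub>M ?C))"
    unfolding space by (rule Bochner_Integration.integral_cong[OF refl k])
  also have "\<dots> = (\<integral>\<omega>. (\<integral>c. k (\<omega>, c) \<partial>?C) \<partial>?U)"
    by (intro integral_fst'[symmetric] Fubini_integrable km integrable_measure_pmf_finite[OF finU] AE_I2 inner_int)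
  also have "\<dots> = av V (\<lambda>S. \<Sum>\<sigma>\<in>?P. g \<sigma> (config_of V S) * perm_law V t \<sigma>)"
    unfolding inner by (rule expectation_uniform_config[OF V])
  also have "\<dots> = (\<Sum>\<sigma>\<in>?P. perm_law V t \<sigma> * av V (\<lambda>S. g \<sigma> (config_of V S)))"
    by (simp add: bav_sum bav_cmult mult.commute)
  also have "\<dots> = (\<Sum>\<sigma>\<in>?P. perm_law V t \<sigma> * av V (\<lambda>S. f (config_of V S) * f (config_of V (\<sigma> ` S))))"
  proof (intro sum.cong refl arg_cong2[of _ _ _ _ "(*)"] bav_cong)
    fix \<sigma> S assume "\<sigma> \<in> ?P" and S: "S \<subseteq> V"
    hence \<sigma>: "\<sigma> permutes V" by simp
    have "x \<in> V \<Longrightarrow> config_of V S (inv \<sigma> x) \<longleftrightarrow> x \<in> \<sigma> ` S" for x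
      using permutes_in_image[OF permutes_inv[OF \<sigma>], of x] permutes_inverses[OF \<sigma>]
      by (auto simp: config_of_def image_iff) metis
    hence "(\<lambda>x\<in>V. config_of V S (inv \<sigma> x)) = config_of V (\<sigma> ` S)"
      unfolding config_of_def[of V "\<sigma> ` S"] by (intro restrict_ext)
    thus "g \<sigma> (config_of V S) = f (config_of V S) * f (config_of V (\<sigma> ` S))"
      by (simp add: g_def)
  qed
  finally show "(\<integral>w. f (fst w) * f (exclusion_config V t w) \<partial>exclusion_space V) =
      (\<Sum>\<sigma>\<in>?P. perm_law V t \<sigma> * av V (\<lambda>S. f (config_of V S) * f (config_of V (\<sigma> ` S))))" .
  have "(\<integral>w. f (fst w) \<partial>(?U \<Otimes>\<^sub>M ?C)) = (\<integral>\<omega>. (\<integral>c. f (fst (\<omega>, c)) \<partial>?C) \<partial>?U)"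
    by (intro integral_fst'[symmetric] Fubini_integrable integrable_measure_pmf_finite[OF finU] AE_I2
        measurable_compose[OF measurable_fst]) simp_all
  thus "(\<integral>w. f (fst w) \<partial>exclusion_space V) = av V (\<lambda>S. f (config_of V S))"
    unfolding space by (simp add: C.prob_space expectation_uniform_config[OF V])
qed

text \<open>On boundedly many points, noise sensitivity forces the functions to be eventually constant.\<close>

lemma noise_correlation_nonconstant:
  assumes V: "finite V" and \<epsilon>: "0 \<le> \<epsilon>" "\<epsilon> \<le> 1"
    and h: "\<And>X. X \<subseteq> V \<Longrightarrow> h X = 1 \<or> h X = -1"
    and ST: "S \<subseteq> V" "T \<subseteq> V" "h S = 1" "h T = -1"
  shows "((1 - \<epsilon>) / 2) ^ card V \<le> bav V \<epsilon> (noise_energy V h) - (av V h)\<^sup>2"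
proof -
  let ?c = "av V h"
  \<comment> \<open>The variance of \<open>h\<close> is at least the contribution of
    \<open>S\<close> and \<open>T\<close>, where \<open>h\<close> is 1 and -1; each has weight
    \<open>1 / 2 ^ card V\<close>.\<close>
  have "(1 - ?c)\<^sup>2 + (1 + ?c)\<^sup>2 = (h S - ?c)\<^sup>2 + (h T - ?c)\<^sup>2"
    using ST by (simp add: power2_eq_square algebra_simps)
  also have "\<dots> = (\<Sum>X\<in>{S, T}. (h X - ?c)\<^sup>2)"
    using ST by (subst sum.insert) auto
  also have "\<dots> \<le> (\<Sum>X\<in>Pow V. (h X - ?c)\<^sup>2)"
    using V ST by (intro sum_mono2) auto
  also have "\<dots> = 2 ^ card V * av V (\<lambda>X. (h X - ?c)\<^sup>2)"
    using V by (simp add: av_eq)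
  also have "av V (\<lambda>X. (h X - ?c)\<^sup>2) = av V (\<lambda>X. (h X)\<^sup>2 - (2 * ?c) * h X + ?c\<^sup>2)"
    by (intro bav_cong) (simp add: power2_eq_square algebra_simps)
  also have "\<dots> = av V (\<lambda>X. (h X)\<^sup>2) - ?c\<^sup>2"
    by (simp only: bav_add bav_diff bav_cmult bav_const[OF V]) (simp add: power2_eq_square)
  also have "av V (\<lambda>X. (h X)\<^sup>2) = noise_energy V h {}"
    using V by (simp add: noise_energy_def resample_def mix_def bav_const)
  finally have "(1 - ?c)\<^sup>2 + (1 + ?c)\<^sup>2 \<le> 2 ^ card V * (noise_energy V h {} - ?c\<^sup>2)" .
  moreover have "1 \<le> (1 - ?c)\<^sup>2 + (1 + ?c)\<^sup>2"
    using zero_le_power2[of ?c] by (simp add: power2_eq_square algebra_simps)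
  ultimately have "1 \<le> 2 ^ card V * (noise_energy V h {} - ?c\<^sup>2)" by linarith
  hence "(1 - \<epsilon>) ^ card V * (1 / 2 ^ card V) \<le> (1 - \<epsilon>) ^ card V * (noise_energy V h {} - ?c\<^sup>2)"
    using \<epsilon> by (intro mult_left_mono) (simp_all add: field_simps)
  \<comment> \<open>Only the term in which nothing is resampled is kept; it has weight
    \<open>(1 - \<epsilon>) ^ card V\<close> and carries the full variance.\<close>
  also have "\<dots> \<le> bav V \<epsilon> (\<lambda>R. noise_energy V h R - ?c\<^sup>2)"
    using bav_ge_term[OF V \<epsilon>, of "\<lambda>R. noise_energy V h R - ?c\<^sup>2" "{}"] noise_energy_ge_square_mean[OF V]
    by simp
  finally show ?thesis by (simp add: bav_diff bav_const[OF V] power_divide)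
qed

theorem corollary1p15:
  fixes V :: "nat \<Rightarrow> 'v set"
    and f :: "nat \<Rightarrow> ('v \<Rightarrow> bool) \<Rightarrow> real"
  assumes "\<And>n. finite (V n)"
    and "incseq V"
    and "\<And>n. f n \<in> configs (V n) \<rightarrow> {-1, 1}"
    and "\<And>n. mono_on (configs (V n)) (f n)"
    and "noise_sensitive V f"
  shows "complete_graph_exclusion_sensitive V f"
proof -
  note fin = assms(1)
  define h where "h n S = f n (config_of (V n) S)" for n S
  define \<beta> where "\<beta> n = bav (V n) (1 / 128) (noise_energy (V n) (h n)) - (av (V n) (h n))\<^sup>2" for n
  define e where "e n = (\<Sum>\<sigma> | \<sigma> permutes V n. perm_law (V n) (1 / 16) \<sigma> *
    av (V n) (\<lambda>S. h n S * h n (\<sigma> ` S))) - (av (V n) (h n))\<^sup>2" for n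
  have h_val: "h n X = 1 \<or> h n X = -1" for n X
    using assms(3)[of n] config_of_in_configs[of "V n" X] by (auto simp: h_def)
  have h_abs: "\<bar>h n X\<bar> \<le> 1" for n X
    using h_val[of n X] by auto
  have h_mono: "h n X \<le> h n Y" if "X \<subseteq> Y" for n X Y
    unfolding h_def
    by (rule mono_onD[OF assms(4)[of n] config_of_in_configs config_of_in_configs config_of_mono[OF that]])
  have \<beta>: "\<beta> \<longlonglongrightarrow> 0"
  proof -
    have "(\<lambda>n. measure_pmf.expectation (noise_pair (V n) (1 / 128)) (\<lambda>(\<omega>, \<omega>'). f n \<omega> * f n \<omega>')
        - (measure_pmf.expectation (uniform_config (V n)) (f n))\<^sup>2) \<longlonglongrightarrow> 0"
      using assms(5) unfolding noise_sensitive_def by simp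
    thus ?thesis
      by (simp add: expectation_noise_pair[OF fin] expectation_uniform_config[OF fin] \<beta>_def[abs_def] h_def[abs_def])
  qed
  have "e \<longlonglongrightarrow> 0"
  \<comment> \<open>The sets increase, so their sizes either tend to infinity or stay bounded; the
    estimates on the scale of the square root of the size serve the first case only.\<close>
  proof (cases "filterlim (\<lambda>n. card (V n)) at_top sequentially")
    case True
    have sq: "filterlim (\<lambda>n. sqrt (card (V n))) at_top sequentially"
      by (intro filterlim_compose[OF sqrt_at_top] filterlim_compose[OF filterlim_real_sequentially True])
    have inv: "(\<lambda>n. 1088 / real (card (V n))) \<longlonglongrightarrow> 0"
      by (intro real_tendsto_divide_at_top[OF tendsto_const] filterlim_compose[OF filterlim_real_sequentially True])
    show ?thesis
    proof (rule LIMSEQ_I)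
      fix r :: real assume r: "r > 0"
      \<comment> \<open>Makes the part \<open>7 / M\<^sup>2\<close> of the error less than
        \<open>r / 2\<close>; with \<open>M\<close> fixed, the other terms vanish as
        \<open>n\<close> grows.\<close>
      define M where "M = max 1 (sqrt (14 / r) + 1)"
      have M1: "M \<ge> 1" by (simp add: M_def)
      have "14 / r < M\<^sup>2"
      proof -
        have "sqrt (14 / r) < M" by (simp add: M_def)
        thus ?thesis using r by (metis real_sqrt_less_iff real_sqrt_abs abs_of_nonneg M1 order_trans zero_le_one)
      qed
      hence M2: "7 / M\<^sup>2 < r / 2"
        using r M1 by (simp add: field_simps)
      define b where "b n = 7 / M\<^sup>2 + 2 * (1088 / real (card (V n))) + \<beta> n + 4 * sqrt (\<beta> n) / tail_const (3 * M + 1)" for n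
      have "b \<longlonglongrightarrow> 7 / M\<^sup>2 + 2 * 0 + 0 + 4 * sqrt 0 / tail_const (3 * M + 1)"
        unfolding b_def using tail_const_pos[of "3 * M + 1"] by (intro tendsto_intros inv \<beta>) auto
      hence "\<forall>\<^sub>F n in sequentially. b n < r"
        using M2 r by (intro order_tendstoD(2)[where y = "7 / M\<^sup>2"]) auto
      moreover have "\<forall>\<^sub>F n in sequentially. 24 * M + 36 \<le> sqrt (card (V n))"
        using sq unfolding filterlim_at_top by blast
      ultimately have "\<forall>\<^sub>F n in sequentially. \<bar>e n\<bar> < r"
      proof eventually_elim
        case (elim n)
        have ne: "V n \<noteq> {}" using elim(2) M1 by auto
        have "\<bar>e n\<bar> \<le> b n"
          unfolding e_def b_def \<beta>_def
        proof (rule noise_implies_exclusion_bound[OF fin M1 elim(2) h_mono h_abs])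
          show "0 \<le> perm_law (V n) (1 / 16) \<sigma>" for \<sigma> by (simp add: perm_law_def)
          show "(\<Sum>\<sigma> | \<sigma> permutes V n. perm_law (V n) (1 / 16) \<sigma>) = 1" by (rule perm_law_total[OF fin])
          show "perm_law (V n) (1 / 16) (\<tau> \<circ> \<sigma> \<circ> inv \<tau>) = perm_law (V n) (1 / 16) \<sigma>"
            if "\<sigma> permutes V n" "\<tau> permutes V n" for \<sigma> \<tau>
            by (rule perm_law_conj[OF fin ne refl refl that])
          show "(\<Sum>\<sigma> | \<sigma> permutes V n. if card (V n) / 512 \<le> card (S - \<sigma> ` S) \<and> card (S - \<sigma> ` S) \<le> card (V n) / 8
              then 0 else perm_law (V n) (1 / 16) \<sigma>) \<le> 1088 / real (card (V n))"
            if "S \<subseteq> V n" "card (V n) / 4 \<le> card S" "card S \<le> 3 * card (V n) / 4" for S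
            using displacement_bound[OF fin ne refl refl that(1,2)] that(3) by simp
        qed auto
        thus ?case using elim(1) by simp
      qed
      thus "\<exists>no. \<forall>n\<ge>no. norm (e n - 0) < r"
        by (simp add: eventually_sequentially)
    qed
  next
    case False
    have "\<exists>N. \<forall>n. card (V n) \<le> N"
    proof (rule ccontr)
      assume unb: "\<nexists>N. \<forall>n. card (V n) \<le> N"
      have "\<forall>\<^sub>F n in sequentially. N \<le> card (V n)" for N
      proof -
        obtain m where m: "N < card (V m)" using unb by (meson not_le)
        have "N \<le> card (V n)" if "n \<ge> m" for n
        proof -
          have "card (V m) \<le> card (V n)"
            using fin incseqD[OF assms(2) that] by (intro card_mono)
          thus ?thesis using m by simp
        qed
        thus ?thesis unfolding eventually_sequentially by blast
      qed
      thus False using False unfolding filterlim_at_top by blast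
    qed
    then obtain N where N: "\<And>n. card (V n) \<le> N" by blast
    \<comment> \<open>\<open>127 / 256\<close> is \<open>(1 - 1 / 128) / 2\<close>, the base of the
      lower bound for a non-constant function; the exponent \<open>N\<close> covers all sizes at
      once.\<close>
    define b where "b = ((127 :: real) / 256) ^ N"
    have "b > 0" by (simp add: b_def)
    hence "\<forall>\<^sub>F n in sequentially. \<beta> n < b"
      using \<beta> by (intro order_tendstoD(2)[where y = 0]) auto
    hence "\<forall>\<^sub>F n in sequentially. e n = 0"
    proof eventually_elim
      case (elim n)
      have const: "h n X = h n {}" if X: "X \<subseteq> V n" for X
      proof (rule ccontr)
        assume "h n X \<noteq> h n {}"
        hence "h n X = 1 \<and> h n {} = -1 \<or> h n {} = 1 \<and> h n X = -1"
          using h_val[of n X] h_val[of n "{}"] by auto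
        hence "((1 - 1 / 128) / 2) ^ card (V n) \<le> \<beta> n"
          unfolding \<beta>_def using X by (elim disjE conjE) (rule noise_correlation_nonconstant[OF fin _ _ h_val]; simp)+
        moreover have "b \<le> ((1 - 1 / 128) / 2) ^ card (V n)"
          unfolding b_def using N[of n] power_decreasing[of "card (V n)" N "127 / 256 :: real"] by simp
        ultimately show False using elim by linarith
      qed
      have "av (V n) (h n) = av (V n) (\<lambda>_. h n {})"
        by (rule bav_cong) (rule const)
      hence c: "av (V n) (h n) = h n {}"
        by (simp add: bav_const[OF fin])
      have "av (V n) (\<lambda>S. h n S * h n (\<sigma> ` S)) = h n {} * h n {}" if \<sigma>: "\<sigma> permutes V n" for \<sigma>
      proof -
        have "av (V n) (\<lambda>S. h n S * h n (\<sigma> ` S)) = av (V n) (\<lambda>_. h n {} * h n {})"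
        proof (rule bav_cong)
          fix S assume "S \<subseteq> V n"
          thus "h n S * h n (\<sigma> ` S) = h n {} * h n {}"
            using const[of S] const[OF permutes_image_subset[OF \<sigma>]] by simp
        qed
        thus ?thesis by (simp add: bav_const[OF fin])
      qed
      hence "(\<Sum>\<sigma> | \<sigma> permutes V n. perm_law (V n) (1 / 16) \<sigma> * av (V n) (\<lambda>S. h n S * h n (\<sigma> ` S))) =
          (\<Sum>\<sigma> | \<sigma> permutes V n. perm_law (V n) (1 / 16) \<sigma> * (h n {} * h n {}))"
        by (intro sum.cong) auto
      also have "\<dots> = h n {} * h n {}"
        using perm_law_total[OF fin, of n "1 / 16"] by (simp flip: sum_distrib_right)
      finally show ?case by (simp add: e_def c power2_eq_square)
    qed
    thus ?thesis by (rule tendsto_eventually)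
  qed
  hence "(\<lambda>n. (\<integral>w. f n (fst w) * f n (exclusion_config (V n) (1 / 16) w) \<partial>exclusion_space (V n))
      - (\<integral>w. f n (fst w) \<partial>exclusion_space (V n))\<^sup>2) \<longlonglongrightarrow> 0"
    by (simp add: exclusion_expectation[OF fin] e_def[abs_def] h_def[abs_def])
  thus ?thesis
    unfolding complete_graph_exclusion_sensitive_def by (intro exI[of _ "1 / 16"]) simp
qed

end
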